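(* Let $A=\bigoplus_{n\ge0}A_n$ be a filtered tower of algebras over $\mathbb{C}$, with filtrations $A_n=A_n^{(0)}\supset A_n^{(1)}\supset\cdots$, and suppose that there exists a multiplication $*$ on $G(A)_q=G(A)\otimes_{\mathbb{Z}}\mathbb{Z}[q]$ quantizing $G(A)$ such that: (Q1) $*$ is a well-defined associative product on $G(A)_q$; (Q2) $G(A)_q$, with the product $*$ and the $\mathbb{Z}[q]$-linear extension of the usual coproduct of $G(A)$, is a $q$-twisted Hopf algebra; (Q3) for all $n$, $\beta^{*n}=[A_n]_q=\sum_{i\ge0}q^i\,[A_n^{(i)}/A_n^{(i+1)}]$ in $G(A)_q$. Then for all $n\ge 0$ $$\sum_{i\ge0}q^i\dim_{\mathbb{C}}\left(A_n^{(i)}/A_n^{(i+1)}\right)=r^n\,[n]!,$$ where $r=\dim_{\mathbb{C}}(A_1)$.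
   Context: A tower of algebras is a graded algebra $A=\bigoplus_{n\ge0}A_n$ over $\mathbb{C}$ with (external, associative) multiplication $\rho_{m,n}\colon A_m\otimes A_n\to A_{m+n}$, such that: (1) each $A_n$ is itself a finite-dimensional associative algebra with internal multiplication and unit $1_n$, and $A_0\cong\mathbb{C}$; (2) each $\rho_{m,n}$ is an injective homomorphism of algebras sending $1_m\otimes 1_n$ to $1_{m+n}$; (3) $A_{m+n}$ is projective both as a left and as a right $A_m\otimes A_n$-module via $\rho_{m,n}$. A filtered tower of algebras is a tower of algebras in which each $A_n$ is equipped with a filtration $A_n=A_n^{(0)}\supset A_n^{(1)}\supset\cdots$ by left ideals $A_n^{(k)}$. $G_0(A_n)$ is the Grothendieck group of finitely generated left $A_n$-modules, and $G(A)=\bigoplus_{n\ge0}G_0(A_n)$, with multiplication $[M][N]=[\mathrm{Ind}_{A_m\otimes A_n}^{A_{m+n}}M\otimes N]$ and coproduct $\Delta([N])=\sum_{k+l=n}[\mathrm{Res}^{A_n}_{A_k\otimes A_l}N]$ (for $N$ an $A_n$-module), induction and restriction being along $\rho$. A multiplication on $G(A)\otimes_{\mathbb{Z}}\mathbb{Z}[q]$ (graded, $\mathbb{Z}[q]$-bilinear) quantizes $G(A)$ if it reduces to the usual multiplication of $G(A)$ at $q=1$. (The motivating choice of $*$ is: for $M$ an $A_m$-module and $N$ an $A_n$-module, $[M]*[N]=\sum_{i\ge 0}q^i[I^{(i)}/I^{(i+1)}]$, where $I=\mathrm{Ind}_{A_m\otimes A_n}^{A_{m+n}}M\otimes N$ and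 $I^{(i)}=A_{m+n}^{(i)}\cdot(M\otimes N)$.) A $q$-twisted Hopf algebra is a graded connected algebra $H$ over $\mathbb{Z}[q]$ with a (co)associative graded coproduct $\Delta\colon H\to H\otimes_{\mathbb{Z}[q]}H$ (and the usual unit, counit, antipode) such that $\Delta(ab)=\Delta(a)\cdot_q\Delta(b)$ for all $a,b\in H$, where for homogeneous elements $(a\otimes b)\cdot_q(a'\otimes b')=q^{\deg(b)\deg(a')}\,aa'\otimes bb'$. Let $S^{(1)}_1,\dots,S^{(1)}_t$ be the simple $A_1$-modules up to isomorphism, with projective covers $P^{(1)}_1,\dots,P^{(1)}_t$. Then $\beta=\sum_{i=1}^t \dim(P^{(1)}_i)\,[S^{(1)}_i]\in G_0(A_1)$, and $\beta^{*n}$ is its $n$-th power under $*$. $[k]=1+q+\cdots+q^{k-1}$ and $[n]!=[n][n-1]\cdots[1]$. *)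

theory Defs
  imports
    "HOL-Algebra.Algebra"
    "HOL-Computational_Algebra.Polynomial"
    "Jordan_Normal_Form.VS_Connect"
begin

hide_const (open) Polynomial.smult Modules.module

section \<open>Left modules\<close>

text \<open>
  \<^const>\<open>Module.module\<close> is restricted to commutative rings. The record type is
  reused for modules over arbitrary rings; its fields \<^const>\<open>monoid.mult\<close> and
  \<^const>\<open>monoid.one\<close> carry no meaning for a module.
\<close>

locale left_module = R?: ring R + M?: abelian_group M
  for R :: "('r, 'x) ring_scheme" (structure) and M :: "('r, 'm) module" (structure) +
  assumes smult_closed: "\<lbrakk>a \<in> carrier R; x \<in> carrier M\<rbrakk> \<Longrightarrow> a \<odot>\<^bsub>M\<^esub> x \<in> carrier M"
    and smult_l_distr: "\<lbrakk>a \<in> carrier R; b \<in> carrier R; x \<in> carrier M\<rbrakk> \<Longrightarrow>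
      (a \<oplus>\<^bsub>R\<^esub> b) \<odot>\<^bsub>M\<^esub> x = a \<odot>\<^bsub>M\<^esub> x \<oplus>\<^bsub>M\<^esub> b \<odot>\<^bsub>M\<^esub> x"
    and smult_r_distr: "\<lbrakk>a \<in> carrier R; x \<in> carrier M; y \<in> carrier M\<rbrakk> \<Longrightarrow>
      a \<odot>\<^bsub>M\<^esub> (x \<oplus>\<^bsub>M\<^esub> y) = a \<odot>\<^bsub>M\<^esub> x \<oplus>\<^bsub>M\<^esub> a \<odot>\<^bsub>M\<^esub> y"
    and smult_assoc: "\<lbrakk>a \<in> carrier R; b \<in> carrier R; x \<in> carrier M\<rbrakk> \<Longrightarrow>
      (a \<otimes>\<^bsub>R\<^esub> b) \<odot>\<^bsub>M\<^esub> x = a \<odot>\<^bsub>M\<^esub> (b \<odot>\<^bsub>M\<^esub> x)"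
    and smult_one: "x \<in> carrier M \<Longrightarrow> \<one>\<^bsub>R\<^esub> \<odot>\<^bsub>M\<^esub> x = x"

text \<open>The additive group of \<open>M\<close> with scalars acting through \<open>f\<close>.\<close>

definition with_action :: "('m, 'x) ring_scheme \<Rightarrow> ('r \<Rightarrow> 'm \<Rightarrow> 'm) \<Rightarrow> ('r, 'm) module" where
  "with_action M f = \<lparr>carrier = carrier M, monoid.mult = monoid.mult M, monoid.one = monoid.one M,
     ring.zero = ring.zero M, ring.add = ring.add M, smult = f\<rparr>"

definition regular_module :: "('r, 'x) ring_scheme \<Rightarrow> ('r, 'r) module" where
  "regular_module R = with_action R (monoid.mult R)"

definition restrict_scalars :: "('s \<Rightarrow> 'r) \<Rightarrow> ('r, 'm) module \<Rightarrow> ('s, 'm) module" where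
  "restrict_scalars \<phi> M = with_action M (\<lambda>s x. \<phi> s \<odot>\<^bsub>M\<^esub> x)"

definition opposite_ring :: "('r, 'x) ring_scheme \<Rightarrow> 'r ring" where
  "opposite_ring R = \<lparr>carrier = carrier R, monoid.mult = (\<lambda>x y. y \<otimes>\<^bsub>R\<^esub> x), monoid.one = monoid.one R,
     ring.zero = ring.zero R, ring.add = ring.add R\<rparr>"

definition quotient_module :: "('r, 'm) module \<Rightarrow> 'm set \<Rightarrow> ('r, 'm set) module" where
  "quotient_module M N = \<lparr>carrier = a_rcosets\<^bsub>M\<^esub> N, monoid.mult = undefined, monoid.one = undefined,
     ring.zero = N, ring.add = set_add M, smult = (\<lambda>r B. set_add M N ((\<lambda>x. r \<odot>\<^bsub>M\<^esub> x) ` B))\<rparr>"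

definition module_iso :: "('r, 'x) ring_scheme \<Rightarrow> ('r, 'm) module \<Rightarrow> ('r, 'n) module \<Rightarrow> bool" where
  "module_iso R M N \<longleftrightarrow> (\<exists>f \<in> module_hom R M N. bij_betw f (carrier M) (carrier N))"

definition fg_module :: "('r, 'x) ring_scheme \<Rightarrow> ('r, 'm) module \<Rightarrow> bool" where
  "fg_module R M \<longleftrightarrow> left_module R M \<and>
     (\<exists>B. finite B \<and> B \<subseteq> carrier M \<and>
        (\<forall>N. Module.submodule N R M \<and> B \<subseteq> N \<longrightarrow> N = carrier M))"

definition short_exact ::
  "('r, 'x) ring_scheme \<Rightarrow> ('r, 'l) module \<Rightarrow> ('r, 'm) module \<Rightarrow> ('r, 'n) module \<Rightarrow> bool" where
  "short_exact R L M N \<longleftrightarrow>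
     (\<exists>f \<in> module_hom R L M. \<exists>g \<in> module_hom R M N.
        inj_on f (carrier L) \<and> g ` carrier M = carrier N \<and> f ` carrier L = a_kernel M N g)"

definition simple_module :: "('r, 'x) ring_scheme \<Rightarrow> ('r, 'm) module \<Rightarrow> bool" where
  "simple_module R S \<longleftrightarrow> left_module R S \<and> carrier S \<noteq> {\<zero>\<^bsub>S\<^esub>} \<and>
     (\<forall>N. Module.submodule N R S \<longrightarrow> N = {\<zero>\<^bsub>S\<^esub>} \<or> N = carrier S)"

definition free_module :: "('r, 'x) ring_scheme \<Rightarrow> 'i set \<Rightarrow> ('r, 'i \<Rightarrow> 'r) module" where
  "free_module R I = \<lparr>carrier = {f \<in> I \<rightarrow>\<^sub>E carrier R. finite {i \<in> I. f i \<noteq> \<zero>\<^bsub>R\<^esub>}},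
     monoid.mult = undefined, monoid.one = undefined, ring.zero = (\<lambda>i\<in>I. \<zero>\<^bsub>R\<^esub>),
     ring.add = (\<lambda>f g. \<lambda>i\<in>I. f i \<oplus>\<^bsub>R\<^esub> g i), smult = (\<lambda>r f. \<lambda>i\<in>I. r \<otimes>\<^bsub>R\<^esub> f i)\<rparr>"

text \<open>
  Projective means: a direct summand of a free module. A basis indexed by elements of
  \<open>P\<close> is no restriction, since every module is a quotient of the free module on its carrier.
\<close>

definition projective :: "('r, 'x) ring_scheme \<Rightarrow> ('r, 'm) module \<Rightarrow> bool" where
  "projective R P \<longleftrightarrow> left_module R P \<and>
     (\<exists>I :: 'm set. \<exists>s \<in> module_hom R P (free_module R I). \<exists>p \<in> module_hom R (free_module R I) P.
        \<forall>x \<in> carrier P. p (s x) = x)"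

definition projective_cover :: "('r, 'x) ring_scheme \<Rightarrow> ('r, 'p) module \<Rightarrow> ('r, 'm) module \<Rightarrow> bool" where
  "projective_cover R P M \<longleftrightarrow> projective R P \<and> left_module R M \<and>
     (\<exists>\<pi> \<in> module_hom R P M. \<pi> ` carrier P = carrier M \<and>
        (\<forall>N. Module.submodule N R P \<and> set_add P N (a_kernel P M \<pi>) = carrier P \<longrightarrow> N = carrier P))"

section \<open>Abelian groups by generators and relations\<close>

definition presented_group :: "'x set \<Rightarrow> ('x \<Rightarrow>\<^sub>0 int) set \<Rightarrow> ('x \<Rightarrow>\<^sub>0 int) set monoid" where
  "presented_group Gen E = free_Abelian_group Gen Mod generate (free_Abelian_group Gen) E"

definition gen_class :: "'x set \<Rightarrow> ('x \<Rightarrow>\<^sub>0 int) set \<Rightarrow> 'x \<Rightarrow> ('x \<Rightarrow>\<^sub>0 int) set" where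
  "gen_class Gen E x = generate (free_Abelian_group Gen) E #>\<^bsub>free_Abelian_group Gen\<^esub> frag_of x"

text \<open>
  The homomorphism from a presented group to the commutative group \<open>P\<close> that sends the
  generator \<open>x\<close> to \<open>\<phi> x\<close>, evaluated on an arbitrary representative of the coset \<open>C\<close>. It
  is independent of the representative whenever \<open>\<phi>\<close> respects the relations.
\<close>

definition extend_gens :: "('b, 'y) monoid_scheme \<Rightarrow> ('x \<Rightarrow> 'b) \<Rightarrow> ('x \<Rightarrow>\<^sub>0 int) set \<Rightarrow> 'b" where
  "extend_gens P \<phi> C = (let c = (SOME c. c \<in> C) in
     finprod P (\<lambda>x. \<phi> x [^]\<^bsub>P\<^esub> Poly_Mapping.lookup c x) (Poly_Mapping.keys c))"

section \<open>Tensor products\<close>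

type_synonym ('m, 'n) tensor = "('m \<times> 'n \<Rightarrow>\<^sub>0 int) set"

text \<open>
  \<open>M\<close> is a right \<open>R\<close>-module, with \<open>r \<odot>\<^bsub>M\<^esub> x\<close> standing for \<open>x \<cdot> r\<close>;
  \<open>N\<close> is a left \<open>R\<close>-module.
\<close>

definition tensor_rels ::
  "('r, 'x) ring_scheme \<Rightarrow> ('r, 'm) module \<Rightarrow> ('r, 'n) module \<Rightarrow> ('m \<times> 'n \<Rightarrow>\<^sub>0 int) set" where
  "tensor_rels R M N =
     {frag_of (x \<oplus>\<^bsub>M\<^esub> x', y) - frag_of (x, y) - frag_of (x', y) | x x' y.
        x \<in> carrier M \<and> x' \<in> carrier M \<and> y \<in> carrier N} \<union>
     {frag_of (x, y \<oplus>\<^bsub>N\<^esub> y') - frag_of (x, y) - frag_of (x, y') | x y y'.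
        x \<in> carrier M \<and> y \<in> carrier N \<and> y' \<in> carrier N} \<union>
     {frag_of (r \<odot>\<^bsub>M\<^esub> x, y) - frag_of (x, r \<odot>\<^bsub>N\<^esub> y) | r x y.
        r \<in> carrier R \<and> x \<in> carrier M \<and> y \<in> carrier N}"

definition tensor_group ::
  "('r, 'x) ring_scheme \<Rightarrow> ('r, 'm) module \<Rightarrow> ('r, 'n) module \<Rightarrow> ('m, 'n) tensor monoid" where
  "tensor_group R M N = presented_group (carrier M \<times> carrier N) (tensor_rels R M N)"

definition pure_tensor ::
  "('r, 'x) ring_scheme \<Rightarrow> ('r, 'm) module \<Rightarrow> ('r, 'n) module \<Rightarrow> 'm \<Rightarrow> 'n \<Rightarrow> ('m, 'n) tensor" where
  "pure_tensor R M N x y = gen_class (carrier M \<times> carrier N) (tensor_rels R M N) (x, y)"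

text \<open>The additive map \<open>x \<otimes> y \<mapsto> f x y\<close> into the additive group of \<open>P\<close>.\<close>

definition tensor_lift :: "('b, 'z) ring_scheme \<Rightarrow> ('m \<Rightarrow> 'n \<Rightarrow> 'b) \<Rightarrow> ('m, 'n) tensor \<Rightarrow> 'b" where
  "tensor_lift P f = extend_gens (add_monoid P) (\<lambda>(x, y). f x y)"

text \<open>
  The tensor product over \<open>R\<close> with scalars \<open>s\<close> acting on pure tensors by
  \<open>x \<otimes> y \<mapsto> x' \<otimes> y'\<close>, where \<open>(x', y') = act s (x, y)\<close>.
\<close>

definition tensor_with_action ::
  "('r, 'x) ring_scheme \<Rightarrow> ('r, 'm) module \<Rightarrow> ('r, 'n) module \<Rightarrow> ('s \<Rightarrow> 'm \<times> 'n \<Rightarrow> 'm \<times> 'n) \<Rightarrow>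
     ('s, ('m, 'n) tensor) module" where
  "tensor_with_action R M N act = (let G = tensor_group R M N in
     \<lparr>carrier = carrier G, monoid.mult = undefined, monoid.one = undefined,
      ring.zero = monoid.one G, ring.add = monoid.mult G,
      smult = (\<lambda>s. extend_gens G (\<lambda>z. case act s z of (x, y) \<Rightarrow> pure_tensor R M N x y))\<rparr>)"

text \<open>Over a commutative ring.\<close>

definition tensor_module ::
  "('r, 'x) ring_scheme \<Rightarrow> ('r, 'm) module \<Rightarrow> ('r, 'n) module \<Rightarrow> ('r, ('m, 'n) tensor) module" where
  "tensor_module R M N = tensor_with_action R M N (\<lambda>r (x, y). (r \<odot>\<^bsub>M\<^esub> x, y))"

section \<open>Algebras over the complex numbers and their modules\<close>

type_synonym 'a calg = "(complex, 'a) module"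

abbreviation complex_ring :: "complex ring" where
  "complex_ring \<equiv> class_ring"

definition fd_algebra :: "'a calg \<Rightarrow> bool" where
  "fd_algebra A \<longleftrightarrow> ring A \<and> vectorspace complex_ring A \<and> vectorspace.fin_dim complex_ring A \<and>
     (\<forall>c. \<forall>x \<in> carrier A. \<forall>y \<in> carrier A.
        (c \<odot>\<^bsub>A\<^esub> x) \<otimes>\<^bsub>A\<^esub> y = c \<odot>\<^bsub>A\<^esub> (x \<otimes>\<^bsub>A\<^esub> y) \<and>
        x \<otimes>\<^bsub>A\<^esub> (c \<odot>\<^bsub>A\<^esub> y) = c \<odot>\<^bsub>A\<^esub> (x \<otimes>\<^bsub>A\<^esub> y))"

definition alg_hom :: "'a calg \<Rightarrow> 'b calg \<Rightarrow> ('a \<Rightarrow> 'b) set" where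
  "alg_hom A B = Ring.ring_hom A B \<inter> module_hom complex_ring A B"

definition ground_algebra :: "complex calg" where
  "ground_algebra = regular_module complex_ring"

text \<open>The complex vector space underlying an \<open>A\<close>-module, and its dimension.\<close>

definition underlying_space :: "'a calg \<Rightarrow> ('a, 'm) module \<Rightarrow> (complex, 'm) module" where
  "underlying_space A M = restrict_scalars (\<lambda>c. c \<odot>\<^bsub>A\<^esub> \<one>\<^bsub>A\<^esub>) M"

definition mdim :: "'a calg \<Rightarrow> ('a, 'm) module \<Rightarrow> nat" where
  "mdim A M = vectorspace.dim complex_ring (underlying_space A M)"

definition tensor_algebra :: "'a calg \<Rightarrow> 'b calg \<Rightarrow> ('a, 'b) tensor calg" where
  "tensor_algebra A B = (let T = tensor_module complex_ring A B in
     T\<lparr>monoid.mult := (\<lambda>s t. tensor_lift T (\<lambda>a b. tensor_lift T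
          (\<lambda>a' b'. pure_tensor complex_ring A B (a \<otimes>\<^bsub>A\<^esub> a') (b \<otimes>\<^bsub>B\<^esub> b')) t) s),
       monoid.one := pure_tensor complex_ring A B \<one>\<^bsub>A\<^esub> \<one>\<^bsub>B\<^esub>\<rparr>)"

text \<open>The \<open>A \<otimes> B\<close>-module \<open>M \<otimes> N\<close> for an \<open>A\<close>-module \<open>M\<close> and a \<open>B\<close>-module \<open>N\<close>.\<close>

definition outer_tensor ::
  "'a calg \<Rightarrow> 'b calg \<Rightarrow> ('a, 'm) module \<Rightarrow> ('b, 'n) module \<Rightarrow>
     (('a, 'b) tensor, ('m, 'n) tensor) module" where
  "outer_tensor A B M N =
     (let V = underlying_space A M; W = underlying_space B N; T = tensor_module complex_ring V W in
      with_action T (\<lambda>t u. tensor_lift T (\<lambda>a b. tensor_lift T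
        (\<lambda>x y. pure_tensor complex_ring V W (a \<odot>\<^bsub>M\<^esub> x) (b \<odot>\<^bsub>N\<^esub> y)) u) t))"

text \<open>\<open>C \<otimes>\<^bsub>A \<otimes> B\<^esub> (M \<otimes> N)\<close> along \<open>\<phi> : A \<otimes> B \<rightarrow> C\<close>, with \<open>C\<close> acting by left multiplication.\<close>

definition induced_module ::
  "'a calg \<Rightarrow> 'b calg \<Rightarrow> 'c calg \<Rightarrow> (('a, 'b) tensor \<Rightarrow> 'c) \<Rightarrow> ('a, 'm) module \<Rightarrow> ('b, 'n) module \<Rightarrow>
     ('c, ('c, ('m, 'n) tensor) tensor) module" where
  "induced_module A B C \<phi> M N =
     tensor_with_action (tensor_algebra A B)
       (with_action C (\<lambda>t c. c \<otimes>\<^bsub>C\<^esub> \<phi> t)) (outer_tensor A B M N)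
       (\<lambda>c (d, u). (c \<otimes>\<^bsub>C\<^esub> d, u))"

section \<open>Grothendieck groups\<close>

text \<open>
  Every finitely generated \<open>R\<close>-module is isomorphic to one whose elements are cosets in some
  \<open>R\<^sup>k\<close>, that is, sets of lists over \<open>R\<close>. Hence modules on this type suffice to generate the
  Grothendieck group. Isomorphic modules get the same class because of the exact sequences
  \<open>0 \<rightarrow> L \<rightarrow> M \<rightarrow> 0 \<rightarrow> 0\<close>.
\<close>

type_synonym 'r umodule = "('r, 'r list set) module"
type_synonym 'r groth = "('r umodule \<Rightarrow>\<^sub>0 int) set"

definition fg_modules :: "('r, 'x) ring_scheme \<Rightarrow> 'r umodule set" where
  "fg_modules R = {M. fg_module R M}"

definition G0_rels :: "('r, 'x) ring_scheme \<Rightarrow> ('r umodule \<Rightarrow>\<^sub>0 int) set" where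
  "G0_rels R = {frag_of M - frag_of L - frag_of N | L M N.
     L \<in> fg_modules R \<and> M \<in> fg_modules R \<and> N \<in> fg_modules R \<and> short_exact R L M N}"

definition G0 :: "('r, 'x) ring_scheme \<Rightarrow> 'r groth monoid" where
  "G0 R = presented_group (fg_modules R) (G0_rels R)"

definition G0_class :: "('r, 'x) ring_scheme \<Rightarrow> ('r, 'm) module \<Rightarrow> 'r groth" where
  "G0_class R M =
     gen_class (fg_modules R) (G0_rels R) (SOME U. U \<in> fg_modules R \<and> module_iso R U M)"

text \<open>The biadditive map \<open>([M], [N]) \<mapsto> [M \<otimes> N]\<close>.\<close>

definition G0_outer :: "'a calg \<Rightarrow> 'b calg \<Rightarrow> 'a groth \<Rightarrow> 'b groth \<Rightarrow> ('a, 'b) tensor groth" where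
  "G0_outer A B x y = (let T = tensor_algebra A B in
     extend_gens (G0 T) (\<lambda>M. extend_gens (G0 T) (\<lambda>N. G0_class T (outer_tensor A B M N)) y) x)"

section \<open>Towers of algebras\<close>

text \<open>
  All \<open>A n\<close> have their carriers in one type \<open>'a\<close>. That \<open>\<rho> 0 n (\<one> \<otimes> a) = a\<close> follows from the
  axioms: this map is injective and, by associativity, idempotent.
\<close>

locale tower_of_algebras =
  fixes A :: "nat \<Rightarrow> 'a calg" and \<rho> :: "nat \<Rightarrow> nat \<Rightarrow> ('a, 'a) tensor \<Rightarrow> 'a"
  assumes fd_algebra: "fd_algebra (A n)"
    and degree_zero: "\<exists>h \<in> alg_hom ground_algebra (A 0). bij_betw h UNIV (carrier (A 0))"
    and rho_hom: "\<rho> m n \<in> alg_hom (tensor_algebra (A m) (A n)) (A (m + n))"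
    and rho_inj: "inj_on (\<rho> m n) (carrier (tensor_algebra (A m) (A n)))"
    and rho_assoc: "\<lbrakk>a \<in> carrier (A l); b \<in> carrier (A m); c \<in> carrier (A n)\<rbrakk> \<Longrightarrow>
      \<rho> (l + m) n (pure_tensor complex_ring (A (l + m)) (A n)
                     (\<rho> l m (pure_tensor complex_ring (A l) (A m) a b)) c) =
      \<rho> l (m + n) (pure_tensor complex_ring (A l) (A (m + n))
                     a (\<rho> m n (pure_tensor complex_ring (A m) (A n) b c)))"
    and left_projective: "projective (tensor_algebra (A m) (A n))
      (restrict_scalars (\<rho> m n) (regular_module (A (m + n))))"
    and right_projective: "projective (opposite_ring (tensor_algebra (A m) (A n)))
      (with_action (A (m + n)) (\<lambda>t x. x \<otimes>\<^bsub>A (m + n)\<^esub> \<rho> m n t))"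

locale filtered_tower = tower_of_algebras A \<rho>
  for A :: "nat \<Rightarrow> 'a calg" and \<rho> +
  fixes F :: "nat \<Rightarrow> nat \<Rightarrow> 'a set"
  assumes filtration_zero: "F n 0 = carrier (A n)"
    and filtration_Suc: "F n (Suc k) \<subseteq> F n k"
    and filtration_left_ideal: "Module.submodule (F n k) (A n) (regular_module (A n))"

definition gr_module :: "(nat \<Rightarrow> 'a calg) \<Rightarrow> (nat \<Rightarrow> nat \<Rightarrow> 'a set) \<Rightarrow> nat \<Rightarrow> nat \<Rightarrow> ('a, 'a set) module" where
  "gr_module A F n i = quotient_module ((regular_module (A n))\<lparr>carrier := F n i\<rparr>) (F n (Suc i))"

text \<open>
  The indices with \<open>A\<^sub>n\<^sup>(\<^sup>i\<^sup>)/A\<^sub>n\<^sup>(\<^sup>i\<^sup>+\<^sup>1\<^sup>) \<noteq> 0\<close>; they are finitely many because \<open>A n\<close> is finite-dimensional,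
  so that a sum over all \<open>i\<close> is a sum over these.
\<close>

definition jumps :: "(nat \<Rightarrow> nat \<Rightarrow> 'a set) \<Rightarrow> nat \<Rightarrow> nat set" where
  "jumps F n = {i. F n i \<noteq> F n (Suc i)}"

section \<open>The groups \<open>G(A)\<close> and \<open>G(A)\<^sub>q\<close>\<close>

definition qvar :: "int poly" where
  "qvar = [:0, 1:]"

definition q_int :: "nat \<Rightarrow> int poly" where
  "q_int k = (\<Sum>i<k. qvar ^ i)"

definition q_fact :: "nat \<Rightarrow> int poly" where
  "q_fact n = (\<Prod>k = 1..n. q_int k)"

abbreviation Zq :: "int poly ring" where
  "Zq \<equiv> class_ring"

text \<open>A commutative group in multiplicative notation as a module over the integers.\<close>

definition int_module :: "('g, 'x) monoid_scheme \<Rightarrow> (int, 'g) module" where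
  "int_module G = \<lparr>carrier = carrier G, monoid.mult = undefined, monoid.one = undefined,
     ring.zero = monoid.one G, ring.add = monoid.mult G, smult = (\<lambda>k x. x [^]\<^bsub>G\<^esub> k)\<rparr>"

definition GA :: "(nat \<Rightarrow> 'a calg) \<Rightarrow> (nat \<Rightarrow> 'a groth) monoid" where
  "GA A = sum_group UNIV (\<lambda>n. G0 (A n))"

definition in_degree :: "(nat \<Rightarrow> 'a calg) \<Rightarrow> nat \<Rightarrow> 'a groth \<Rightarrow> nat \<Rightarrow> 'a groth" where
  "in_degree A n x = (\<lambda>m. if m = n then x else \<one>\<^bsub>G0 (A m)\<^esub>)"

type_synonym 'a gq = "(nat \<Rightarrow> 'a groth, int poly) tensor"

definition Zq_int_module :: "(int, int poly) module" where
  "Zq_int_module = with_action Zq (\<lambda>k p. of_int k * p)"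

definition Gq :: "(nat \<Rightarrow> 'a calg) \<Rightarrow> (int poly, 'a gq) module" where
  "Gq A = tensor_with_action \<Z> (int_module (GA A)) Zq_int_module (\<lambda>p (x, f). (x, p * f))"

definition Gq_pure :: "(nat \<Rightarrow> 'a calg) \<Rightarrow> (nat \<Rightarrow> 'a groth) \<Rightarrow> int poly \<Rightarrow> 'a gq" where
  "Gq_pure A = pure_tensor \<Z> (int_module (GA A)) Zq_int_module"

definition Gq_class :: "(nat \<Rightarrow> 'a calg) \<Rightarrow> nat \<Rightarrow> ('a, 'm) module \<Rightarrow> 'a gq" where
  "Gq_class A n M = Gq_pure A (in_degree A n (G0_class (A n) M)) 1"

definition Gq_degree :: "(nat \<Rightarrow> 'a calg) \<Rightarrow> nat \<Rightarrow> 'a gq set" where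
  "Gq_degree A n = generate (add_monoid (Gq A))
     {Gq_pure A (in_degree A n x) p | x p. x \<in> carrier (G0 (A n))}"

text \<open>\<open>G(A)\<^sub>q\<close> with multiplication \<open>star\<close>; the unit is the usual one of \<open>G(A)\<close>, the class of \<open>A\<^sub>0\<close>.\<close>

definition Gq_algebra :: "(nat \<Rightarrow> 'a calg) \<Rightarrow> ('a gq \<Rightarrow> 'a gq \<Rightarrow> 'a gq) \<Rightarrow> (int poly, 'a gq) module" where
  "Gq_algebra A star = (Gq A)\<lparr>monoid.mult := star, monoid.one := Gq_class A 0 (regular_module (A 0))\<rparr>"

definition Gq_filtered_class :: "(nat \<Rightarrow> 'a calg) \<Rightarrow> (nat \<Rightarrow> nat \<Rightarrow> 'a set) \<Rightarrow> nat \<Rightarrow> 'a gq" where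
  "Gq_filtered_class A F n =
     finsum (Gq A) (\<lambda>i. qvar ^ i \<odot>\<^bsub>Gq A\<^esub> Gq_class A n (gr_module A F n i)) (jumps F n)"

section \<open>Quantized multiplications\<close>

definition bilinear_mult :: "(int poly, 'h) module \<Rightarrow> ('h \<Rightarrow> 'h \<Rightarrow> 'h) \<Rightarrow> bool" where
  "bilinear_mult H m \<longleftrightarrow>
     (\<forall>x \<in> carrier H. (\<lambda>y. m x y) \<in> module_hom Zq H H \<and> (\<lambda>y. m y x) \<in> module_hom Zq H H)"

definition graded_mult :: "(nat \<Rightarrow> 'h set) \<Rightarrow> ('h \<Rightarrow> 'h \<Rightarrow> 'h) \<Rightarrow> bool" where
  "graded_mult Hn m \<longleftrightarrow> (\<forall>k l. \<forall>x \<in> Hn k. \<forall>y \<in> Hn l. m x y \<in> Hn (k + l))"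

text \<open>Reduction at \<open>q = 1\<close> is reduction modulo \<open>(q - 1) G(A)\<^sub>q\<close>.\<close>

definition quantizes ::
  "(nat \<Rightarrow> 'a calg) \<Rightarrow> (nat \<Rightarrow> nat \<Rightarrow> ('a, 'a) tensor \<Rightarrow> 'a) \<Rightarrow> ('a gq \<Rightarrow> 'a gq \<Rightarrow> 'a gq) \<Rightarrow> bool" where
  "quantizes A \<rho> star \<longleftrightarrow> bilinear_mult (Gq A) star \<and> graded_mult (Gq_degree A) star \<and>
     (\<forall>m n. \<forall>M \<in> fg_modules (A m). \<forall>N \<in> fg_modules (A n). \<exists>z \<in> carrier (Gq A).
        star (Gq_class A m M) (Gq_class A n N) =
        Gq_class A (m + n) (induced_module (A m) (A n) (A (m + n)) (\<rho> m n) M N)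
          \<oplus>\<^bsub>Gq A\<^esub> (qvar - 1) \<odot>\<^bsub>Gq A\<^esub> z)"

section \<open>The coproduct\<close>

text \<open>The \<open>(k, l)\<close> component \<open>G(A) \<otimes> G(A) \<rightarrow> G\<^sub>0(A\<^sub>k \<otimes> A\<^sub>l)\<close> of the canonical isomorphism of
  \<open>G(A) \<otimes> G(A)\<close> with the direct sum of all \<open>G\<^sub>0(A\<^sub>k \<otimes> A\<^sub>l)\<close>.\<close>

definition GA_canonical ::
  "(nat \<Rightarrow> 'a calg) \<Rightarrow> nat \<Rightarrow> nat \<Rightarrow> (nat \<Rightarrow> 'a groth, nat \<Rightarrow> 'a groth) tensor \<Rightarrow> ('a, 'a) tensor groth" where
  "GA_canonical A k l = extend_gens (G0 (tensor_algebra (A k) (A l)))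
     (\<lambda>(x, y). G0_outer (A k) (A l) (x k) (y l))"

text \<open>
  The usual coproduct of \<open>G(A)\<close>: \<open>\<Delta>([N])\<close>, for an \<open>A\<^sub>n\<close>-module \<open>N\<close>, is the sum of the restrictions
  of \<open>N\<close> over \<open>k + l = n\<close>, transported along the canonical isomorphism.
\<close>

definition usual_coproduct ::
  "(nat \<Rightarrow> 'a calg) \<Rightarrow> (nat \<Rightarrow> nat \<Rightarrow> ('a, 'a) tensor \<Rightarrow> 'a) \<Rightarrow>
     ((nat \<Rightarrow> 'a groth) \<Rightarrow> (nat \<Rightarrow> 'a groth, nat \<Rightarrow> 'a groth) tensor) \<Rightarrow> bool" where
  "usual_coproduct A \<rho> \<delta> \<longleftrightarrow>
     \<delta> \<in> module_hom \<Z> (int_module (GA A)) (tensor_module \<Z> (int_module (GA A)) (int_module (GA A))) \<and>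
     (\<forall>n. \<forall>N \<in> fg_modules (A n). \<forall>k l.
        GA_canonical A k l (\<delta> (in_degree A n (G0_class (A n) N))) =
        (if k + l = n
         then G0_class (tensor_algebra (A k) (A l)) (restrict_scalars (\<rho> k l) N)
         else \<one>\<^bsub>G0 (tensor_algebra (A k) (A l))\<^esub>))"

definition coproduct_q ::
  "(nat \<Rightarrow> 'a calg) \<Rightarrow> (nat \<Rightarrow> nat \<Rightarrow> ('a, 'a) tensor \<Rightarrow> 'a) \<Rightarrow> ('a gq \<Rightarrow> ('a gq, 'a gq) tensor) \<Rightarrow> bool" where
  "coproduct_q A \<rho> \<Delta> \<longleftrightarrow> (\<exists>\<delta>. usual_coproduct A \<rho> \<delta> \<and>
     \<Delta> \<in> module_hom Zq (Gq A) (tensor_module Zq (Gq A) (Gq A)) \<and>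
     (\<forall>x \<in> carrier (GA A). \<Delta> (Gq_pure A x 1) =
        tensor_lift (tensor_module Zq (Gq A) (Gq A))
          (\<lambda>y z. pure_tensor Zq (Gq A) (Gq A) (Gq_pure A y 1) (Gq_pure A z 1)) (\<delta> x)))"

section \<open>\<open>q\<close>-twisted Hopf algebras\<close>

definition twisted_product ::
  "(int poly, 'h) module \<Rightarrow> (nat \<Rightarrow> 'h set) \<Rightarrow>
     (('h, 'h) tensor \<Rightarrow> ('h, 'h) tensor \<Rightarrow> ('h, 'h) tensor) \<Rightarrow> bool" where
  "twisted_product H Hn \<tau> \<longleftrightarrow> bilinear_mult (tensor_module Zq H H) \<tau> \<and>
     (\<forall>i j k l. \<forall>a \<in> Hn i. \<forall>b \<in> Hn j. \<forall>a' \<in> Hn k. \<forall>b' \<in> Hn l.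
        \<tau> (pure_tensor Zq H H a b) (pure_tensor Zq H H a' b') =
        qvar ^ (j * k) \<odot>\<^bsub>tensor_module Zq H H\<^esub> pure_tensor Zq H H (a \<otimes>\<^bsub>H\<^esub> a') (b \<otimes>\<^bsub>H\<^esub> b'))"

locale q_twisted_hopf_algebra =
  fixes H :: "(int poly, 'h) module" (structure)
    and Hn :: "nat \<Rightarrow> 'h set"
    and \<Delta> :: "'h \<Rightarrow> ('h, 'h) tensor"
  fixes HH :: "(int poly, ('h, 'h) tensor) module"
    and pt :: "'h \<Rightarrow> 'h \<Rightarrow> ('h, 'h) tensor"
  defines "HH \<equiv> tensor_module Zq H H"
    and "pt \<equiv> pure_tensor Zq H H"
  assumes ring: "ring H"
    and module: "Module.module Zq H"
    and mult_bilinear: "bilinear_mult H (monoid.mult H)"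
    and degree_submodule: "Module.submodule (Hn n) Zq H"
    and degree_decomposition: "x \<in> carrier H \<Longrightarrow>
      \<exists>!c. (\<forall>n. c n \<in> Hn n) \<and> finite {n. c n \<noteq> \<zero>} \<and> x = finsum H c {n. c n \<noteq> \<zero>}"
    and mult_graded: "graded_mult Hn (monoid.mult H)"
    and connected: "bij_betw (\<lambda>p. p \<odot> \<one>) UNIV (Hn 0)"
    and coproduct_linear: "\<Delta> \<in> module_hom Zq H HH"
    and coproduct_graded: "x \<in> Hn n \<Longrightarrow>
      \<Delta> x \<in> generate (add_monoid HH) {pt a b | a b k l. a \<in> Hn k \<and> b \<in> Hn l \<and> k + l = n}"
    and coassociative: "x \<in> carrier H \<Longrightarrow>
      tensor_lift (tensor_module Zq H HH)
        (\<lambda>a b. tensor_lift (tensor_module Zq H HH)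
          (\<lambda>a' a''. pure_tensor Zq H HH a' (pt a'' b)) (\<Delta> a)) (\<Delta> x) =
      tensor_lift (tensor_module Zq H HH) (\<lambda>a b. pure_tensor Zq H HH a (\<Delta> b)) (\<Delta> x)"
    and coproduct_one: "\<Delta> \<one> = pt \<one> \<one>"
    and counit_antipode: "\<exists>\<epsilon> S.
      \<epsilon> \<in> module_hom Zq H (regular_module Zq) \<and> S \<in> module_hom Zq H H \<and>
      \<epsilon> \<one> = 1 \<and> (\<forall>n > 0. \<forall>x \<in> Hn n. \<epsilon> x = 0) \<and>
      (\<forall>x \<in> carrier H.
         tensor_lift H (\<lambda>a b. \<epsilon> a \<odot> b) (\<Delta> x) = x \<and>
         tensor_lift H (\<lambda>a b. \<epsilon> b \<odot> a) (\<Delta> x) = x \<and>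
         tensor_lift H (\<lambda>a b. S a \<otimes> b) (\<Delta> x) = \<epsilon> x \<odot> \<one> \<and>
         tensor_lift H (\<lambda>a b. a \<otimes> S b) (\<Delta> x) = \<epsilon> x \<odot> \<one>)"
    and coproduct_mult: "\<exists>\<tau>. twisted_product H Hn \<tau> \<and>
      (\<forall>a \<in> carrier H. \<forall>b \<in> carrier H. \<Delta> (a \<otimes> b) = \<tau> (\<Delta> a) (\<Delta> b))"

section \<open>The element \<open>\<beta>\<close>\<close>

definition simple_modules_list :: "('r, 'x) ring_scheme \<Rightarrow> nat \<Rightarrow> (nat \<Rightarrow> ('r, 'm) module) \<Rightarrow> bool" where
  "simple_modules_list R t S \<longleftrightarrow> (\<forall>i<t. simple_module R (S i)) \<and>
     (\<forall>i<t. \<forall>j<t. module_iso R (S i) (S j) \<longrightarrow> i = j) \<and>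
     (\<forall>L :: 'r umodule. simple_module R L \<longrightarrow> (\<exists>i<t. module_iso R (S i) L))"

definition beta ::
  "'a calg \<Rightarrow> nat \<Rightarrow> (nat \<Rightarrow> ('a, 's) module) \<Rightarrow> (nat \<Rightarrow> ('a, 'p) module) \<Rightarrow> 'a groth" where
  "beta A t S P = finprod (G0 A) (\<lambda>i. G0_class A (S i) [^]\<^bsub>G0 A\<^esub> mdim A (P i)) {..<t}"

end

theory Submission
  imports Defs "Jordan_Normal_Form.DL_Rank"
begin

text \<open>
  Dimension of the degree \<open>n\<close> part gives a \<open>\<int>[q]\<close>-linear functional \<open>D\<^sub>n\<close> on \<open>G(A)\<^sub>q\<close>, and
  since restriction preserves dimensions, \<open>(D\<^sub>k \<otimes> D\<^sub>l) \<circ> \<Delta> = D\<^sub>k\<^sub>+\<^sub>l\<close>. The element \<open>\<beta>\<close> is primitive for degree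
  reasons, so the twisted multiplicativity of \<open>\<Delta>\<close> yields
  \<open>(\<phi> \<otimes> D\<^sub>1) (\<Delta> (\<beta>\<^sup>n)) = [n] \<phi> (\<beta>\<^sup>n\<^sup>-\<^sup>1) D\<^sub>1 (\<beta>)\<close> for every functional \<open>\<phi>\<close>, whence
  \<open>D\<^sub>n (\<beta>\<^sup>n) = [n]! D\<^sub>1 (\<beta>)\<^sup>n\<close>. It remains to see that \<open>D\<^sub>1 (\<beta>) = dim A\<^sub>1\<close>. Here \<open>\<le>\<close> is the constant
  coefficient of (Q3) for \<open>n = 1\<close>, which is the dimension of a quotient of \<open>A\<^sub>1\<close>, and \<open>\<ge>\<close> holds for all
  finite-dimensional algebras.
\<close>

section \<open>Presented groups\<close>

text \<open>The product \<open>star\<close> is known only modulo q - 1, so the dimension of a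
  product cannot be read off from induced modules. The coproduct is the classical one extended
  linearly, so the dimensions of its components are exact, and q enters only through the twist in
  the multiplicativity of \<Delta>. Hence the powers of \<beta> are measured through \<Delta>. The
  factor [n] counts the positions of the one factor \<beta> that ends up in the right-hand slot,
  weighted by q for each later factor that has to pass it.

  A filtration may stop short of zero, so the dimensions of the graded pieces of A_1 may add up to
  less than dim A_1, and (Q3) bounds D_1(\<beta>) only from above. The opposite bound is half of the
  classical identity that dim A is the sum of dim S_i dim P_i. It is obtained by enlarging a left
  ideal step by step instead of decomposing the regular module into indecomposable
  projectives.\<close>

definition word_value :: "('b, 'y) monoid_scheme \<Rightarrow> ('x \<Rightarrow> 'b) \<Rightarrow> ('x \<Rightarrow>\<^sub>0 int) \<Rightarrow> 'b" where
  "word_value P \<phi> c = finprod P (\<lambda>x. \<phi> x [^]\<^bsub>P\<^esub> Poly_Mapping.lookup c x) (Poly_Mapping.keys c)"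

text \<open>Indices outside the support contribute zeroth powers. A common index set is what makes
  the values of two words and of their sum comparable.\<close>

lemma word_value_superset:
  assumes "comm_group P" "finite K" "Poly_Mapping.keys c \<subseteq> K" "\<phi> \<in> K \<rightarrow> carrier P"
  shows "word_value P \<phi> c = finprod P (\<lambda>x. \<phi> x [^]\<^bsub>P\<^esub> Poly_Mapping.lookup c x) K"
proof -
  interpret comm_group P by fact
  show ?thesis
    unfolding word_value_def
    by (rule finprod_mono_neutral_cong_left) (use assms in \<open>auto simp: in_keys_iff\<close>)
qed

lemma word_value_hom:
  assumes "comm_group P" "\<phi> \<in> Gen \<rightarrow> carrier P"
  shows "word_value P \<phi> \<in> hom (free_Abelian_group Gen) P"
proof (rule homI)
  interpret comm_group P by fact
  fix c assume c: "c \<in> carrier (free_Abelian_group Gen)"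
  then have "\<phi> \<in> Poly_Mapping.keys c \<rightarrow> carrier P"
    using assms(2) by auto
  then show "word_value P \<phi> c \<in> carrier P"
    unfolding word_value_def by (intro finprod_closed) auto
  fix d assume d: "d \<in> carrier (free_Abelian_group Gen)"
  let ?K = "Poly_Mapping.keys c \<union> Poly_Mapping.keys d"
  have K: "finite ?K" "\<phi> \<in> ?K \<rightarrow> carrier P"
    using c d assms(2) by auto
  have "word_value P \<phi> (c + d) = finprod P (\<lambda>x. \<phi> x [^]\<^bsub>P\<^esub> Poly_Mapping.lookup (c + d) x) ?K"
    by (rule word_value_superset) (use K assms keys_add[of c d] in auto)
  also have "\<dots> = finprod P (\<lambda>x. \<phi> x [^]\<^bsub>P\<^esub> Poly_Mapping.lookup c x \<otimes>\<^bsub>P\<^esub> \<phi> x [^]\<^bsub>P\<^esub> Poly_Mapping.lookup d x) ?K"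
    by (rule finprod_cong') (use K in \<open>auto simp: lookup_add int_pow_mult Pi_iff\<close>)
  also have "\<dots> = word_value P \<phi> c \<otimes>\<^bsub>P\<^esub> word_value P \<phi> d"
    using K assms(1) by (simp add: word_value_superset[of P ?K] finprod_multf Pi_iff)
  finally show "word_value P \<phi> (c \<otimes>\<^bsub>free_Abelian_group Gen\<^esub> d) = word_value P \<phi> c \<otimes>\<^bsub>P\<^esub> word_value P \<phi> d"
    by simp
qed

lemma word_value_frag_of:
  assumes "comm_group P" "\<phi> x \<in> carrier P"
  shows "word_value P \<phi> (frag_of x) = \<phi> x"
proof -
  interpret comm_group P by fact
  show ?thesis
    using assms(2) by (simp add: word_value_def)
qed

lemma word_value_diff:
  assumes "comm_group P" "\<phi> \<in> Gen \<rightarrow> carrier P" "Poly_Mapping.keys c \<subseteq> Gen" "Poly_Mapping.keys d \<subseteq> Gen"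
  shows "word_value P \<phi> (c - d) = word_value P \<phi> c \<otimes>\<^bsub>P\<^esub> inv\<^bsub>P\<^esub> word_value P \<phi> d"
proof -
  interpret comm_group P by fact
  interpret h: group_hom "free_Abelian_group Gen" P "word_value P \<phi>"
    by (simp add: group_hom_def group_hom_axioms_def word_value_hom assms is_group)
  have "word_value P \<phi> (c \<otimes>\<^bsub>free_Abelian_group Gen\<^esub> inv\<^bsub>free_Abelian_group Gen\<^esub> d) =
    word_value P \<phi> c \<otimes>\<^bsub>P\<^esub> inv\<^bsub>P\<^esub> word_value P \<phi> d"
    by (subst h.hom_mult) (use assms h.hom_inv[of d] in \<open>auto simp: keys_minus\<close>)
  then show ?thesis
    using assms by simp
qed

text \<open>All relators in the tensor products and Grothendieck groups below have the shape a - b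
  or a - b - c. This lemma and the next one turn respect for such a relator into an equation between
  the values of its generators.\<close>

lemma word_value_diff_eq_one:
  assumes P: "comm_group P" and "\<phi> a = \<phi> b" "\<phi> b \<in> carrier P"
  shows "word_value P \<phi> (frag_of a - frag_of b) = \<one>\<^bsub>P\<^esub>"
proof -
  interpret P: comm_group P by fact
  have "\<phi> \<in> {a, b} \<rightarrow> carrier P"
    using assms by auto
  from word_value_diff[OF P this, of "frag_of a" "frag_of b"] show ?thesis
    using assms by (simp add: word_value_frag_of)
qed

lemma word_value_diff2_eq_one:
  assumes P: "comm_group P" and "\<phi> a = \<phi> b \<otimes>\<^bsub>P\<^esub> \<phi> c" "\<phi> b \<in> carrier P" "\<phi> c \<in> carrier P"
  shows "word_value P \<phi> (frag_of a - frag_of b - frag_of c) = \<one>\<^bsub>P\<^esub>"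
proof -
  interpret P: comm_group P by fact
  have *: "\<phi> \<in> {a, b, c} \<rightarrow> carrier P"
    using assms by auto
  have "word_value P \<phi> (frag_of a - frag_of b - frag_of c) = (\<phi> a \<otimes>\<^bsub>P\<^esub> inv\<^bsub>P\<^esub> \<phi> b) \<otimes>\<^bsub>P\<^esub> inv\<^bsub>P\<^esub> \<phi> c"
    using word_value_diff[OF P *, of "frag_of a" "frag_of b"]
      word_value_diff[OF P *, of "frag_of a - frag_of b" "frag_of c"]
      keys_diff[of "frag_of a" "frag_of b"] assms
    by (auto simp: word_value_frag_of)
  also have "\<dots> = \<one>\<^bsub>P\<^esub>"
    using assms by (metis P.inv_solve_right' P.m_comm P.m_closed P.r_inv P.inv_closed)
  finally show ?thesis .
qed

lemma word_value_comp_hom: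
  assumes "comm_group P" "comm_group Q" "h \<in> hom P Q" "\<phi> \<in> Poly_Mapping.keys c \<rightarrow> carrier P"
  shows "h (word_value P \<phi> c) = word_value Q (h \<circ> \<phi>) c"
proof -
  interpret P: comm_group P by fact
  interpret Q: comm_group Q by fact
  interpret h: group_hom P Q h
    by (simp add: group_hom_def group_hom_axioms_def assms P.is_group Q.is_group)
  have "h (finprod P f K) = finprod Q (h \<circ> f) K" if "finite K" "f \<in> K \<rightarrow> carrier P" for f K
    using that by (induction K) (auto simp: Pi_iff)
  moreover have "finprod Q (h \<circ> (\<lambda>x. \<phi> x [^]\<^bsub>P\<^esub> Poly_Mapping.lookup c x)) (Poly_Mapping.keys c) =
      finprod Q (\<lambda>x. (h \<circ> \<phi>) x [^]\<^bsub>Q\<^esub> Poly_Mapping.lookup c x) (Poly_Mapping.keys c)"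
    by (rule Q.finprod_cong') (use assms(4) in \<open>auto simp: h.hom_int_pow Pi_iff\<close>)
  moreover have "h (finprod P (\<lambda>x. \<phi> x [^]\<^bsub>P\<^esub> Poly_Mapping.lookup c x) (Poly_Mapping.keys c)) =
      finprod Q (h \<circ> (\<lambda>x. \<phi> x [^]\<^bsub>P\<^esub> Poly_Mapping.lookup c x)) (Poly_Mapping.keys c)"
    by (rule calculation(1)) (use assms(4) in auto)
  ultimately show ?thesis
    unfolding word_value_def by metis
qed

lemma word_value_cong:
  assumes "comm_group P" "\<And>x. x \<in> Poly_Mapping.keys c \<Longrightarrow> \<phi> x = \<psi> x \<and> \<psi> x \<in> carrier P"
  shows "word_value P \<phi> c = word_value P \<psi> c"
proof -
  interpret comm_group P by fact
  show ?thesis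
    unfolding word_value_def by (rule finprod_cong') (use assms(2) in auto)
qed

section \<open>The universal property of generators and relations\<close>

locale presentation =
  fixes Gen :: "'x set" and E :: "('x \<Rightarrow>\<^sub>0 int) set"
  assumes rels: "E \<subseteq> carrier (free_Abelian_group Gen)"
begin

sublocale F: comm_group "free_Abelian_group Gen"
  by (rule abelian_free_Abelian_group)

abbreviation "FG \<equiv> free_Abelian_group Gen"
abbreviation "PG \<equiv> presented_group Gen E"
abbreviation "cls \<equiv> gen_class Gen E"
abbreviation "coset c \<equiv> generate FG E #>\<^bsub>FG\<^esub> c"

lemma normal_rels: "generate FG E \<lhd> FG"
  using rels by (simp add: F.normal_iff_subgroup F.generate_is_subgroup)

lemma comm_group: "comm_group PG"
  unfolding presented_group_def using rels by (intro F.abelian_FactGroup F.generate_is_subgroup)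

lemma gen_class_closed: "x \<in> Gen \<Longrightarrow> cls x \<in> carrier PG"
  by (simp add: presented_group_def gen_class_def carrier_FactGroup)

lemma coset_hom:
  "coset \<in>
     hom FG PG"
  unfolding presented_group_def by (rule normal.r_coset_hom_Mod[OF normal_rels])

lemma coset_diff:
  assumes "Poly_Mapping.keys c \<subseteq> Gen" "Poly_Mapping.keys d \<subseteq> Gen"
  shows "coset (c - d) =
    coset c \<otimes>\<^bsub>PG\<^esub>
    inv\<^bsub>PG\<^esub> coset d"
proof -
  interpret Q: comm_group PG by (rule comm_group)
  interpret h: group_hom FG PG
      coset
    by (simp add: group_hom_def group_hom_axioms_def coset_hom Q.is_group)
  show ?thesis
    using h.hom_mult[of c "inv\<^bsub>FG\<^esub> d"] h.hom_inv[of d] assms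
    by (auto simp: keys_minus)
qed

lemma coset_eq_one:
  assumes "e \<in> E"
  shows "coset e = \<one>\<^bsub>PG\<^esub>"
  unfolding presented_group_def
  using F.coset_join2[of e "generate FG E"] assms rels
  by (auto simp: F.generate_is_subgroup generate.incl)

lemma gen_class_eqI:
  assumes "frag_of a - frag_of b \<in> E" "a \<in> Gen" "b \<in> Gen"
  shows "cls a = cls b"
proof -
  interpret Q: comm_group PG by (rule comm_group)
  have "cls a \<otimes>\<^bsub>PG\<^esub> inv\<^bsub>PG\<^esub> cls b = \<one>\<^bsub>PG\<^esub>"
    using coset_eq_one[OF assms(1)] coset_diff[of "frag_of a" "frag_of b"] assms(2,3) by (simp add: gen_class_def)
  then show ?thesis
    using gen_class_closed assms(2,3) by (metis Q.inv_closed Q.inv_equality Q.inv_inv)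
qed

lemma gen_class_eq_multI:
  assumes "frag_of a - frag_of b - frag_of c \<in> E" "a \<in> Gen" "b \<in> Gen" "c \<in> Gen"
  shows "cls a = cls b \<otimes>\<^bsub>PG\<^esub> cls c"
proof -
  interpret Q: comm_group PG by (rule comm_group)
  have "(cls a \<otimes>\<^bsub>PG\<^esub> inv\<^bsub>PG\<^esub> cls b)
      \<otimes>\<^bsub>PG\<^esub> inv\<^bsub>PG\<^esub> cls c = \<one>\<^bsub>PG\<^esub>"
    using coset_eq_one[OF assms(1)] coset_diff[of "frag_of a" "frag_of b"]
      coset_diff[of "frag_of a - frag_of b" "frag_of c"] keys_diff[of "frag_of a" "frag_of b"] assms(2-4)
    by (auto simp: gen_class_def)
  then have "cls a \<otimes>\<^bsub>PG\<^esub> inv\<^bsub>PG\<^esub> cls b = cls c"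
    using gen_class_closed assms(2-4) by (metis Q.inv_closed Q.m_closed Q.inv_equality Q.inv_inv)
  then show ?thesis
    using gen_class_closed assms(2-4) Q.inv_solve_right' Q.m_comm by (metis Q.inv_closed)
qed

lemma induct [consumes 1, case_names one gen mult inv]:
  assumes C: "C \<in> carrier PG"
    and one: "Q \<one>\<^bsub>PG\<^esub>"
    and gen: "\<And>x. x \<in> Gen \<Longrightarrow> Q (cls x)"
    and mult: "\<And>a b. \<lbrakk>a \<in> carrier PG; b \<in> carrier PG; Q a; Q b\<rbrakk> \<Longrightarrow>
      Q (a \<otimes>\<^bsub>PG\<^esub> b)"
    and inv: "\<And>a. \<lbrakk>a \<in> carrier PG; Q a\<rbrakk> \<Longrightarrow> Q (inv\<^bsub>PG\<^esub> a)"
  shows "Q C"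
proof -
  interpret Q: comm_group PG by (rule comm_group)
  let coset = coset
  have cl: "coset c \<in> carrier PG" if "Poly_Mapping.keys c \<subseteq> Gen" for c
    using that by (simp add: presented_group_def carrier_FactGroup)
  have "Q (coset c)" if "Poly_Mapping.keys c \<subseteq> Gen" for c
  proof (rule free_Abelian_group_induct[OF that, where P="\<lambda>c. Q (coset c)"])
    have "coset 0 = \<one>\<^bsub>PG\<^esub>"
      using F.coset_mult_one[of "generate FG E"] rels
      by (simp add: presented_group_def F.generate_incl)
    then show "Q (coset 0)" using one by simp
  next
    fix x y assume "Poly_Mapping.keys x \<subseteq> Gen" "Poly_Mapping.keys y \<subseteq> Gen" "Q (coset x)" "Q (coset y)"
    then show "Q (coset (x - y))"
      by (simp add: coset_diff cl mult inv)
  next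
    fix a assume "a \<in> Gen"
    then show "Q (coset (frag_of a))"
      using gen by (simp add: gen_class_def)
  qed
  then show ?thesis
    using C by (auto simp: presented_group_def carrier_FactGroup)
qed

text \<open>A coset is recovered from any of its elements, in particular from the one that
  \<open>extend_gens\<close> chooses.\<close>

lemma representative:
  assumes "C \<in> carrier PG"
  shows "Poly_Mapping.keys (SOME c. c \<in> C) \<subseteq> Gen"
    "C = coset (SOME c. c \<in> C)"
proof -
  interpret N: normal "generate FG E" FG
    by (rule normal_rels)
  obtain c where c: "c \<in> carrier FG"
    "C = coset c"
    using assms by (auto simp: presented_group_def carrier_FactGroup)
  then have "c \<in> C"
    using F.rcos_self N.is_subgroup by blast
  then have s: "(SOME c. c \<in> C) \<in> C"
    by (rule someI)
  then show "Poly_Mapping.keys (SOME c. c \<in> C) \<subseteq> Gen"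
    using F.r_coset_subset_G[OF N.subset c(1)] c(2) by (metis carrier_free_Abelian_group_iff subsetD)
  show "C = coset (SOME c. c \<in> C)"
    using F.repr_independence[of "SOME c. c \<in> C" "generate FG E" c] s c N.is_subgroup
    by simp
qed

lemma extend_gens_eq:
  assumes "C \<in> carrier PG"
  shows "extend_gens P \<phi> C = word_value P \<phi> (SOME c. c \<in> C)"
  by (simp add: extend_gens_def word_value_def Let_def)

text \<open>Both sides evaluate the same chosen representative, so the homomorphism moves inside
  word by word. In this way the dimension of \<open>G0_outer\<close> and of
  \<open>GA_canonical\<close> is computed directly from their values on generators.\<close>

lemma extend_gens_comp_hom:
  assumes "comm_group P" "comm_group Q" "h \<in> hom P Q" "\<phi> \<in> Gen \<rightarrow> carrier P"
    "C \<in> carrier PG"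
  shows "h (extend_gens P \<phi> C) = extend_gens Q (h \<circ> \<phi>) C"
  unfolding extend_gens_eq[OF assms(5)]
  by (rule word_value_comp_hom) (use assms representative(1)[OF assms(5)] in auto)

lemma extend_gens_cong:
  assumes "comm_group P" "\<And>x. x \<in> Gen \<Longrightarrow> \<phi> x = \<psi> x \<and> \<psi> x \<in> carrier P" "C \<in> carrier PG"
  shows "extend_gens P \<phi> C = extend_gens P \<psi> C"
  unfolding extend_gens_eq[OF assms(3)]
  by (rule word_value_cong) (use assms representative(1)[OF assms(3)] in auto)

lemma extend_gens_closed:
  assumes "comm_group P" "\<phi> \<in> Gen \<rightarrow> carrier P" "C \<in> carrier PG"
  shows "extend_gens P \<phi> C \<in> carrier P"
  unfolding extend_gens_eq[OF assms(3)]
  using word_value_hom[OF assms(1,2)] representative(1)[OF assms(3)] by (auto simp: hom_def)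

text \<open>Two representatives of a coset differ by an element of the subgroup generated by the
  relators, and this subgroup lies in the kernel of \<open>word_value\<close> as soon as the
  relators do. So the choice in \<open>extend_gens\<close> has no influence on the value.\<close>

lemma
  assumes P: "comm_group P" and \<phi>: "\<phi> \<in> Gen \<rightarrow> carrier P"
    and respects: "\<And>e. e \<in> E \<Longrightarrow> word_value P \<phi> e = \<one>\<^bsub>P\<^esub>"
  shows extend_gens_hom: "extend_gens P \<phi> \<in> hom PG P"
    and extend_gens_gen: "x \<in> Gen \<Longrightarrow> extend_gens P \<phi> (cls x) = \<phi> x"
proof -
  interpret P: comm_group P by fact
  interpret N: normal "generate FG E" FG
    by (rule normal_rels)
  interpret h: group_hom FG P "word_value P \<phi>"
    by (simp add: group_hom_def group_hom_axioms_def word_value_hom P \<phi> P.is_group)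
  have ker: "word_value P \<phi> e = \<one>\<^bsub>P\<^esub>" if "e \<in> generate FG E" for e
    using F.generate_subgroup_incl[OF _ h.subgroup_kernel, of E] rels respects that
    by (force simp: kernel_def)
  have eq: "extend_gens P \<phi> (coset c) = word_value P \<phi> c"
    if c: "c \<in> carrier FG" for c
  proof -
    let ?C = "coset c"
    have C: "?C \<in> carrier PG"
      using c by (auto simp: presented_group_def carrier_FactGroup)
    have "c \<in> ?C"
      using F.rcos_self[OF c N.is_subgroup] .
    then have "(SOME c. c \<in> ?C) \<in> ?C"
      by (rule someI)
    then obtain e where e: "e \<in> generate FG E"
      "(SOME c. c \<in> ?C) = e \<otimes>\<^bsub>FG\<^esub> c"
      by (auto simp: r_coset_def)
    have "word_value P \<phi> (e \<otimes>\<^bsub>FG\<^esub> c) = word_value P \<phi> e \<otimes>\<^bsub>P\<^esub> word_value P \<phi> c"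
      using subsetD[OF N.subset e(1)] c by (intro h.hom_mult)
    then show ?thesis
      using ker[OF e(1)] h.hom_closed[OF c] by (simp add: extend_gens_eq[OF C] e(2))
  qed
  show "extend_gens P \<phi> \<in> hom PG P"
  proof (rule homI)
    fix C D assume "C \<in> carrier PG" "D \<in> carrier PG"
    then obtain c d where cd: "c \<in> carrier FG" "d \<in> carrier FG"
      "C = coset c"
      "D = coset d"
      by (auto simp: presented_group_def carrier_FactGroup)
    have "C \<otimes>\<^bsub>PG\<^esub> D = coset (c \<otimes>\<^bsub>FG\<^esub> d)"
      using hom_mult[OF coset_hom cd(1,2)] cd by simp
    then show "extend_gens P \<phi> (C \<otimes>\<^bsub>PG\<^esub> D) = extend_gens P \<phi> C \<otimes>\<^bsub>P\<^esub> extend_gens P \<phi> D"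
      using eq[OF cd(1)] eq[OF cd(2)] eq[OF F.m_closed[OF cd(1,2)]] h.hom_mult[OF cd(1,2)] cd(3,4) by simp
  qed (use extend_gens_closed[OF P \<phi>] in auto)
  show "extend_gens P \<phi> (cls x) = \<phi> x" if "x \<in> Gen"
    using eq[of "frag_of x"] that \<phi> word_value_frag_of[OF P, of \<phi> x] by (auto simp: gen_class_def)
qed

end

section \<open>Tensor products\<close>

text \<open>The same group operations reappear in several record types, such as
  \<open>tensor_with_action\<close> and \<open>int_module\<close>; this carries the group laws
  over.\<close>

lemma comm_group_cong:
  assumes "comm_group G" "carrier H = carrier G" "monoid.mult H = monoid.mult G" "\<one>\<^bsub>H\<^esub> = \<one>\<^bsub>G\<^esub>"
  shows "comm_group H"
proof -
  interpret comm_group G by fact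
  show ?thesis
    by (rule comm_groupI) (use assms(2-) in \<open>auto simp: m_ac intro: l_inv_ex\<close>)
qed

lemma tensor_with_action_simps:
  "carrier (tensor_with_action R M N act) = carrier (tensor_group R M N)"
  "ring.add (tensor_with_action R M N act) = monoid.mult (tensor_group R M N)"
  "ring.zero (tensor_with_action R M N act) = monoid.one (tensor_group R M N)"
  "smult (tensor_with_action R M N act) s =
     extend_gens (tensor_group R M N) (\<lambda>z. case act s z of (x, y) \<Rightarrow> pure_tensor R M N x y)"
  by (simp_all add: tensor_with_action_def Let_def)

text \<open>Closure under scalars is what keeps the relators inside the free group. The locale
  serves both the tensor products over \<Z> that build G(A)_q and, through
  \<open>tensor_modules\<close>, those over any commutative ring.\<close>

locale tensor_pair = M: abelian_group M + N: abelian_group N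
  for R :: "('r, 'x) ring_scheme" and M :: "('r, 'm) module" and N :: "('r, 'n) module" +
  assumes left_closed: "\<lbrakk>r \<in> carrier R; x \<in> carrier M\<rbrakk> \<Longrightarrow> r \<odot>\<^bsub>M\<^esub> x \<in> carrier M"
    and right_closed: "\<lbrakk>r \<in> carrier R; y \<in> carrier N\<rbrakk> \<Longrightarrow> r \<odot>\<^bsub>N\<^esub> y \<in> carrier N"
begin

lemma keys_tensor_rels: "tensor_rels R M N \<subseteq> carrier (free_Abelian_group (carrier M \<times> carrier N))"
proof -
  have "Poly_Mapping.keys (frag_of a - frag_of b) \<subseteq> S" if "a \<in> S" "b \<in> S"
    for a b :: "'m \<times> 'n" and S
    using that keys_diff[of "frag_of a" "frag_of b"] by auto
  moreover have "Poly_Mapping.keys (frag_of a - frag_of b - frag_of c) \<subseteq> S" if "a \<in> S" "b \<in> S" "c \<in> S"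
    for a b c :: "'m \<times> 'n" and S
    using that keys_diff[of "frag_of a - frag_of b" "frag_of c"] keys_diff[of "frag_of a" "frag_of b"] by auto
  ultimately show ?thesis
    using left_closed right_closed unfolding tensor_rels_def by auto
qed

sublocale presentation "carrier M \<times> carrier N" "tensor_rels R M N"
  by unfold_locales (rule keys_tensor_rels)

abbreviation "T \<equiv> tensor_group R M N"
abbreviation "pt \<equiv> pure_tensor R M N"

lemma comm_group_tensor: "comm_group T"
  unfolding tensor_group_def by (rule comm_group)

sublocale T: comm_group T
  by (rule comm_group_tensor)

lemma abelian_group_tensor: "abelian_group (tensor_with_action R M N act)"
  by (rule comm_group_abelian_groupI)
    (rule comm_group_cong[OF comm_group_tensor], auto simp: tensor_with_action_simps)

lemma pure_closed: "\<lbrakk>x \<in> carrier M; y \<in> carrier N\<rbrakk> \<Longrightarrow> pt x y \<in> carrier T"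
  unfolding pure_tensor_def tensor_group_def by (rule gen_class_closed) simp

lemma
  assumes "x \<in> carrier M" "y \<in> carrier N"
  shows pure_add_left: "x' \<in> carrier M \<Longrightarrow> pt (x \<oplus>\<^bsub>M\<^esub> x') y = pt x y \<otimes>\<^bsub>T\<^esub> pt x' y"
    and pure_add_right: "y' \<in> carrier N \<Longrightarrow> pt x (y \<oplus>\<^bsub>N\<^esub> y') = pt x y \<otimes>\<^bsub>T\<^esub> pt x y'"
    and pure_balanced: "r \<in> carrier R \<Longrightarrow> pt (r \<odot>\<^bsub>M\<^esub> x) y = pt x (r \<odot>\<^bsub>N\<^esub> y)"
proof -
  show "pt (x \<oplus>\<^bsub>M\<^esub> x') y = pt x y \<otimes>\<^bsub>T\<^esub> pt x' y" if "x' \<in> carrier M"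
    unfolding pure_tensor_def tensor_group_def
    by (rule gen_class_eq_multI) (use that assms in \<open>auto simp: tensor_rels_def\<close>)
  show "pt x (y \<oplus>\<^bsub>N\<^esub> y') = pt x y \<otimes>\<^bsub>T\<^esub> pt x y'" if "y' \<in> carrier N"
    unfolding pure_tensor_def tensor_group_def
    by (rule gen_class_eq_multI) (use that assms in \<open>auto simp: tensor_rels_def\<close>)
  show "pt (r \<odot>\<^bsub>M\<^esub> x) y = pt x (r \<odot>\<^bsub>N\<^esub> y)" if "r \<in> carrier R"
    unfolding pure_tensor_def
    by (rule gen_class_eqI) (use that assms left_closed right_closed in \<open>auto simp: tensor_rels_def\<close>)
qed

lemma pure_zero_left: "y \<in> carrier N \<Longrightarrow> pt \<zero>\<^bsub>M\<^esub> y = \<one>\<^bsub>T\<^esub>"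
  using pure_add_left[of "\<zero>\<^bsub>M\<^esub>" y "\<zero>\<^bsub>M\<^esub>"] pure_closed[of "\<zero>\<^bsub>M\<^esub>" y] by simp

lemma pure_zero_right: "x \<in> carrier M \<Longrightarrow> pt x \<zero>\<^bsub>N\<^esub> = \<one>\<^bsub>T\<^esub>"
  using pure_add_right[of x "\<zero>\<^bsub>N\<^esub>" "\<zero>\<^bsub>N\<^esub>"] pure_closed[of x "\<zero>\<^bsub>N\<^esub>"] by simp

lemma pure_inv_left: "\<lbrakk>x \<in> carrier M; y \<in> carrier N\<rbrakk> \<Longrightarrow> inv\<^bsub>T\<^esub> pt x y = pt (\<ominus>\<^bsub>M\<^esub> x) y"
  using pure_add_left[of "\<ominus>\<^bsub>M\<^esub> x" y x] pure_closed pure_zero_left[of y]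
  by (intro T.inv_equality) (auto simp: M.l_neg)

text \<open>The negative of a pure tensor is the pure tensor of the negated left factor, so sums of
  pure tensors exhaust the group and no case for inverses remains.\<close>

lemma tensor_induct [consumes 1, case_names pure add]:
  assumes t: "t \<in> carrier T"
    and pure: "\<And>x y. \<lbrakk>x \<in> carrier M; y \<in> carrier N\<rbrakk> \<Longrightarrow> Q (pt x y)"
    and add: "\<And>a b. \<lbrakk>a \<in> carrier T; b \<in> carrier T; Q a; Q b\<rbrakk> \<Longrightarrow> Q (a \<otimes>\<^bsub>T\<^esub> b)"
  shows "Q t"
proof -
  have one: "Q \<one>\<^bsub>T\<^esub>"
    using pure[of "\<zero>\<^bsub>M\<^esub>" "\<zero>\<^bsub>N\<^esub>"] pure_zero_left[of "\<zero>\<^bsub>N\<^esub>"] by simp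
  \<comment> \<open>The property is proved for an element and its inverse at once; this absorbs the
    inverse case of the underlying induction.\<close>
  have "Q t \<and> Q (inv\<^bsub>T\<^esub> t)"
    using t unfolding tensor_group_def
  proof (induction t rule: induct)
    case one
    show ?case using \<open>Q \<one>\<^bsub>T\<^esub>\<close> T.inv_one by (simp add: tensor_group_def)
  next
    case (gen z)
    then show ?case
      using pure[of "fst z" "snd z"] pure[of "\<ominus>\<^bsub>M\<^esub> fst z" "snd z"] pure_inv_left[of "fst z" "snd z"]
      by (auto simp: pure_tensor_def tensor_group_def)
  next
    case (mult a b)
    then show ?case
      using add[of a b] add[of "inv\<^bsub>T\<^esub> a" "inv\<^bsub>T\<^esub> b"] T.inv_mult[of a b] T.inv_closed[of a] T.inv_closed[of b]
      by (simp add: tensor_group_def)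
  next
    case (inv a)
    then show ?case
      using T.inv_inv[of a] by (simp add: tensor_group_def)
  qed
  then show ?thesis ..
qed

lemma
  assumes P: "comm_group P"
    and closed: "\<And>x y. \<lbrakk>x \<in> carrier M; y \<in> carrier N\<rbrakk> \<Longrightarrow> f x y \<in> carrier P"
    and add_left: "\<And>x x' y. \<lbrakk>x \<in> carrier M; x' \<in> carrier M; y \<in> carrier N\<rbrakk> \<Longrightarrow> f (x \<oplus>\<^bsub>M\<^esub> x') y = f x y \<otimes>\<^bsub>P\<^esub> f x' y"
    and add_right: "\<And>x y y'. \<lbrakk>x \<in> carrier M; y \<in> carrier N; y' \<in> carrier N\<rbrakk> \<Longrightarrow> f x (y \<oplus>\<^bsub>N\<^esub> y') = f x y \<otimes>\<^bsub>P\<^esub> f x y'"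
    and balanced: "\<And>r x y. \<lbrakk>r \<in> carrier R; x \<in> carrier M; y \<in> carrier N\<rbrakk> \<Longrightarrow> f (r \<odot>\<^bsub>M\<^esub> x) y = f x (r \<odot>\<^bsub>N\<^esub> y)"
  shows tensor_extend_hom: "extend_gens P (\<lambda>(x, y). f x y) \<in> hom T P"
    and tensor_extend_pure: "\<lbrakk>x \<in> carrier M; y \<in> carrier N\<rbrakk> \<Longrightarrow> extend_gens P (\<lambda>(x, y). f x y) (pt x y) = f x y"
proof -
  interpret P: comm_group P by fact
  let ?f = "\<lambda>(x, y). f x y"
  have fP: "?f \<in> carrier M \<times> carrier N \<rightarrow> carrier P"
    using closed by auto
  have "word_value P ?f e = \<one>\<^bsub>P\<^esub>" if "e \<in> tensor_rels R M N" for e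
    using that unfolding tensor_rels_def
  proof (elim UnE CollectE exE conjE)
    fix x x' y
    assume "x \<in> carrier M" "x' \<in> carrier M" "y \<in> carrier N"
      "e = frag_of (x \<oplus>\<^bsub>M\<^esub> x', y) - frag_of (x, y) - frag_of (x', y)"
    then show ?thesis
      using word_value_diff2_eq_one[OF P, of ?f "(x \<oplus>\<^bsub>M\<^esub> x', y)" "(x, y)" "(x', y)"] add_left closed by simp
  next
    fix x y y'
    assume "x \<in> carrier M" "y \<in> carrier N" "y' \<in> carrier N"
      "e = frag_of (x, y \<oplus>\<^bsub>N\<^esub> y') - frag_of (x, y) - frag_of (x, y')"
    then show ?thesis
      using word_value_diff2_eq_one[OF P, of ?f "(x, y \<oplus>\<^bsub>N\<^esub> y')" "(x, y)" "(x, y')"] add_right closed by simp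
  next
    fix r x y
    assume "r \<in> carrier R" "x \<in> carrier M" "y \<in> carrier N"
      "e = frag_of (r \<odot>\<^bsub>M\<^esub> x, y) - frag_of (x, r \<odot>\<^bsub>N\<^esub> y)"
    then show ?thesis
      using word_value_diff_eq_one[OF P, of ?f "(r \<odot>\<^bsub>M\<^esub> x, y)" "(x, r \<odot>\<^bsub>N\<^esub> y)"] balanced closed right_closed by simp
  qed
  note * = extend_gens_hom[OF P fP this] extend_gens_gen[OF P fP this]
  show "extend_gens P ?f \<in> hom T P"
    using *(1) by (simp add: tensor_group_def)
  show "extend_gens P ?f (pt x y) = f x y" if "x \<in> carrier M" "y \<in> carrier N"
    using *(2)[of "(x, y)"] that by (simp add: pure_tensor_def)
qed

lemma tensor_lift_comp_hom:
  assumes "abelian_group P" "comm_group Q" "h \<in> hom (add_monoid P) Q"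
    "\<And>x y. \<lbrakk>x \<in> carrier M; y \<in> carrier N\<rbrakk> \<Longrightarrow> f x y \<in> carrier P"
    "t \<in> carrier T"
  shows "h (tensor_lift P f t) = extend_gens Q (\<lambda>(x, y). h (f x y)) t"
proof -
  have "h (tensor_lift P f t) = extend_gens Q (h \<circ> (\<lambda>(x, y). f x y)) t"
    unfolding tensor_lift_def
    by (rule extend_gens_comp_hom) (use assms in \<open>auto simp: tensor_group_def abelian_group.a_comm_group\<close>)
  then show ?thesis
    by (simp add: comp_def case_prod_unfold)
qed

end

section \<open>Tensor products of modules over a commutative ring\<close>

locale tensor_modules = M: Module.module R M + N: Module.module R N
  for R :: "('r, 'x) ring_scheme" and M :: "('r, 'm) module" and N :: "('r, 'n) module"
begin

sublocale tensor_pair R M N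
  by unfold_locales auto

abbreviation "TM \<equiv> tensor_module R M N"

lemma TM_simps: "carrier TM = carrier T" "x \<oplus>\<^bsub>TM\<^esub> y = x \<otimes>\<^bsub>T\<^esub> y" "\<zero>\<^bsub>TM\<^esub> = \<one>\<^bsub>T\<^esub>"
  by (simp_all add: tensor_module_def tensor_with_action_simps)

lemma TM_smult: "r \<odot>\<^bsub>TM\<^esub> t = extend_gens T (\<lambda>(x, y). pt (r \<odot>\<^bsub>M\<^esub> x) y) t"
  by (simp add: tensor_module_def tensor_with_action_simps case_prod_unfold)

lemma
  assumes "r \<in> carrier R"
  shows TM_smult_hom: "(\<lambda>t. r \<odot>\<^bsub>TM\<^esub> t) \<in> hom T T"
    and TM_smult_pure: "\<lbrakk>x \<in> carrier M; y \<in> carrier N\<rbrakk> \<Longrightarrow> r \<odot>\<^bsub>TM\<^esub> pt x y = pt (r \<odot>\<^bsub>M\<^esub> x) y"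
proof -
  \<comment> \<open>Commutativity of \<open>R\<close> enters here: acting by r must preserve the
    relation that moves s from one factor to the other, so r and s have to be interchanged.\<close>
  have b: "pt (r \<odot>\<^bsub>M\<^esub> (s \<odot>\<^bsub>M\<^esub> x)) y = pt (r \<odot>\<^bsub>M\<^esub> x) (s \<odot>\<^bsub>N\<^esub> y)"
    if "s \<in> carrier R" "x \<in> carrier M" "y \<in> carrier N" for s x y
    using that assms pure_balanced[of "r \<odot>\<^bsub>M\<^esub> x" y s]
    by (simp flip: M.smult_assoc1 add: M.m_comm[of r s])
  have *: "extend_gens T (\<lambda>(x, y). pt (r \<odot>\<^bsub>M\<^esub> x) y) \<in> hom T T"
    by (rule tensor_extend_hom)
      (use assms b in \<open>auto simp: pure_closed pure_add_left pure_add_right M.smult_r_distr comm_group_tensor\<close>)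
  then show "(\<lambda>t. r \<odot>\<^bsub>TM\<^esub> t) \<in> hom T T"
    by (simp add: TM_smult[abs_def])
  show "r \<odot>\<^bsub>TM\<^esub> pt x y = pt (r \<odot>\<^bsub>M\<^esub> x) y" if "x \<in> carrier M" "y \<in> carrier N"
    unfolding TM_smult
    by (rule tensor_extend_pure)
      (use that assms b in \<open>auto simp: pure_closed pure_add_left pure_add_right M.smult_r_distr comm_group_tensor\<close>)
qed

lemma TM_smult_add:
  "\<lbrakk>r \<in> carrier R; a \<in> carrier T; b \<in> carrier T\<rbrakk> \<Longrightarrow> r \<odot>\<^bsub>TM\<^esub> (a \<otimes>\<^bsub>T\<^esub> b) = (r \<odot>\<^bsub>TM\<^esub> a) \<otimes>\<^bsub>T\<^esub> (r \<odot>\<^bsub>TM\<^esub> b)"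
  using TM_smult_hom[of r] by (auto simp: hom_def)

lemma TM_smult_closed: "\<lbrakk>r \<in> carrier R; a \<in> carrier T\<rbrakk> \<Longrightarrow> r \<odot>\<^bsub>TM\<^esub> a \<in> carrier T"
  using TM_smult_hom[of r] by (auto simp: hom_def)

lemma module_TM: "Module.module R TM"
proof (rule moduleI)
  show "cring R" by (rule M.is_cring)
  show "abelian_group TM"
    unfolding tensor_module_def by (rule abelian_group_tensor)
  show "a \<odot>\<^bsub>TM\<^esub> x \<in> carrier TM" if "a \<in> carrier R" "x \<in> carrier TM" for a x
    using that by (simp add: TM_simps TM_smult_closed)
  show "a \<odot>\<^bsub>TM\<^esub> (x \<oplus>\<^bsub>TM\<^esub> y) = a \<odot>\<^bsub>TM\<^esub> x \<oplus>\<^bsub>TM\<^esub> a \<odot>\<^bsub>TM\<^esub> y"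
    if "a \<in> carrier R" "x \<in> carrier TM" "y \<in> carrier TM" for a x y
    using that by (simp add: TM_simps TM_smult_add)
  show "(a \<oplus>\<^bsub>R\<^esub> b) \<odot>\<^bsub>TM\<^esub> x = a \<odot>\<^bsub>TM\<^esub> x \<oplus>\<^bsub>TM\<^esub> b \<odot>\<^bsub>TM\<^esub> x"
    if ab: "a \<in> carrier R" "b \<in> carrier R" and x: "x \<in> carrier TM" for a b x
    using x unfolding TM_simps
  proof (induction x rule: tensor_induct)
    case (pure x y)
    then show ?case using ab by (simp add: TM_smult_pure M.smult_l_distr pure_add_left)
  next
    case (add x y)
    then show ?case using ab by (simp add: TM_smult_add TM_smult_closed T.m_ac)
  qed
  show "(a \<otimes>\<^bsub>R\<^esub> b) \<odot>\<^bsub>TM\<^esub> x = a \<odot>\<^bsub>TM\<^esub> (b \<odot>\<^bsub>TM\<^esub> x)"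
    if ab: "a \<in> carrier R" "b \<in> carrier R" and x: "x \<in> carrier TM" for a b x
    using x unfolding TM_simps
  proof (induction x rule: tensor_induct)
    case (pure x y)
    then show ?case using ab by (simp add: TM_smult_pure M.smult_assoc1)
  next
    case (add x y)
    then show ?case using ab by (simp add: TM_smult_add TM_smult_closed)
  qed
  show "\<one>\<^bsub>R\<^esub> \<odot>\<^bsub>TM\<^esub> x = x" if x: "x \<in> carrier TM" for x
    using x unfolding TM_simps
  proof (induction x rule: tensor_induct)
    case (pure x y)
    then show ?case by (simp add: TM_smult_pure)
  next
    case (add x y)
    then show ?case by (simp add: TM_smult_add)
  qed
qed

lemma TM_smult_pure_right:
  "\<lbrakk>r \<in> carrier R; x \<in> carrier M; y \<in> carrier N\<rbrakk> \<Longrightarrow> r \<odot>\<^bsub>TM\<^esub> pt x y = pt x (r \<odot>\<^bsub>N\<^esub> y)"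
  by (simp add: TM_smult_pure pure_balanced)

lemma
  assumes P: "Module.module R P"
    and closed: "\<And>x y. \<lbrakk>x \<in> carrier M; y \<in> carrier N\<rbrakk> \<Longrightarrow> f x y \<in> carrier P"
    and add_left: "\<And>x x' y. \<lbrakk>x \<in> carrier M; x' \<in> carrier M; y \<in> carrier N\<rbrakk> \<Longrightarrow> f (x \<oplus>\<^bsub>M\<^esub> x') y = f x y \<oplus>\<^bsub>P\<^esub> f x' y"
    and add_right: "\<And>x y y'. \<lbrakk>x \<in> carrier M; y \<in> carrier N; y' \<in> carrier N\<rbrakk> \<Longrightarrow> f x (y \<oplus>\<^bsub>N\<^esub> y') = f x y \<oplus>\<^bsub>P\<^esub> f x y'"
    and smult_left: "\<And>r x y. \<lbrakk>r \<in> carrier R; x \<in> carrier M; y \<in> carrier N\<rbrakk> \<Longrightarrow> f (r \<odot>\<^bsub>M\<^esub> x) y = r \<odot>\<^bsub>P\<^esub> f x y"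
    and smult_right: "\<And>r x y. \<lbrakk>r \<in> carrier R; x \<in> carrier M; y \<in> carrier N\<rbrakk> \<Longrightarrow> f x (r \<odot>\<^bsub>N\<^esub> y) = r \<odot>\<^bsub>P\<^esub> f x y"
  shows TM_lift_hom: "tensor_lift P f \<in> module_hom R TM P"
    and TM_lift_pure: "\<lbrakk>x \<in> carrier M; y \<in> carrier N\<rbrakk> \<Longrightarrow> tensor_lift P f (pt x y) = f x y"
proof -
  interpret P: Module.module R P by fact
  have h: "tensor_lift P f \<in> hom T (add_monoid P)"
    unfolding tensor_lift_def
    by (rule tensor_extend_hom) (use assms in \<open>auto simp: P.a_comm_group\<close>)
  have p: "tensor_lift P f (pt x y) = f x y" if "x \<in> carrier M" "y \<in> carrier N" for x y
    unfolding tensor_lift_def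
    by (rule tensor_extend_pure) (use assms that in \<open>auto simp: P.a_comm_group\<close>)
  then show "tensor_lift P f (pt x y) = f x y" if "x \<in> carrier M" "y \<in> carrier N"
    using that by blast
  have lift_add: "tensor_lift P f (a \<otimes>\<^bsub>T\<^esub> b) = tensor_lift P f a \<oplus>\<^bsub>P\<^esub> tensor_lift P f b"
    and cl: "tensor_lift P f a \<in> carrier P"
    if "a \<in> carrier T" "b \<in> carrier T" for a b
    using h that by (auto simp: hom_def)
  have "tensor_lift P f (r \<odot>\<^bsub>TM\<^esub> t) = r \<odot>\<^bsub>P\<^esub> tensor_lift P f t" if r: "r \<in> carrier R" and t: "t \<in> carrier T" for r t
    using t
  proof (induction t rule: tensor_induct)
    case (pure x y)
    then show ?case using r by (simp add: TM_smult_pure p smult_left)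
  next
    case (add a b)
    then show ?case using r cl[of a b] cl[of b b]
      by (simp add: TM_smult_add TM_smult_closed lift_add P.smult_r_distr)
  qed
  then show "tensor_lift P f \<in> module_hom R TM P"
    using lift_add cl by (auto simp: module_hom_def TM_simps)
qed

end

section \<open>Finite-dimensional vector spaces\<close>

definition fd_space :: "('k, 'x) ring_scheme \<Rightarrow> ('k, 'v) module \<Rightarrow> bool" where
  "fd_space K V \<longleftrightarrow> vectorspace K V \<and> vectorspace.fin_dim K V"

lemma fd_spaceD: "fd_space K V \<Longrightarrow> vectorspace K V" "fd_space K V \<Longrightarrow> vectorspace.fin_dim K V"
  by (simp_all add: fd_space_def)

lemma (in cring) module_regular: "Module.module R (regular_module R)"
proof (rule moduleI)
  show "abelian_group (regular_module R)"
    by (rule abelian_groupI) (auto simp: regular_module_def with_action_def a_ac intro: l_neg)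
qed (auto simp: regular_module_def with_action_def l_distr r_distr m_assoc is_cring)

lemma linear_mapI:
  "\<lbrakk>vectorspace K V; vectorspace K W; f \<in> module_hom K V W\<rbrakk> \<Longrightarrow> linear_map K V W f"
  by (simp add: linear_map_def mod_hom_def mod_hom_axioms_def vectorspace_def)

lemma
  assumes "fd_space K V" "vectorspace K W" "f \<in> module_hom K V W" "f ` carrier V = carrier W"
  shows fd_space_image: "fd_space K W"
    and dim_image_le: "vectorspace.dim K W \<le> vectorspace.dim K V"
proof -
  interpret linear_map K V W f
    by (rule linear_mapI) (use assms in \<open>auto simp: fd_space_def\<close>)
  show "fd_space K W"
    using surj_fin_dim assms by (auto simp: fd_space_def)
  show "vectorspace.dim K W \<le> vectorspace.dim K V"
    using rank_nullity surj_imp_imT_carrier assms by (auto simp: fd_space_def)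
qed

lemma
  assumes "fd_space K V" "vectorspace K W" "f \<in> module_hom K V W" "bij_betw f (carrier V) (carrier W)"
  shows fd_space_iso: "fd_space K W"
    and dim_iso: "vectorspace.dim K W = vectorspace.dim K V"
proof -
  interpret linear_map K V W f
    by (rule linear_mapI) (use assms in \<open>auto simp: fd_space_def\<close>)
  show "fd_space K W"
    by (rule fd_space_image) (use assms in \<open>auto simp: bij_betw_def\<close>)
  show "vectorspace.dim K W = vectorspace.dim K V"
    using dim_eq assms by (auto simp: fd_space_def bij_betw_def)
qed

text \<open>Linear independence and span of a subset of U mean the same in U and in V. Hence
  independent subsets of U have at most dim V elements, a maximal one is a basis of U, and if it has
  dim V elements it is a basis of V as well.\<close>

lemma
  assumes "fd_space K V" "subspace K U V"
  shows fd_space_subspace: "fd_space K (V\<lparr>carrier := U\<rparr>)"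
    and dim_subspace_le: "vectorspace.dim K (V\<lparr>carrier := U\<rparr>) \<le> vectorspace.dim K V"
    and subspace_eqI: "vectorspace.dim K (V\<lparr>carrier := U\<rparr>) = vectorspace.dim K V \<Longrightarrow> U = carrier V"
proof -
  interpret V: vectorspace K V
    using assms by (simp add: fd_space_def)
  have sub: "submodule K U V" and U: "U \<subseteq> carrier V"
    using assms(2) by (auto simp: subspace_def submodule_def)
  interpret U: vectorspace K "V\<lparr>carrier := U\<rparr>"
    using V.subspace_is_vs assms(2) by simp
  have li: "V.lin_dep A = U.lin_dep A" and sp: "U.span A = V.span A" if "A \<subseteq> U" for A
    by (rule V.span_li_not_depend(2)[OF that sub, symmetric], rule V.span_li_not_depend(1)[OF that sub])
  have fd: V.fin_dim
    using assms(1) by (rule fd_spaceD)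
  have fin: "finite A \<and> card A \<le> V.dim" if "A \<subseteq> U \<and> U.lin_indpt A" for A
  proof -
    have "V.lin_indpt A" "A \<subseteq> carrier V"
      using that li[of A] U by blast+
    then show ?thesis
      using V.li_le_dim[OF fd] by blast
  qed
  have "U.lin_indpt {}"
    unfolding U.lin_dep_def by blast
  then have "{} \<subseteq> U \<and> U.lin_indpt {}"
    by blast
  from maximal_exists[where P = "\<lambda>S. S \<subseteq> U \<and> U.lin_indpt S", OF fin this]
  obtain A where A: "finite A" "maximal A (\<lambda>S. S \<subseteq> U \<and> U.lin_indpt S)"
    by blast
  have AU: "A \<subseteq> U" "U.lin_indpt A"
    using A(2) unfolding maximal_def by blast+
  have basis: "U.basis A"
    by (rule U.max_li_is_basis) (simp add: A(2))
  have spA: "U.span A = U"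
    using basis by (simp add: U.basis_def)
  show "fd_space K (V\<lparr>carrier := U\<rparr>)"
    unfolding fd_space_def U.fin_dim_def using A(1) AU(1) U.vectorspace_axioms spA by auto
  have d: "U.dim = card A"
    by (rule U.dim_basis[OF A(1) basis])
  show "U.dim \<le> V.dim"
    unfolding d using fin AU by blast
  show "U = carrier V" if "U.dim = V.dim"
  proof -
    have "V.basis A"
    proof (rule V.dim_li_is_basis[OF fd A(1)])
      show "A \<subseteq> carrier V" "V.lin_indpt A"
        using AU U li by blast+
      show "V.dim \<le> card A"
        using that d by linarith
    qed
    then have "V.span A = carrier V"
      unfolding V.basis_def by blast
    then show ?thesis
      using sp[OF AU(1)] spA by blast
  qed
qed

text \<open>The inverse of an injective linear map is linear on the image, so the image is
  isomorphic to the source.\<close>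

lemma dim_inj_image:
  fixes U :: "('k, 'u) module"
  assumes "vectorspace K U" "fd_space K V" "f \<in> module_hom K U V" "inj_on f (carrier U)"
  shows "vectorspace.dim K (V\<lparr>carrier := f ` carrier U\<rparr>) = vectorspace.dim K U"
proof -
  interpret linear_map K U V f
    by (rule linear_mapI) (use assms in \<open>auto simp: fd_space_def\<close>)
  let ?I = "V\<lparr>carrier := f ` carrier U\<rparr>"
  have sub: "subspace K (f ` carrier U) V"
    using imT_is_subspace by (simp add: im_def)
  have fdI: "fd_space K ?I"
    by (rule fd_space_subspace[OF assms(2) sub])
  interpret I: vectorspace K ?I
    using fdI by (simp add: fd_space_def)
  let ?g = "inv_into (carrier U) f"
  have g: "?g (f x) = x" if "x \<in> carrier U" for x
    using that assms(4) by simp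
  have "?g \<in> module_hom K ?I U"
    unfolding module_hom_def
  proof (intro CollectI conjI allI impI)
    show "?g \<in> carrier ?I \<rightarrow> carrier U"
      using g by auto
    fix m1 m2 assume "m1 \<in> carrier ?I \<and> m2 \<in> carrier ?I"
    then obtain x y where "x \<in> carrier U" "y \<in> carrier U" "m1 = f x" "m2 = f y"
      by auto
    then show "?g (m1 \<oplus>\<^bsub>?I\<^esub> m2) = ?g m1 \<oplus>\<^bsub>U\<^esub> ?g m2"
      using g[of "x \<oplus>\<^bsub>U\<^esub> y"] by (simp add: g)
  next
    fix r m assume "r \<in> carrier K \<and> m \<in> carrier ?I"
    then obtain x where "x \<in> carrier U" "r \<in> carrier K" "m = f x"
      by auto
    then show "?g (r \<odot>\<^bsub>?I\<^esub> m) = r \<odot>\<^bsub>U\<^esub> ?g m"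
      using g[of "r \<odot>\<^bsub>U\<^esub> x"] by (simp add: g)
  qed
  moreover have "bij_betw ?g (carrier ?I) (carrier U)"
    using assms(4) by (simp add: bij_betw_inv_into inj_on_imp_bij_betw)
  ultimately show "vectorspace.dim K ?I = vectorspace.dim K U"
    using dim_iso[OF fdI assms(1)] by simp
qed

lemma dim_exact:
  fixes L :: "('k, 'l) module" and N :: "('k, 'n) module"
  assumes "fd_space K M" "vectorspace K L" "vectorspace K N"
    and "f \<in> module_hom K L M" "inj_on f (carrier L)"
    and "g \<in> module_hom K M N" "g ` carrier M = carrier N"
    and "f ` carrier L = {x \<in> carrier M. g x = \<zero>\<^bsub>N\<^esub>}"
  shows "vectorspace.dim K M = vectorspace.dim K L + vectorspace.dim K N"
proof -
  interpret linear_map K M N g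
    by (rule linear_mapI) (use assms in \<open>auto simp: fd_space_def\<close>)
  have "vectorspace.dim K (M\<lparr>carrier := f ` carrier L\<rparr>) = vectorspace.dim K L"
    by (rule dim_inj_image[OF assms(2,1,4,5)])
  then show ?thesis
    using rank_nullity assms(1,8) surj_imp_imT_carrier[OF assms(7)] by (simp add: fd_space_def ker_def)
qed

text \<open>Coefficient functions are taken extensional on the basis, which makes the coordinates of
  a vector unique and therefore linear. These functionals later separate the pure tensors of basis
  vectors.\<close>

lemma coordinate_functional:
  assumes "vectorspace K V" "finite B" "vectorspace.basis K V B" "b \<in> B"
  obtains \<phi> where "\<phi> \<in> carrier V \<rightarrow> carrier K"
    "\<And>x y. \<lbrakk>x \<in> carrier V; y \<in> carrier V\<rbrakk> \<Longrightarrow> \<phi> (x \<oplus>\<^bsub>V\<^esub> y) = \<phi> x \<oplus>\<^bsub>K\<^esub> \<phi> y"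
    "\<And>r x. \<lbrakk>r \<in> carrier K; x \<in> carrier V\<rbrakk> \<Longrightarrow> \<phi> (r \<odot>\<^bsub>V\<^esub> x) = r \<otimes>\<^bsub>K\<^esub> \<phi> x"
    "\<And>b'. b' \<in> B \<Longrightarrow> \<phi> b' = (if b' = b then \<one>\<^bsub>K\<^esub> else \<zero>\<^bsub>K\<^esub>)"
proof -
  interpret V: vectorspace K V by fact
  have BV: "B \<subseteq> carrier V"
    using assms(3) by (simp add: V.basis_def)
  have ex1: "\<exists>!a. a \<in> B \<rightarrow>\<^sub>E carrier K \<and> V.lincomb a B = v" if "v \<in> carrier V" for v
    using V.basis_criterion[OF assms(2) BV] assms(3) that by blast
  define co where "co v = (THE a. a \<in> B \<rightarrow>\<^sub>E carrier K \<and> V.lincomb a B = v)" for v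
  have co: "co v \<in> B \<rightarrow>\<^sub>E carrier K" "V.lincomb (co v) B = v" if "v \<in> carrier V" for v
    using theI'[OF ex1[OF that]] by (auto simp: co_def)
  have co_eq: "co v = restrict a B" if "a \<in> B \<rightarrow> carrier K" "V.lincomb a B = v" for a v
  proof -
    have v: "v \<in> carrier V"
      using that BV by auto
    have "V.lincomb (restrict a B) B = v"
      using that BV V.lincomb_cong[of B B "restrict a B" a] by auto
    then have "restrict a B \<in> B \<rightarrow>\<^sub>E carrier K \<and> V.lincomb (restrict a B) B = v"
      using that by auto
    then show ?thesis
      using ex1[OF v] co[OF v] by blast
  qed
  show thesis
  proof
    show "(\<lambda>v. co v b) \<in> carrier V \<rightarrow> carrier K"
      using co(1) assms(4) by auto
    show "co (x \<oplus>\<^bsub>V\<^esub> y) b = co x b \<oplus>\<^bsub>K\<^esub> co y b" if "x \<in> carrier V" "y \<in> carrier V" for x y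
    proof -
      have "V.lincomb (\<lambda>v. co x v \<oplus>\<^bsub>K\<^esub> co y v) B = x \<oplus>\<^bsub>V\<^esub> y"
        using V.lincomb_sum[OF assms(2) BV, of "co x" "co y"] co[OF that(1)] co[OF that(2)] by auto
      then have "co (x \<oplus>\<^bsub>V\<^esub> y) = restrict (\<lambda>v. co x v \<oplus>\<^bsub>K\<^esub> co y v) B"
        by (rule co_eq[rotated]) (use co(1)[OF that(1)] co(1)[OF that(2)] in auto)
      then show ?thesis
        using assms(4) by simp
    qed
    show "co (r \<odot>\<^bsub>V\<^esub> x) b = r \<otimes>\<^bsub>K\<^esub> co x b" if "r \<in> carrier K" "x \<in> carrier V" for r x
    proof -
      have "V.lincomb (\<lambda>v. r \<otimes>\<^bsub>K\<^esub> co x v) B = r \<odot>\<^bsub>V\<^esub> x"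
        using V.lincomb_smult[OF BV, of "co x" r] co[OF that(2)] that by auto
      then have "co (r \<odot>\<^bsub>V\<^esub> x) = restrict (\<lambda>v. r \<otimes>\<^bsub>K\<^esub> co x v) B"
        by (rule co_eq[rotated]) (use co(1)[OF that(2)] that(1) in auto)
      then show ?thesis
        using assms(4) by simp
    qed
    show "co b' b = (if b' = b then \<one>\<^bsub>K\<^esub> else \<zero>\<^bsub>K\<^esub>)" if "b' \<in> B" for b'
    proof -
      have "V.lincomb (\<lambda>v. if v = b' then \<one>\<^bsub>K\<^esub> else \<zero>\<^bsub>K\<^esub>) B = b'"
      proof -
        have "V.lincomb (\<lambda>v. if v = b' then \<one>\<^bsub>K\<^esub> else \<zero>\<^bsub>K\<^esub>) B =
            finsum V (\<lambda>v. if b' = v then v else \<zero>\<^bsub>V\<^esub>) B"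
          unfolding V.lincomb_def by (rule V.finsum_cong') (use BV in auto)
        also have "\<dots> = b'"
          using V.add.finprod_singleton[OF that assms(2), of "\<lambda>v. v"] BV by auto
        finally show ?thesis .
      qed
      then have "co b' = restrict (\<lambda>v. if v = b' then \<one>\<^bsub>K\<^esub> else \<zero>\<^bsub>K\<^esub>) B"
        by (rule co_eq[rotated]) auto
      then show ?thesis
        using assms(4) by auto
    qed
  qed
qed

text \<open>The pure tensors of two bases form a basis. They span because, with one argument fixed,
  membership in their span defines a submodule in the other argument. They are independent because
  products of coordinate functionals, lifted to the tensor product, are dual to them.\<close>

lemma
  assumes "fd_space K V" "fd_space K W"
  shows fd_space_tensor: "fd_space K (tensor_module K V W)"
    and dim_tensor: "vectorspace.dim K (tensor_module K V W) = vectorspace.dim K V * vectorspace.dim K W"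
proof -
  interpret V: vectorspace K V using assms by (simp add: fd_space_def)
  interpret W: vectorspace K W using assms by (simp add: fd_space_def)
  interpret tensor_modules K V W
    by unfold_locales
  interpret TM: vectorspace K TM
    by (simp add: vectorspace_def module_TM V.field_axioms)
  obtain B where B: "finite B" "V.basis B"
    using V.finite_basis_exists assms(1) by (auto simp: fd_space_def)
  obtain C where C: "finite C" "W.basis C"
    using W.finite_basis_exists assms(2) by (auto simp: fd_space_def)
  have BV: "B \<subseteq> carrier V" and CW: "C \<subseteq> carrier W"
    and spB: "V.span B = carrier V" and spC: "W.span C = carrier W"
    using B(2) C(2) by (auto simp: V.basis_def W.basis_def)
  define S where "S = (\<lambda>(b, c). pt b c) ` (B \<times> C)"
  have finS: "finite S" and ST: "S \<subseteq> carrier TM"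
    using B C BV CW pure_closed by (auto simp: S_def TM_simps)
  have dual: "\<exists>\<phi> \<in> module_hom K TM (regular_module K). \<forall>b'\<in>B. \<forall>c'\<in>C.
      \<phi> (pt b' c') = (if b' = b \<and> c' = c then \<one>\<^bsub>K\<^esub> else \<zero>\<^bsub>K\<^esub>)" if bc: "b \<in> B" "c \<in> C" for b c
  proof -
    obtain \<phi> where \<phi>: "\<phi> \<in> carrier V \<rightarrow> carrier K"
      "\<And>x y. \<lbrakk>x \<in> carrier V; y \<in> carrier V\<rbrakk> \<Longrightarrow> \<phi> (x \<oplus>\<^bsub>V\<^esub> y) = \<phi> x \<oplus>\<^bsub>K\<^esub> \<phi> y"
      "\<And>r x. \<lbrakk>r \<in> carrier K; x \<in> carrier V\<rbrakk> \<Longrightarrow> \<phi> (r \<odot>\<^bsub>V\<^esub> x) = r \<otimes>\<^bsub>K\<^esub> \<phi> x"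
      "\<And>b'. b' \<in> B \<Longrightarrow> \<phi> b' = (if b' = b then \<one>\<^bsub>K\<^esub> else \<zero>\<^bsub>K\<^esub>)"
      using coordinate_functional[OF V.vectorspace_axioms B bc(1)] by blast
    obtain \<psi> where \<psi>: "\<psi> \<in> carrier W \<rightarrow> carrier K"
      "\<And>x y. \<lbrakk>x \<in> carrier W; y \<in> carrier W\<rbrakk> \<Longrightarrow> \<psi> (x \<oplus>\<^bsub>W\<^esub> y) = \<psi> x \<oplus>\<^bsub>K\<^esub> \<psi> y"
      "\<And>r x. \<lbrakk>r \<in> carrier K; x \<in> carrier W\<rbrakk> \<Longrightarrow> \<psi> (r \<odot>\<^bsub>W\<^esub> x) = r \<otimes>\<^bsub>K\<^esub> \<psi> x"
      "\<And>b'. b' \<in> C \<Longrightarrow> \<psi> b' = (if b' = c then \<one>\<^bsub>K\<^esub> else \<zero>\<^bsub>K\<^esub>)"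
      using coordinate_functional[OF W.vectorspace_axioms C bc(2)] by blast
    have cl: "\<phi> x \<in> carrier K" "\<psi> y \<in> carrier K" if "x \<in> carrier V" "y \<in> carrier W" for x y
      using that \<phi>(1) \<psi>(1) by auto
    have reg: "Module.module K (regular_module K)"
      by (rule cring.module_regular) (rule V.is_cring)
    let ?f = "\<lambda>v w. \<phi> v \<otimes>\<^bsub>K\<^esub> \<psi> w"
    have "tensor_lift (regular_module K) ?f \<in> module_hom K TM (regular_module K)"
      by (rule TM_lift_hom)
        (use cl \<phi> \<psi> reg in \<open>auto simp: regular_module_def with_action_def V.l_distr V.r_distr V.m_ac\<close>)
    moreover have "tensor_lift (regular_module K) ?f (pt x y) = ?f x y" if "x \<in> carrier V" "y \<in> carrier W" for x y
      by (rule TM_lift_pure)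
        (use cl \<phi> \<psi> reg that in \<open>auto simp: regular_module_def with_action_def V.l_distr V.r_distr V.m_ac\<close>)
    ultimately show ?thesis
      using \<phi>(4) \<psi>(4) subsetD[OF BV] subsetD[OF CW] by (intro bexI[of _ "tensor_lift (regular_module K) ?f"]) auto
  qed
  \<comment> \<open>Distinct pairs must give distinct tensors for \<open>S\<close> to have as many
    elements as the product of the dimensions; the dual functional of one pair tells it from all
    others.\<close>
  have inj: "inj_on (\<lambda>(b, c). pt b c) (B \<times> C)"
  proof (rule inj_onI, clarify)
    fix b c b' c' assume "b \<in> B" "c \<in> C" "b' \<in> B" "c' \<in> C" "pt b c = pt b' c'"
    then show "b = b' \<and> c = c'"
      using dual[of b c] V.one_not_zero by (metis (full_types))
  qed
  have card: "card S = card B * card C"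
    using card_image[OF inj] by (simp add: S_def card_cartesian_product)
  have spanS: "TM.span S = carrier TM"
  proof -
    have sub: "submodule K (TM.span S) TM"
      by (rule TM.span_is_submodule[OF ST])
    have a: "pt b w \<in> TM.span S" if "b \<in> B" "w \<in> carrier W" for b w
    proof -
      have "submodule K {w \<in> carrier W. pt b w \<in> TM.span S} W"
        unfolding submodule_def
      proof (intro conjI allI impI)
        show "Module.module K W" by (rule W.module_axioms)
        show "\<zero>\<^bsub>W\<^esub> \<in> {w \<in> carrier W. pt b w \<in> TM.span S}"
          using that BV pure_zero_right sub by (auto simp: submodule_def TM_simps)
      qed (use that BV sub in \<open>auto simp: submodule_def TM_simps pure_add_right TM_smult_pure_right[symmetric]\<close>)
      moreover have "C \<subseteq> {w \<in> carrier W. pt b w \<in> TM.span S}"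
        using that CW TM.in_own_span[OF ST] by (auto simp: S_def)
      ultimately have "W.span C \<subseteq> {w \<in> carrier W. pt b w \<in> TM.span S}"
        by (intro W.span_is_subset)
      then show ?thesis
        using that spC by auto
    qed
    have b: "pt v w \<in> TM.span S" if "v \<in> carrier V" "w \<in> carrier W" for v w
    proof -
      have "submodule K {v \<in> carrier V. pt v w \<in> TM.span S} V"
        unfolding submodule_def
      proof (intro conjI allI impI)
        show "Module.module K V" by (rule V.module_axioms)
        show "\<zero>\<^bsub>V\<^esub> \<in> {v \<in> carrier V. pt v w \<in> TM.span S}"
          using that pure_zero_left sub by (auto simp: submodule_def TM_simps)
      qed (use that sub in \<open>auto simp: submodule_def TM_simps pure_add_left TM_smult_pure[symmetric]\<close>)
      moreover have "B \<subseteq> {v \<in> carrier V. pt v w \<in> TM.span S}"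
        using that BV a by auto
      ultimately have "V.span B \<subseteq> {v \<in> carrier V. pt v w \<in> TM.span S}"
        by (intro V.span_is_subset)
      then show ?thesis
        using that spB by auto
    qed
    have "t \<in> TM.span S" if "t \<in> carrier TM" for t
      using that unfolding TM_simps
    proof (induction t rule: tensor_induct)
      case (pure x y)
      then show ?case by (rule b)
    next
      case (add x y)
      then show ?case using sub by (auto simp: submodule_def TM_simps)
    qed
    then show ?thesis
      using TM.span_is_subset2[OF ST] by auto
  qed
  have li: "TM.lin_indpt S"
  proof (rule TM.finite_lin_indpt2[OF finS ST], rule ballI)
    fix a s assume a: "a \<in> S \<rightarrow> carrier K" "TM.lincomb a S = \<zero>\<^bsub>TM\<^esub>" and "s \<in> S"
    then obtain b c where s: "b \<in> B" "c \<in> C" "s = pt b c"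
      by (auto simp: S_def)
    obtain \<phi> where \<phi>: "\<phi> \<in> module_hom K TM (regular_module K)"
      "\<And>b' c'. \<lbrakk>b' \<in> B; c' \<in> C\<rbrakk> \<Longrightarrow> \<phi> (pt b' c') = (if b' = b \<and> c' = c then \<one>\<^bsub>K\<^esub> else \<zero>\<^bsub>K\<^esub>)"
      using dual[OF s(1,2)] by blast
    have reg: "Module.module K (regular_module K)"
      by (rule cring.module_regular) (rule V.is_cring)
    interpret RK: Module.module K "regular_module K" by (rule reg)
    interpret \<phi>: mod_hom K TM "regular_module K" \<phi>
      by (simp add: mod_hom_def mod_hom_axioms_def module_TM reg \<phi>(1))
    have reg_simps: "carrier (regular_module K) = carrier K" "\<zero>\<^bsub>regular_module K\<^esub> = \<zero>\<^bsub>K\<^esub>"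
      "r \<odot>\<^bsub>regular_module K\<^esub> x = r \<otimes>\<^bsub>K\<^esub> x" for r x
      by (auto simp: regular_module_def with_action_def)
    have "\<zero>\<^bsub>K\<^esub> = \<phi> (TM.lincomb a S)"
      using a(2) \<phi>.f0_is_0 by (simp add: reg_simps)
    also have "\<dots> = finsum (regular_module K) (\<lambda>v. \<phi> (a v \<odot>\<^bsub>TM\<^esub> v)) S"
      unfolding TM.lincomb_def by (rule \<phi>.hom_sum) (use a(1) ST in auto)
    also have "\<dots> = finsum (regular_module K) (\<lambda>v. if s = v then a v else \<zero>\<^bsub>regular_module K\<^esub>) S"
    proof (rule RK.finsum_cong')
      show "\<phi> (a v \<odot>\<^bsub>TM\<^esub> v) = (if s = v then a v else \<zero>\<^bsub>regular_module K\<^esub>)" if "v \<in> S" for v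
      proof -
        obtain b' c' where v: "b' \<in> B" "c' \<in> C" "v = pt b' c'"
          using \<open>v \<in> S\<close> by (auto simp: S_def)
        have av: "a v \<in> carrier K"
          using that a(1) by auto
        have "s = v \<longleftrightarrow> b' = b \<and> c' = c"
          using inj s v by (auto simp: inj_on_def)
        then show ?thesis
          using \<phi>.f_smult[OF av, of v] that ST \<phi>(2)[OF v(1,2)] av by (auto simp: reg_simps v(3)[symmetric])
      qed
    qed (use a(1) in \<open>auto simp: reg_simps\<close>)
    also have "\<dots> = a s"
      by (rule RK.add.finprod_singleton) (use finS \<open>s \<in> S\<close> a(1) in \<open>auto simp: reg_simps\<close>)
    finally show "a s = \<zero>\<^bsub>K\<^esub>" ..
  qed
  have "TM.basis S"
    by (simp add: TM.basis_def li spanS ST)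
  then have "TM.dim = card S"
    by (rule TM.dim_basis[OF finS])
  then show "TM.dim = V.dim * W.dim"
    using card V.dim_basis[OF B] W.dim_basis[OF C] by simp
  show "fd_space K TM"
    using finS ST spanS TM.vectorspace_axioms by (auto simp: fd_space_def TM.fin_dim_def)
qed

section \<open>Left modules\<close>

lemma with_action_simps [simp]:
  "carrier (with_action M f) = carrier M" "ring.zero (with_action M f) = ring.zero M"
  "ring.add (with_action M f) = ring.add M" "smult (with_action M f) = f"
  by (simp_all add: with_action_def)

lemma regular_module_simps [simp]:
  "carrier (regular_module R) = carrier R" "ring.zero (regular_module R) = ring.zero R"
  "ring.add (regular_module R) = ring.add R" "smult (regular_module R) = monoid.mult R"
  by (simp_all add: regular_module_def)

lemma restrict_scalars_simps [simp]:
  "carrier (restrict_scalars \<phi> M) = carrier M" "ring.zero (restrict_scalars \<phi> M) = ring.zero M"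
  "ring.add (restrict_scalars \<phi> M) = ring.add M" "smult (restrict_scalars \<phi> M) = (\<lambda>s x. \<phi> s \<odot>\<^bsub>M\<^esub> x)"
  by (simp_all add: restrict_scalars_def)

lemma underlying_space_simps [simp]:
  "carrier (underlying_space A M) = carrier M" "ring.zero (underlying_space A M) = ring.zero M"
  "ring.add (underlying_space A M) = ring.add M"
  "smult (underlying_space A M) = (\<lambda>c x. (c \<odot>\<^bsub>A\<^esub> \<one>\<^bsub>A\<^esub>) \<odot>\<^bsub>M\<^esub> x)"
  by (simp_all add: underlying_space_def)

lemma left_module_of_module: "Module.module R M \<Longrightarrow> left_module R M"
  by (simp add: left_module_def left_module_axioms_def Module.module_def module_axioms_def cring_def)

lemma module_of_left_module: "\<lbrakk>left_module R M; cring R\<rbrakk> \<Longrightarrow> Module.module R M"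
  by (simp add: left_module_def left_module_axioms_def Module.module_def module_axioms_def)

context left_module
begin

lemma smult_zero_right: "a \<in> carrier R \<Longrightarrow> a \<odot>\<^bsub>M\<^esub> \<zero>\<^bsub>M\<^esub> = \<zero>\<^bsub>M\<^esub>"
  using smult_r_distr[of a "\<zero>\<^bsub>M\<^esub>" "\<zero>\<^bsub>M\<^esub>"] smult_closed[of a "\<zero>\<^bsub>M\<^esub>"] by simp

lemma smult_zero_left: "x \<in> carrier M \<Longrightarrow> \<zero>\<^bsub>R\<^esub> \<odot>\<^bsub>M\<^esub> x = \<zero>\<^bsub>M\<^esub>"
  using smult_l_distr[of "\<zero>\<^bsub>R\<^esub>" "\<zero>\<^bsub>R\<^esub>" x] smult_closed[of "\<zero>\<^bsub>R\<^esub>" x] by simp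

lemma smult_minus_one:
  assumes "x \<in> carrier M"
  shows "(\<ominus>\<^bsub>R\<^esub> \<one>\<^bsub>R\<^esub>) \<odot>\<^bsub>M\<^esub> x = \<ominus>\<^bsub>M\<^esub> x"
proof -
  have "(\<ominus>\<^bsub>R\<^esub> \<one>\<^bsub>R\<^esub>) \<odot>\<^bsub>M\<^esub> x \<oplus>\<^bsub>M\<^esub> x = \<zero>\<^bsub>M\<^esub>"
    using smult_l_distr[of "\<ominus>\<^bsub>R\<^esub> \<one>\<^bsub>R\<^esub>" "\<one>\<^bsub>R\<^esub>" x] assms
    by (simp add: smult_one smult_zero_left R.l_neg)
  then show ?thesis
    using M.minus_equality[of "(\<ominus>\<^bsub>R\<^esub> \<one>\<^bsub>R\<^esub>) \<odot>\<^bsub>M\<^esub> x" x] assms by (simp add: smult_closed)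
qed

text \<open>Closure under negatives comes from the scalar minus one.\<close>

lemma submoduleI:
  assumes "H \<subseteq> carrier M" "\<zero>\<^bsub>M\<^esub> \<in> H" "\<And>x y. \<lbrakk>x \<in> H; y \<in> H\<rbrakk> \<Longrightarrow> x \<oplus>\<^bsub>M\<^esub> y \<in> H"
    "\<And>a x. \<lbrakk>a \<in> carrier R; x \<in> H\<rbrakk> \<Longrightarrow> a \<odot>\<^bsub>M\<^esub> x \<in> H"
  shows "Module.submodule H R M"
proof (intro Module.submodule.intro subgroup.intro)
  show "inv\<^bsub>add_monoid M\<^esub> x \<in> H" if "x \<in> H" for x
    using assms(4)[of "\<ominus>\<^bsub>R\<^esub> \<one>\<^bsub>R\<^esub>" x] that assms(1) smult_minus_one[of x] by (auto simp: a_inv_def)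
qed (use assms in \<open>auto simp: submodule_axioms_def\<close>)

lemma submoduleD:
  assumes "Module.submodule H R M"
  shows "H \<subseteq> carrier M" "\<zero>\<^bsub>M\<^esub> \<in> H" "\<lbrakk>x \<in> H; y \<in> H\<rbrakk> \<Longrightarrow> x \<oplus>\<^bsub>M\<^esub> y \<in> H"
    "\<lbrakk>a \<in> carrier R; x \<in> H\<rbrakk> \<Longrightarrow> a \<odot>\<^bsub>M\<^esub> x \<in> H" "x \<in> H \<Longrightarrow> \<ominus>\<^bsub>M\<^esub> x \<in> H"
  using assms subgroup.m_inv_closed[of H "add_monoid M" x]
    subgroup.m_closed[of H "add_monoid M" x y] subgroup.one_closed[of H "add_monoid M"]
    subgroup.subset[of H "add_monoid M"]
  by (auto simp: Module.submodule_def submodule_axioms_def a_inv_def)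

text \<open>Module laws pass to the image under a map that respects the operations, even if the
  target is so far only a structure with operations. Quotients, the copies on sets of lists and the
  zero module all obtain their laws from here.\<close>

lemma left_module_image:
  fixes N :: "('r, 'n) module"
  assumes "f ` carrier M = carrier N" "f \<zero>\<^bsub>M\<^esub> = \<zero>\<^bsub>N\<^esub>"
    and "\<And>x y. \<lbrakk>x \<in> carrier M; y \<in> carrier M\<rbrakk> \<Longrightarrow> f (x \<oplus>\<^bsub>M\<^esub> y) = f x \<oplus>\<^bsub>N\<^esub> f y"
    and "\<And>a x. \<lbrakk>a \<in> carrier R; x \<in> carrier M\<rbrakk> \<Longrightarrow> f (a \<odot>\<^bsub>M\<^esub> x) = a \<odot>\<^bsub>N\<^esub> f x"
  shows "left_module R N"
proof -
  have ex: "\<exists>x \<in> carrier M. y = f x" if "y \<in> carrier N" for y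
    using assms(1) that by auto
  have cl: "f x \<in> carrier N" if "x \<in> carrier M" for x
    using assms(1) that by auto
  note add = assms(3)[symmetric] and sm = assms(4)[symmetric]
  have "abelian_group N"
  proof (rule abelian_groupI)
    fix x y z assume "x \<in> carrier N" "y \<in> carrier N" "z \<in> carrier N"
    then obtain x' y' z' where "x' \<in> carrier M" "y' \<in> carrier M" "z' \<in> carrier M" "x = f x'" "y = f y'" "z = f z'"
      using ex by metis
    then show "x \<oplus>\<^bsub>N\<^esub> y \<oplus>\<^bsub>N\<^esub> z = x \<oplus>\<^bsub>N\<^esub> (y \<oplus>\<^bsub>N\<^esub> z)"
      by (simp add: add M.a_assoc)
  next
    fix x y assume "x \<in> carrier N" "y \<in> carrier N"
    then obtain x' y' where "x' \<in> carrier M" "y' \<in> carrier M" "x = f x'" "y = f y'"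
      using ex by metis
    then show "x \<oplus>\<^bsub>N\<^esub> y = y \<oplus>\<^bsub>N\<^esub> x" "x \<oplus>\<^bsub>N\<^esub> y \<in> carrier N"
      by (simp_all add: add M.a_comm cl)
  next
    fix x assume "x \<in> carrier N"
    then obtain x' where x: "x' \<in> carrier M" "x = f x'"
      using ex by metis
    then show "\<zero>\<^bsub>N\<^esub> \<oplus>\<^bsub>N\<^esub> x = x"
      by (simp add: add assms(2)[symmetric])
    show "\<exists>y\<in>carrier N. y \<oplus>\<^bsub>N\<^esub> x = \<zero>\<^bsub>N\<^esub>"
      by (rule bexI[of _ "f (\<ominus>\<^bsub>M\<^esub> x')"]) (use x in \<open>simp_all add: add cl M.l_neg assms(2)\<close>)
  qed (use assms(2) cl in \<open>metis M.zero_closed\<close>)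
  moreover have "left_module_axioms R N"
  proof
    fix x assume "x \<in> carrier N"
    then obtain x' where x: "x' \<in> carrier M" "x = f x'"
      using ex by metis
    then show "\<one>\<^bsub>R\<^esub> \<odot>\<^bsub>N\<^esub> x = x"
      by (simp add: sm smult_one)
    fix a assume a: "a \<in> carrier R"
    then show "a \<odot>\<^bsub>N\<^esub> x \<in> carrier N"
      using x by (simp add: sm smult_closed cl)
    show "(a \<oplus>\<^bsub>R\<^esub> b) \<odot>\<^bsub>N\<^esub> x = a \<odot>\<^bsub>N\<^esub> x \<oplus>\<^bsub>N\<^esub> b \<odot>\<^bsub>N\<^esub> x" if "b \<in> carrier R" for b
      using x a that by (simp add: sm smult_closed add smult_l_distr)
    show "a \<otimes>\<^bsub>R\<^esub> b \<odot>\<^bsub>N\<^esub> x = a \<odot>\<^bsub>N\<^esub> (b \<odot>\<^bsub>N\<^esub> x)" if "b \<in> carrier R" for b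
      using x a that by (simp add: sm smult_closed smult_assoc)
    show "a \<odot>\<^bsub>N\<^esub> (x \<oplus>\<^bsub>N\<^esub> y) = a \<odot>\<^bsub>N\<^esub> x \<oplus>\<^bsub>N\<^esub> a \<odot>\<^bsub>N\<^esub> y" if y: "y \<in> carrier N" for y
    proof -
      obtain y' where "y' \<in> carrier M" "y = f y'"
        using ex y by metis
      then show ?thesis
        using x a by (simp add: sm smult_closed add smult_r_distr)
    qed
  qed
  ultimately show ?thesis
    by (simp add: left_module_def R.ring_axioms)
qed

lemma left_module_sub:
  assumes H: "Module.submodule H R M"
  shows "left_module R (M\<lparr>carrier := H\<rparr>)"
proof -
  note D = submoduleD[OF H]
  have "abelian_group (M\<lparr>carrier := H\<rparr>)"
  proof (rule abelian_groupI)
    show "\<exists>y\<in>carrier (M\<lparr>carrier := H\<rparr>). y \<oplus>\<^bsub>M\<lparr>carrier := H\<rparr>\<^esub> x = \<zero>\<^bsub>M\<lparr>carrier := H\<rparr>\<^esub>"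
      if "x \<in> carrier (M\<lparr>carrier := H\<rparr>)" for x
      using that D by (intro bexI[of _ "\<ominus>\<^bsub>M\<^esub> x"]) (auto simp: M.l_neg)
  qed (use D in \<open>auto simp: M.a_ac subset_iff\<close>)
  moreover have "left_module_axioms R (M\<lparr>carrier := H\<rparr>)"
    by (unfold_locales) (use D in \<open>auto simp: subset_iff smult_l_distr smult_r_distr smult_assoc smult_one\<close>)
  ultimately show ?thesis
    by (simp add: left_module_def R.ring_axioms)
qed

lemma
  assumes N: "Module.submodule N R M"
  shows quotient_proj_onto: "(\<lambda>x. N +>\<^bsub>M\<^esub> x) ` carrier M = carrier (quotient_module M N)"
    and quotient_proj_hom: "(\<lambda>x. N +>\<^bsub>M\<^esub> x) \<in> module_hom R M (quotient_module M N)"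
    and quotient_proj_zero: "x \<in> carrier M \<Longrightarrow> N +>\<^bsub>M\<^esub> x = \<zero>\<^bsub>quotient_module M N\<^esub> \<longleftrightarrow> x \<in> N"
    and left_module_quotient: "left_module R (quotient_module M N)"
proof -
  note D = submoduleD[OF N]
  interpret N: abelian_subgroup N M
    by (rule abelian_subgroupI3) (use N M.abelian_group_axioms in \<open>auto simp: Module.submodule_def additive_subgroup_def\<close>)
  show onto: "(\<lambda>x. N +>\<^bsub>M\<^esub> x) ` carrier M = carrier (quotient_module M N)"
    by (auto simp: quotient_module_def A_RCOSETS_def')
  have add: "N +>\<^bsub>M\<^esub> (x \<oplus>\<^bsub>M\<^esub> y) = (N +>\<^bsub>M\<^esub> x) \<oplus>\<^bsub>quotient_module M N\<^esub> (N +>\<^bsub>M\<^esub> y)"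
    if "x \<in> carrier M" "y \<in> carrier M" for x y
    using N.a_rcos_sum[OF that] by (simp add: quotient_module_def)
  have sm: "N +>\<^bsub>M\<^esub> (a \<odot>\<^bsub>M\<^esub> x) = a \<odot>\<^bsub>quotient_module M N\<^esub> (N +>\<^bsub>M\<^esub> x)"
    if ax: "a \<in> carrier R" "x \<in> carrier M" for a x
  proof -
    \<comment> \<open>The set of multiples by \<open>a\<close> of the elements of a coset can be
      smaller than a coset, for example when \<open>a\<close> is zero. Adding \<open>N\<close> fills
      it up.\<close>
    have "set_add M N ((\<lambda>z. a \<odot>\<^bsub>M\<^esub> z) ` (N +>\<^bsub>M\<^esub> x)) = N +>\<^bsub>M\<^esub> (a \<odot>\<^bsub>M\<^esub> x)"
    proof (intro equalityI subsetI)
      fix z assume "z \<in> set_add M N ((\<lambda>z. a \<odot>\<^bsub>M\<^esub> z) ` (N +>\<^bsub>M\<^esub> x))"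
      then obtain n n' where n: "n \<in> N" "n' \<in> N" "z = n \<oplus>\<^bsub>M\<^esub> a \<odot>\<^bsub>M\<^esub> (n' \<oplus>\<^bsub>M\<^esub> x)"
        by (auto simp: set_add_def' a_r_coset_def')
      then have "z = (n \<oplus>\<^bsub>M\<^esub> a \<odot>\<^bsub>M\<^esub> n') \<oplus>\<^bsub>M\<^esub> a \<odot>\<^bsub>M\<^esub> x"
        using ax D(1) by (auto simp: smult_r_distr smult_closed M.a_assoc subset_iff)
      moreover have "n \<oplus>\<^bsub>M\<^esub> a \<odot>\<^bsub>M\<^esub> n' \<in> N"
        using n ax D by auto
      ultimately show "z \<in> N +>\<^bsub>M\<^esub> (a \<odot>\<^bsub>M\<^esub> x)"
        by (auto simp: a_r_coset_def')
    next
      fix z assume "z \<in> N +>\<^bsub>M\<^esub> (a \<odot>\<^bsub>M\<^esub> x)"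
      then obtain n where n: "n \<in> N" "z = n \<oplus>\<^bsub>M\<^esub> a \<odot>\<^bsub>M\<^esub> x"
        by (auto simp: a_r_coset_def')
      have "x \<in> N +>\<^bsub>M\<^esub> x"
        using N.a_rcos_self ax by simp
      then show "z \<in> set_add M N ((\<lambda>z. a \<odot>\<^bsub>M\<^esub> z) ` (N +>\<^bsub>M\<^esub> x))"
        using n by (auto simp: set_add_def')
    qed
    then show ?thesis
      by (simp add: quotient_module_def)
  qed
  have zero: "\<zero>\<^bsub>quotient_module M N\<^esub> = N" "N +>\<^bsub>M\<^esub> \<zero>\<^bsub>M\<^esub> = N"
    using D(1) by (simp_all add: quotient_module_def)
  show "left_module R (quotient_module M N)"
    by (rule left_module_image[OF onto]) (use add sm zero in auto)
  show "(\<lambda>x. N +>\<^bsub>M\<^esub> x) \<in> module_hom R M (quotient_module M N)"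
    using add sm onto by (auto simp: module_hom_def)
  show "N +>\<^bsub>M\<^esub> x = \<zero>\<^bsub>quotient_module M N\<^esub> \<longleftrightarrow> x \<in> N" if "x \<in> carrier M"
    using that zero N.a_rcos_self[OF that] M.a_coset_join2[OF that] N by (auto simp: Module.submodule_def)
qed

end

lemma module_hom_zero:
  assumes "left_module R M" "left_module R N" "f \<in> module_hom R M N"
  shows "f \<zero>\<^bsub>M\<^esub> = \<zero>\<^bsub>N\<^esub>"
proof -
  interpret M: left_module R M by fact
  interpret N: left_module R N by fact
  have "f (\<zero>\<^bsub>R\<^esub> \<odot>\<^bsub>M\<^esub> \<zero>\<^bsub>M\<^esub>) = \<zero>\<^bsub>R\<^esub> \<odot>\<^bsub>N\<^esub> f \<zero>\<^bsub>M\<^esub>"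
    using assms(3) by (auto simp: module_hom_def)
  moreover have "f \<zero>\<^bsub>M\<^esub> \<in> carrier N"
    using assms(3) by (auto simp: module_hom_def)
  ultimately show ?thesis
    by (simp add: M.smult_zero_left N.smult_zero_left)
qed

lemma module_hom_comp:
  "\<lbrakk>f \<in> module_hom R L M; g \<in> module_hom R M N\<rbrakk> \<Longrightarrow> (\<lambda>x. g (f x)) \<in> module_hom R L N"
  by (auto simp: module_hom_def Pi_iff)

lemma module_hom_inv:
  assumes "left_module R M" "f \<in> module_hom R M N" "bij_betw f (carrier M) (carrier N)"
  shows "inv_into (carrier M) f \<in> module_hom R N M"
proof -
  interpret left_module R M by fact
  let ?g = "inv_into (carrier M) f"
  have g: "?g (f x) = x" if "x \<in> carrier M" for x
    using that assms(3) by (simp add: bij_betw_def)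
  have N: "carrier N = f ` carrier M"
    using assms(3) by (simp add: bij_betw_def)
  have f: "f (x \<oplus>\<^bsub>M\<^esub> y) = f x \<oplus>\<^bsub>N\<^esub> f y" "a \<in> carrier R \<Longrightarrow> f (a \<odot>\<^bsub>M\<^esub> x) = a \<odot>\<^bsub>N\<^esub> f x"
    if "x \<in> carrier M" "y \<in> carrier M" for x y a
    using assms(2) that by (auto simp: module_hom_def)
  show ?thesis
    using g smult_closed unfolding module_hom_def N by (auto simp flip: f)
qed

lemma module_iso_sym: "\<lbrakk>left_module R M; module_iso R M N\<rbrakk> \<Longrightarrow> module_iso R N M"
  unfolding module_iso_def using module_hom_inv bij_betw_inv_into by blast

section \<open>Finitely generated modules over finite-dimensional algebras\<close>

locale fd_alg =
  fixes A :: "'a calg"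
  assumes fd: "fd_algebra A"
begin

sublocale ring A
  using fd by (simp add: fd_algebra_def)

sublocale AV: vectorspace complex_ring A
  using fd by (simp add: fd_algebra_def)

lemma fd_space_alg: "fd_space complex_ring A"
  using fd by (simp add: fd_algebra_def fd_space_def)

lemma smult_mult_left: "\<lbrakk>x \<in> carrier A; y \<in> carrier A\<rbrakk> \<Longrightarrow> (c \<odot>\<^bsub>A\<^esub> x) \<otimes>\<^bsub>A\<^esub> y = c \<odot>\<^bsub>A\<^esub> (x \<otimes>\<^bsub>A\<^esub> y)"
  using fd by (simp add: fd_algebra_def)

lemma smult_mult_right: "\<lbrakk>x \<in> carrier A; y \<in> carrier A\<rbrakk> \<Longrightarrow> x \<otimes>\<^bsub>A\<^esub> (c \<odot>\<^bsub>A\<^esub> y) = c \<odot>\<^bsub>A\<^esub> (x \<otimes>\<^bsub>A\<^esub> y)"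
  using fd by (simp add: fd_algebra_def)

lemma scalar_closed: "x \<in> carrier A \<Longrightarrow> c \<odot>\<^bsub>A\<^esub> x \<in> carrier A"
  by (rule AV.smult_closed) auto

lemma scalar_one_mult: "a \<in> carrier A \<Longrightarrow> (c \<odot>\<^bsub>A\<^esub> \<one>\<^bsub>A\<^esub>) \<otimes>\<^bsub>A\<^esub> a = c \<odot>\<^bsub>A\<^esub> a"
  by (simp add: smult_mult_left)

lemma vectorspace_underlying:
  assumes "left_module A M"
  shows "vectorspace complex_ring (underlying_space A M)"
proof -
  interpret left_module A M by fact
  have "Module.module complex_ring (underlying_space A M)"
  proof (rule moduleI)
    show "abelian_group (underlying_space A M)"
      by (rule abelian_groupI) (auto simp: M.a_ac intro: M.l_neg)
  next
    fix c d :: complex and x assume x: "x \<in> carrier (underlying_space A M)"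
    show "(c \<otimes>\<^bsub>complex_ring\<^esub> d) \<odot>\<^bsub>underlying_space A M\<^esub> x = c \<odot>\<^bsub>underlying_space A M\<^esub> (d \<odot>\<^bsub>underlying_space A M\<^esub> x)"
      using x AV.smult_assoc1[of c d "\<one>\<^bsub>A\<^esub>"]
      by (simp add: smult_assoc[symmetric] scalar_closed scalar_one_mult)
    show "(c \<oplus>\<^bsub>complex_ring\<^esub> d) \<odot>\<^bsub>underlying_space A M\<^esub> x =
      c \<odot>\<^bsub>underlying_space A M\<^esub> x \<oplus>\<^bsub>underlying_space A M\<^esub> d \<odot>\<^bsub>underlying_space A M\<^esub> x"
      using x AV.smult_l_distr[of c d "\<one>\<^bsub>A\<^esub>"]
      by (simp add: smult_l_distr scalar_closed)
  next
    fix x assume x: "x \<in> carrier (underlying_space A M)"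
    show "\<one>\<^bsub>complex_ring\<^esub> \<odot>\<^bsub>underlying_space A M\<^esub> x = x"
      using x AV.smult_one[of "\<one>\<^bsub>A\<^esub>"] by (simp add: smult_one)
  qed (auto simp: class_cring.cring_axioms smult_closed smult_r_distr scalar_closed)
  then show ?thesis
    by (simp add: vectorspace_def class_field)
qed

lemma module_hom_underlying:
  "f \<in> module_hom A M N \<Longrightarrow> f \<in> module_hom complex_ring (underlying_space A M) (underlying_space A N)"
  by (auto simp: module_hom_def scalar_closed)

lemma submodule_subspace:
  assumes "left_module A M" "Module.submodule H A M"
  shows "subspace complex_ring H (underlying_space A M)"
proof -
  interpret left_module A M by fact
  note D = submoduleD[OF assms(2)]
  show ?thesis
    using vectorspace_underlying[OF assms(1)] D
    by (auto simp: subspace_def LinearCombinations.submodule_def vectorspace_def scalar_closed)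
qed

lemma underlying_sub: "underlying_space A (M\<lparr>carrier := H\<rparr>) = (underlying_space A M)\<lparr>carrier := H\<rparr>"
  by (simp add: underlying_space_def restrict_scalars_def with_action_def)

text \<open>The products e b of spanning vectors e of \<open>A\<close> with module generators b span
  a subspace that is stable under \<open>A\<close> and contains the generators. It is thus a
  submodule and all of \<open>M\<close>.\<close>

lemma fg_imp_fd:
  assumes "fg_module A M"
  shows "fd_space complex_ring (underlying_space A M)"
proof -
  interpret left_module A M
    using assms by (simp add: fg_module_def)
  let ?V = "underlying_space A M"
  interpret V: vectorspace complex_ring ?V
    by (rule vectorspace_underlying) unfold_locales
  obtain B where B: "finite B" "B \<subseteq> carrier M"
    "\<And>N. \<lbrakk>Module.submodule N A M; B \<subseteq> N\<rbrakk> \<Longrightarrow> N = carrier M"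
    using assms by (auto simp: fg_module_def)
  obtain E where E: "finite E" "E \<subseteq> carrier A" "AV.span E = carrier A"
    using fd_space_alg by (auto simp: fd_space_def AV.fin_dim_def)
  define S where "S = (\<lambda>(e, b). e \<odot>\<^bsub>M\<^esub> b) ` (E \<times> B)"
  have S: "finite S" "S \<subseteq> carrier ?V"
    using E B by (auto simp: S_def intro!: smult_closed)
  let ?W = "V.span S"
  have W: "LinearCombinations.submodule complex_ring ?W ?V"
    by (rule V.span_is_submodule[OF S(2)])
  have WM: "?W \<subseteq> carrier M"
    using V.span_is_subset2[OF S(2)] by simp
  \<comment> \<open>For a fixed generator b, the a with a b in the span form a subspace of
    \<open>A\<close>, and this subspace contains \<open>E\<close>.\<close>
  have Ab: "a \<odot>\<^bsub>M\<^esub> b \<in> ?W" if "a \<in> carrier A" "b \<in> B" for a b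
  proof -
    have "LinearCombinations.submodule complex_ring {a \<in> carrier A. a \<odot>\<^bsub>M\<^esub> b \<in> ?W} A"
      unfolding LinearCombinations.submodule_def
    proof (intro conjI allI impI)
      show "Module.module complex_ring A" by (rule AV.module_axioms)
      show "\<zero>\<^bsub>A\<^esub> \<in> {a \<in> carrier A. a \<odot>\<^bsub>M\<^esub> b \<in> ?W}"
        using that B(2) W by (auto simp: smult_zero_left subset_iff LinearCombinations.submodule_def)
      show "c \<odot>\<^bsub>A\<^esub> v \<in> {a \<in> carrier A. a \<odot>\<^bsub>M\<^esub> b \<in> ?W}"
        if v: "c \<in> carrier complex_ring" "v \<in> {a \<in> carrier A. a \<odot>\<^bsub>M\<^esub> b \<in> ?W}" for c v
      proof -
        have "(c \<odot>\<^bsub>A\<^esub> \<one>\<^bsub>A\<^esub>) \<odot>\<^bsub>M\<^esub> (v \<odot>\<^bsub>M\<^esub> b) \<in> ?W"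
          using v W by (auto simp: LinearCombinations.submodule_def)
        then show ?thesis
          using v \<open>b \<in> B\<close> B(2) by (auto simp: smult_assoc[symmetric] scalar_closed scalar_one_mult subset_iff)
      qed
    qed (use that B(2) W in \<open>auto simp: smult_l_distr subset_iff LinearCombinations.submodule_def\<close>)
    moreover have "E \<subseteq> {a \<in> carrier A. a \<odot>\<^bsub>M\<^esub> b \<in> ?W}"
      using that E V.in_own_span[OF S(2)] by (auto simp: S_def)
    ultimately have "AV.span E \<subseteq> {a \<in> carrier A. a \<odot>\<^bsub>M\<^esub> b \<in> ?W}"
      by (intro AV.span_is_subset)
    then show ?thesis
      using that E(3) by auto
  qed
  \<comment> \<open>The vectors that all of \<open>A\<close> keeps inside the span form a subspace.
    It contains \<open>S\<close> because a (e b) = (a e) b, which is covered by the previous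
    step.\<close>
  have act: "a \<odot>\<^bsub>M\<^esub> w \<in> ?W" if a: "a \<in> carrier A" and w: "w \<in> ?W" for a w
  proof -
    have "LinearCombinations.submodule complex_ring {w \<in> ?W. \<forall>a \<in> carrier A. a \<odot>\<^bsub>M\<^esub> w \<in> ?W} ?V"
      unfolding LinearCombinations.submodule_def
    proof (intro conjI allI impI)
      show "Module.module complex_ring ?V" by (rule V.module_axioms)
      show "c \<odot>\<^bsub>?V\<^esub> v \<in> {w \<in> ?W. \<forall>a \<in> carrier A. a \<odot>\<^bsub>M\<^esub> w \<in> ?W}"
        if v: "c \<in> carrier complex_ring" "v \<in> {w \<in> ?W. \<forall>a \<in> carrier A. a \<odot>\<^bsub>M\<^esub> w \<in> ?W}" for c v
      proof -
        have vM: "v \<in> carrier M" "c \<odot>\<^bsub>?V\<^esub> v \<in> ?W"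
          using v W WM by (auto simp: LinearCombinations.submodule_def)
        have "a \<odot>\<^bsub>M\<^esub> ((c \<odot>\<^bsub>A\<^esub> \<one>\<^bsub>A\<^esub>) \<odot>\<^bsub>M\<^esub> v) \<in> ?W" if "a \<in> carrier A" for a
          using that v vM scalar_closed[of "\<one>\<^bsub>A\<^esub>" c] by (simp add: smult_assoc[symmetric])
        then show ?thesis
          using vM by simp
      qed
    qed (use WM W in \<open>auto simp: smult_r_distr smult_zero_right subset_iff LinearCombinations.submodule_def\<close>)
    moreover have "S \<subseteq> {w \<in> ?W. \<forall>a \<in> carrier A. a \<odot>\<^bsub>M\<^esub> w \<in> ?W}"
    proof
      fix s assume s: "s \<in> S"
      then obtain e b where "e \<in> E" "b \<in> B" "s = e \<odot>\<^bsub>M\<^esub> b"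
        by (auto simp: S_def)
      then have "a \<odot>\<^bsub>M\<^esub> s \<in> ?W" if "a \<in> carrier A" for a
        using that E(2) B(2) Ab[of "a \<otimes>\<^bsub>A\<^esub> e" b] by (auto simp: smult_assoc[symmetric] subset_iff)
      then show "s \<in> {w \<in> ?W. \<forall>a \<in> carrier A. a \<odot>\<^bsub>M\<^esub> w \<in> ?W}"
        using s V.in_own_span[OF S(2)] by auto
    qed
    ultimately have "?W \<subseteq> {w \<in> ?W. \<forall>a \<in> carrier A. a \<odot>\<^bsub>M\<^esub> w \<in> ?W}"
      by (intro V.span_is_subset)
    then show ?thesis
      using a w by auto
  qed
  have "Module.submodule ?W A M"
    by (rule submoduleI) (use W WM act in \<open>auto simp: LinearCombinations.submodule_def\<close>)
  moreover have "B \<subseteq> ?W"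
    using Ab[of "\<one>\<^bsub>A\<^esub>"] B(2) by (auto simp: smult_one subset_iff)
  ultimately have "?W = carrier M"
    by (rule B(3))
  then show ?thesis
    using S V.vectorspace_axioms by (auto simp: fd_space_def V.fin_dim_def)
qed

text \<open>Submodules are complex subspaces, so a spanning set generates.\<close>

lemma fd_imp_fg:
  assumes "left_module A M" "fd_space complex_ring (underlying_space A M)"
  shows "fg_module A M"
proof -
  interpret left_module A M by fact
  interpret V: vectorspace complex_ring "underlying_space A M"
    using assms(2) by (simp add: fd_space_def)
  obtain B where B: "finite B" "B \<subseteq> carrier M" "V.span B = carrier M"
    using assms(2) by (auto simp: fd_space_def V.fin_dim_def)
  have "N = carrier M" if "Module.submodule N A M" "B \<subseteq> N" for N
  proof -
    have "V.span B \<subseteq> N"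
      using submodule_subspace[OF assms(1) that(1)] that(2)
      by (intro V.span_is_subset) (auto simp: subspace_def)
    then show ?thesis
      using B(3) submoduleD(1)[OF that(1)] by auto
  qed
  then show ?thesis
    using B assms(1) by (auto simp: fg_module_def)
qed

lemma fg_iff: "fg_module A M \<longleftrightarrow> left_module A M \<and> fd_space complex_ring (underlying_space A M)"
  using fg_imp_fd fd_imp_fg by (auto simp: fg_module_def)

lemma
  assumes "fg_module A M" "left_module A N" "f \<in> module_hom A M N" "f ` carrier M = carrier N"
  shows fg_image: "fg_module A N" and mdim_image_le: "mdim A N \<le> mdim A M"
  using fd_space_image[OF _ vectorspace_underlying[OF assms(2)] module_hom_underlying[OF assms(3)]]
    dim_image_le[OF _ vectorspace_underlying[OF assms(2)] module_hom_underlying[OF assms(3)]] assms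
  by (auto simp: fg_iff mdim_def)

lemma
  assumes "fg_module A M" "left_module A N" "module_iso A M N"
  shows fg_iso: "fg_module A N" and mdim_iso: "mdim A N = mdim A M"
proof -
  obtain f where f: "f \<in> module_hom A M N" "bij_betw f (carrier M) (carrier N)"
    using assms(3) by (auto simp: module_iso_def)
  show "fg_module A N" "mdim A N = mdim A M"
    using fd_space_iso[OF _ vectorspace_underlying[OF assms(2)] module_hom_underlying[OF f(1)]]
      dim_iso[OF _ vectorspace_underlying[OF assms(2)] module_hom_underlying[OF f(1)]] assms f(2)
    by (auto simp: fg_iff mdim_def)
qed

lemma
  assumes "fg_module A M" "Module.submodule H A M"
  shows fg_sub: "fg_module A (M\<lparr>carrier := H\<rparr>)"
    and mdim_sub_le: "mdim A (M\<lparr>carrier := H\<rparr>) \<le> mdim A M"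
    and mdim_sub_eq: "mdim A (M\<lparr>carrier := H\<rparr>) = mdim A M \<Longrightarrow> H = carrier M"
proof -
  have M: "left_module A M" "fd_space complex_ring (underlying_space A M)"
    using assms(1) by (auto simp: fg_iff)
  note s = submodule_subspace[OF M(1) assms(2)]
  show "fg_module A (M\<lparr>carrier := H\<rparr>)"
    using fd_space_subspace[OF M(2) s] left_module.left_module_sub[OF M(1) assms(2)]
    by (simp add: fg_iff underlying_sub)
  show "mdim A (M\<lparr>carrier := H\<rparr>) \<le> mdim A M"
    using dim_subspace_le[OF M(2) s] by (simp add: mdim_def underlying_sub)
  show "mdim A (M\<lparr>carrier := H\<rparr>) = mdim A M \<Longrightarrow> H = carrier M"
    using subspace_eqI[OF M(2) s] by (simp add: mdim_def underlying_sub)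
qed

lemma fg_quotient:
  assumes "fg_module A M" "Module.submodule N A M"
  shows "fg_module A (quotient_module M N)"
proof -
  interpret left_module A M
    using assms(1) by (simp add: fg_module_def)
  show ?thesis
    by (rule fg_image[OF assms(1) left_module_quotient quotient_proj_hom quotient_proj_onto]) (rule assms(2))+
qed

text \<open>Rank-nullity on the underlying spaces. This additivity is exactly the respect for
  relators that lets dimension descend to the Grothendieck group.\<close>

lemma mdim_exact:
  assumes "fg_module A M" "left_module A L" "left_module A N" "short_exact A L M N"
  shows "mdim A M = mdim A L + mdim A N"
proof -
  obtain f g where fg: "f \<in> module_hom A L M" "g \<in> module_hom A M N"
    "inj_on f (carrier L)" "g ` carrier M = carrier N" "f ` carrier L = a_kernel M N g"
    using assms(4) by (auto simp: short_exact_def)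
  show ?thesis
    unfolding mdim_def
    by (rule dim_exact[OF _ _ _ module_hom_underlying[OF fg(1)] _ module_hom_underlying[OF fg(2)]])
      (use assms fg in \<open>auto simp: fg_iff vectorspace_underlying a_kernel_def'\<close>)
qed

lemma left_module_regular: "left_module A (regular_module A)"
proof -
  have "abelian_group (regular_module A)"
    by (rule abelian_groupI) (auto simp: a_ac intro: l_neg)
  then show ?thesis
    by (auto simp: left_module_def left_module_axioms_def ring_axioms l_distr r_distr m_assoc)
qed

lemma
  shows fg_regular: "fg_module A (regular_module A)"
    and mdim_regular: "mdim A (regular_module A) = vectorspace.dim complex_ring A"
proof -
  have id: "(\<lambda>x. x) \<in> module_hom complex_ring A (underlying_space A (regular_module A))"
    by (auto simp: module_hom_def scalar_one_mult)
  have v: "vectorspace complex_ring (underlying_space A (regular_module A))"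
    by (rule vectorspace_underlying[OF left_module_regular])
  show "fg_module A (regular_module A)"
    using fd_space_iso[OF fd_space_alg v id] left_module_regular by (auto simp: fg_iff bij_betw_def)
  show "mdim A (regular_module A) = vectorspace.dim complex_ring A"
    using dim_iso[OF fd_space_alg v id] by (auto simp: mdim_def bij_betw_def)
qed

end

section \<open>Grothendieck groups\<close>

fun list_comb :: "('r, 'm) module \<Rightarrow> 'r list \<Rightarrow> 'm list \<Rightarrow> 'm" where
  "list_comb M (c # cs) (b # bs) = c \<odot>\<^bsub>M\<^esub> b \<oplus>\<^bsub>M\<^esub> list_comb M cs bs"
| "list_comb M _ _ = \<zero>\<^bsub>M\<^esub>"

context left_module
begin

definition combs :: "'m list \<Rightarrow> 'm set" where
  "combs bs = {list_comb M cs bs | cs. length cs = length bs \<and> set cs \<subseteq> carrier R}"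

lemma list_comb_closed: "\<lbrakk>set cs \<subseteq> carrier R; set bs \<subseteq> carrier M\<rbrakk> \<Longrightarrow> list_comb M cs bs \<in> carrier M"
proof (induction cs arbitrary: bs)
  case (Cons c cs)
  then show ?case
    by (cases bs) (auto simp: smult_closed)
qed simp

lemma combs_Nil: "combs [] = {\<zero>\<^bsub>M\<^esub>}"
  by (auto simp: combs_def)

lemma combs_Cons: "combs (b # bs) = {c \<odot>\<^bsub>M\<^esub> b \<oplus>\<^bsub>M\<^esub> x | c x. c \<in> carrier R \<and> x \<in> combs bs}"
proof (intro equalityI subsetI)
  fix z assume "z \<in> combs (b # bs)"
  then obtain cs where "z = list_comb M cs (b # bs)" "length cs = Suc (length bs)" "set cs \<subseteq> carrier R"
    by (auto simp: combs_def)
  then show "z \<in> {c \<odot>\<^bsub>M\<^esub> b \<oplus>\<^bsub>M\<^esub> x | c x. c \<in> carrier R \<and> x \<in> combs bs}"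
    by (cases cs) (auto simp: combs_def)
next
  fix z assume "z \<in> {c \<odot>\<^bsub>M\<^esub> b \<oplus>\<^bsub>M\<^esub> x | c x. c \<in> carrier R \<and> x \<in> combs bs}"
  then obtain c cs where "c \<in> carrier R" "length cs = length bs" "set cs \<subseteq> carrier R"
    "z = list_comb M (c # cs) (b # bs)"
    by (auto simp: combs_def)
  then show "z \<in> combs (b # bs)"
    unfolding combs_def by (intro CollectI exI[of _ "c # cs"]) auto
qed

lemma combs_submodule: "set bs \<subseteq> carrier M \<Longrightarrow> Module.submodule (combs bs) R M \<and> set bs \<subseteq> combs bs"
proof (induction bs)
  case Nil
  then show ?case
    by (auto simp: combs_Nil smult_zero_right intro: submoduleI)
next
  case (Cons b bs)
  then have b: "b \<in> carrier M" and sub: "Module.submodule (combs bs) R M" and bs: "set bs \<subseteq> combs bs"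
    by auto
  note D = submoduleD[OF sub]
  have mem: "c \<odot>\<^bsub>M\<^esub> b \<oplus>\<^bsub>M\<^esub> x \<in> combs (b # bs)" if "c \<in> carrier R" "x \<in> combs bs" for c x
    using that by (auto simp: combs_Cons)
  have "Module.submodule (combs (b # bs)) R M"
  proof (rule submoduleI)
    show "combs (b # bs) \<subseteq> carrier M"
      using b D(1) by (auto simp: combs_Cons smult_closed subset_iff)
    show "\<zero>\<^bsub>M\<^esub> \<in> combs (b # bs)"
      using mem[of "\<zero>\<^bsub>R\<^esub>" "\<zero>\<^bsub>M\<^esub>"] b D(2) by (simp add: smult_zero_left)
  next
    fix x y assume "x \<in> combs (b # bs)" "y \<in> combs (b # bs)"
    then obtain c u d v where cd: "c \<in> carrier R" "d \<in> carrier R" "u \<in> combs bs" "v \<in> combs bs"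
      "x = c \<odot>\<^bsub>M\<^esub> b \<oplus>\<^bsub>M\<^esub> u" "y = d \<odot>\<^bsub>M\<^esub> b \<oplus>\<^bsub>M\<^esub> v"
      by (auto simp: combs_Cons)
    have uv: "u \<in> carrier M" "v \<in> carrier M"
      using cd D(1) by auto
    have "x \<oplus>\<^bsub>M\<^esub> y = (c \<oplus>\<^bsub>R\<^esub> d) \<odot>\<^bsub>M\<^esub> b \<oplus>\<^bsub>M\<^esub> (u \<oplus>\<^bsub>M\<^esub> v)"
      using cd uv b by (simp add: smult_l_distr smult_closed M.a_ac)
    then show "x \<oplus>\<^bsub>M\<^esub> y \<in> combs (b # bs)"
      using mem[of "c \<oplus>\<^bsub>R\<^esub> d" "u \<oplus>\<^bsub>M\<^esub> v"] cd D(3) by simp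
  next
    fix a x assume a: "a \<in> carrier R" and "x \<in> combs (b # bs)"
    then obtain c u where cu: "c \<in> carrier R" "u \<in> combs bs" "x = c \<odot>\<^bsub>M\<^esub> b \<oplus>\<^bsub>M\<^esub> u"
      by (auto simp: combs_Cons)
    have "a \<odot>\<^bsub>M\<^esub> x = (a \<otimes>\<^bsub>R\<^esub> c) \<odot>\<^bsub>M\<^esub> b \<oplus>\<^bsub>M\<^esub> a \<odot>\<^bsub>M\<^esub> u"
      using a cu b subsetD[OF D(1) cu(2)] by (simp add: smult_r_distr smult_closed smult_assoc)
    then show "a \<odot>\<^bsub>M\<^esub> x \<in> combs (b # bs)"
      using mem[of "a \<otimes>\<^bsub>R\<^esub> c" "a \<odot>\<^bsub>M\<^esub> u"] a cu D(4) by simp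
  qed
  moreover have "b \<in> combs (b # bs)"
    using mem[of "\<one>\<^bsub>R\<^esub>" "\<zero>\<^bsub>M\<^esub>"] b D(2) by (simp add: smult_one)
  moreover have "x \<in> combs (b # bs)" if "x \<in> set bs" for x
    using mem[of "\<zero>\<^bsub>R\<^esub>" x] b bs that D(1) by (auto simp: smult_zero_left subset_iff)
  ultimately show ?case
    by auto
qed

end

text \<open>An element is encoded by the set of all coefficient lists that represent it, that is, by
  its fibre under R^k -> M. Fibres are nonempty since the listed elements generate, so the encoding
  is injective and the operations can be transported.\<close>

lemma umodule_exists:
  fixes M :: "('r, 'm) module"
  assumes "fg_module R M"
  obtains U :: "'r umodule" where "left_module R U" "module_iso R U M"
proof -
  interpret left_module R M
    using assms by (simp add: fg_module_def)
  obtain B where B: "finite B" "B \<subseteq> carrier M"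
    "\<And>N. \<lbrakk>Module.submodule N R M; B \<subseteq> N\<rbrakk> \<Longrightarrow> N = carrier M"
    using assms by (auto simp: fg_module_def)
  obtain bs where bs: "set bs = B"
    using finite_list[OF B(1)] by blast
  have gen: "combs bs = carrier M"
    using combs_submodule[of bs] B bs by auto
  define g where "g x = {cs. length cs = length bs \<and> set cs \<subseteq> carrier R \<and> list_comb M cs bs = x}" for x
  have inj: "inj_on g (carrier M)"
  proof (rule inj_onI)
    fix x y assume "x \<in> carrier M" "y \<in> carrier M" and eq: "g x = g y"
    then have "x \<in> combs bs"
      using gen by simp
    then obtain cs where "cs \<in> g x"
      by (auto simp: g_def combs_def)
    then have "cs \<in> g x" "cs \<in> g y"
      using eq by auto
    then show "x = y"
      by (simp add: g_def)
  qed
  let ?h = "inv_into (carrier M) g"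
  have h: "?h (g x) = x" if "x \<in> carrier M" for x
    using that inj by simp
  define U :: "'r umodule" where "U = \<lparr>carrier = g ` carrier M, monoid.mult = undefined, monoid.one = undefined,
    ring.zero = g \<zero>\<^bsub>M\<^esub>, ring.add = (\<lambda>u v. g (?h u \<oplus>\<^bsub>M\<^esub> ?h v)), smult = (\<lambda>a u. g (a \<odot>\<^bsub>M\<^esub> ?h u))\<rparr>"
  have lU: "left_module R U"
    by (rule left_module_image[of g]) (auto simp: U_def h)
  have "g \<in> module_hom R M U"
    by (auto simp: module_hom_def U_def h)
  moreover have "bij_betw g (carrier M) (carrier U)"
    using inj by (simp add: U_def bij_betw_def)
  ultimately have "module_iso R M U"
    by (auto simp: module_iso_def)
  then have "module_iso R U M"
    by (rule module_iso_sym[rotated]) unfold_locales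
  then show thesis
    using lU that by blast
qed

section \<open>The Grothendieck group and the dimension homomorphism\<close>

lemma G0_presentation: "presentation (fg_modules R) (G0_rels R)"
proof
  have "Poly_Mapping.keys (frag_of a - frag_of b - frag_of c) \<subseteq> S" if "a \<in> S" "b \<in> S" "c \<in> S"
    for a b c :: "'a umodule" and S
    using that keys_diff[of "frag_of a - frag_of b" "frag_of c"] keys_diff[of "frag_of a" "frag_of b"] by auto
  then show "G0_rels R \<subseteq> carrier (free_Abelian_group (fg_modules R))"
    unfolding G0_rels_def by auto
qed

interpretation G0: presentation "fg_modules R" "G0_rels R" for R
  by (rule G0_presentation)

lemma comm_group_G0: "comm_group (G0 R)"
  unfolding G0_def by (rule G0.comm_group)

lemma comm_group_Zq: "comm_group (add_monoid Zq)"
  using class_ring.a_comm_group by simp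

text \<open>Dimensions are recorded as constant polynomials, ready for the extension of scalars to
  \<Z>[q].\<close>

definition gdim :: "'a calg \<Rightarrow> 'a groth \<Rightarrow> int poly" where
  "gdim R = extend_gens (add_monoid Zq) (\<lambda>M. of_nat (mdim R M))"

definition zero_umodule :: "'r umodule" where
  "zero_umodule = \<lparr>carrier = {{}}, monoid.mult = undefined, monoid.one = undefined,
     ring.zero = {}, ring.add = (\<lambda>_ _. {}), smult = (\<lambda>_ _. {})\<rparr>"

context fd_alg
begin

lemma umodule_representative:
  assumes "fg_module A M"
  defines "U \<equiv> SOME U. U \<in> fg_modules A \<and> module_iso A U M"
  shows "U \<in> fg_modules A" "module_iso A U M" "mdim A U = mdim A M"
proof -
  obtain U' :: "'a umodule" where U': "left_module A U'" "module_iso A U' M"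
    using umodule_exists[OF assms(1)] .
  have "fg_module A U'"
    by (rule fg_iso[OF assms(1) U'(1) module_iso_sym[OF U']])
  then have "\<exists>U. U \<in> fg_modules A \<and> module_iso A U M"
    using U' by (auto simp: fg_modules_def)
  from someI_ex[OF this] show U: "U \<in> fg_modules A" "module_iso A U M"
    by (simp_all add: U_def)
  then show "mdim A U = mdim A M"
    using mdim_iso[of U M] assms(1) by (simp add: fg_modules_def fg_module_def)
qed

lemma zero_umodule: "zero_umodule \<in> fg_modules A"
proof -
  have "left_module A zero_umodule"
  proof -
    interpret left_module A "regular_module A"
      by (rule left_module_regular)
    show ?thesis
      by (rule left_module_image[of "\<lambda>_. {}"]) (auto simp: zero_umodule_def)
  qed
  moreover have "N = carrier zero_umodule" if "Module.submodule N A zero_umodule" for N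
    using left_module.submoduleD(1,2)[OF \<open>left_module A zero_umodule\<close> that] by (auto simp: zero_umodule_def)
  ultimately show ?thesis
    unfolding fg_modules_def fg_module_def by blast
qed

lemma mem_G0_rels:
  "\<lbrakk>L \<in> fg_modules A; M \<in> fg_modules A; N \<in> fg_modules A; short_exact A L M N\<rbrakk> \<Longrightarrow>
    frag_of M - frag_of L - frag_of N \<in> G0_rels A"
  unfolding G0_rels_def by blast

text \<open>The sequence 0 -> U -> M -> 0 -> 0 gives [M] = [U] [0] in multiplicative notation.
  Applied to the zero module itself, the same identity shows that [0] is neutral.\<close>

lemma gen_class_iso:
  assumes "U \<in> fg_modules A" "M \<in> fg_modules A" "module_iso A U M"
  shows "gen_class (fg_modules A) (G0_rels A) U = gen_class (fg_modules A) (G0_rels A) M"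
proof -
  interpret Q: comm_group "presented_group (fg_modules A) (G0_rels A)"
    by (rule G0.comm_group)
  have Z: "gen_class (fg_modules A) (G0_rels A) M =
      gen_class (fg_modules A) (G0_rels A) U \<otimes>\<^bsub>presented_group (fg_modules A) (G0_rels A)\<^esub>
      gen_class (fg_modules A) (G0_rels A) zero_umodule"
    if U: "U \<in> fg_modules A" and M: "M \<in> fg_modules A" and iso: "module_iso A U M" for U M
  proof (rule G0.gen_class_eq_multI[OF mem_G0_rels[OF U M zero_umodule] M U zero_umodule])
    obtain f where f: "f \<in> module_hom A U M" "bij_betw f (carrier U) (carrier M)"
      using iso by (auto simp: module_iso_def)
    interpret M: left_module A M
      using M by (simp add: fg_modules_def fg_module_def)
    have "(\<lambda>_. {}) \<in> module_hom A M zero_umodule"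
      by (auto simp: module_hom_def zero_umodule_def)
    moreover have "(\<lambda>_. {}) ` carrier M = carrier zero_umodule"
      using M.M.zero_closed by (auto simp: zero_umodule_def)
    moreover have "f ` carrier U = a_kernel M zero_umodule (\<lambda>_. {})"
      using f(2) by (auto simp: a_kernel_def' bij_betw_def zero_umodule_def)
    ultimately show "short_exact A U M zero_umodule"
      unfolding short_exact_def using f(1) bij_betw_imp_inj_on[OF f(2)] by blast
  qed
  have "module_iso A zero_umodule zero_umodule"
    unfolding module_iso_def by (rule bexI[of _ "\<lambda>x. x"]) (auto simp: module_hom_def bij_betw_def)
  then have "gen_class (fg_modules A) (G0_rels A) zero_umodule = \<one>\<^bsub>presented_group (fg_modules A) (G0_rels A)\<^esub>"
    using Z[OF zero_umodule zero_umodule] G0.gen_class_closed[OF zero_umodule] by simp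
  then show ?thesis
    using Z[OF assms] G0.gen_class_closed[OF assms(1)] by simp
qed

lemma G0_class_closed: "fg_module A M \<Longrightarrow> G0_class A M \<in> carrier (G0 A)"
  unfolding G0_class_def G0_def by (rule G0.gen_class_closed) (rule umodule_representative(1))

lemma G0_class_umodule: "M \<in> fg_modules A \<Longrightarrow> G0_class A M = gen_class (fg_modules A) (G0_rels A) M"
  using umodule_representative[of M] unfolding G0_class_def
  by (intro gen_class_iso) (auto simp: fg_modules_def)

lemma G0_induct [consumes 1, case_names one gen mult inv]:
  assumes "x \<in> carrier (G0 A)" "Q \<one>\<^bsub>G0 A\<^esub>" "\<And>M. M \<in> fg_modules A \<Longrightarrow> Q (G0_class A M)"
    "\<And>a b. \<lbrakk>a \<in> carrier (G0 A); b \<in> carrier (G0 A); Q a; Q b\<rbrakk> \<Longrightarrow> Q (a \<otimes>\<^bsub>G0 A\<^esub> b)"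
    "\<And>a. \<lbrakk>a \<in> carrier (G0 A); Q a\<rbrakk> \<Longrightarrow> Q (inv\<^bsub>G0 A\<^esub> a)"
  shows "Q x"
  using assms(1) unfolding G0_def
  by (induction x rule: G0.induct) (use assms G0_class_umodule in \<open>auto simp: G0_def\<close>)

lemma
  shows gdim_hom: "gdim A \<in> hom (G0 A) (add_monoid Zq)"
    and gdim_gen_class: "M \<in> fg_modules A \<Longrightarrow> gdim A (gen_class (fg_modules A) (G0_rels A) M) = of_nat (mdim A M)"
proof -
  have resp: "word_value (add_monoid Zq) (\<lambda>M. of_nat (mdim A M)) e = \<one>\<^bsub>add_monoid Zq\<^esub>" if "e \<in> G0_rels A" for e
    using that unfolding G0_rels_def
  proof (elim CollectE exE conjE)
    fix L M N assume *: "L \<in> fg_modules A" "M \<in> fg_modules A" "N \<in> fg_modules A" "short_exact A L M N"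
      and e: "e = frag_of M - frag_of L - frag_of N"
    have "mdim A M = mdim A L + mdim A N"
      by (rule mdim_exact) (use * in \<open>auto simp: fg_modules_def fg_module_def\<close>)
    then show ?thesis
      unfolding e by (intro word_value_diff2_eq_one comm_group_Zq) auto
  qed
  note * = G0.extend_gens_hom[OF comm_group_Zq _ resp] G0.extend_gens_gen[OF comm_group_Zq _ resp]
  show "gdim A \<in> hom (G0 A) (add_monoid Zq)"
    unfolding gdim_def G0_def by (rule *(1)) auto
  show "gdim A (gen_class (fg_modules A) (G0_rels A) M) = of_nat (mdim A M)" if "M \<in> fg_modules A"
    unfolding gdim_def by (rule *(2)) (use that in auto)
qed

lemma gdim_class: "fg_module A M \<Longrightarrow> gdim A (G0_class A M) = of_nat (mdim A M)"
  using umodule_representative[of M] by (simp add: G0_class_def gdim_gen_class)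

lemma gdim_mult: "\<lbrakk>x \<in> carrier (G0 A); y \<in> carrier (G0 A)\<rbrakk> \<Longrightarrow> gdim A (x \<otimes>\<^bsub>G0 A\<^esub> y) = gdim A x + gdim A y"
  using gdim_hom by (auto simp: hom_def)

lemma gdim_one: "gdim A \<one>\<^bsub>G0 A\<^esub> = 0"
  using hom_one[OF gdim_hom] comm_group_G0[of A] comm_group_Zq
  by (simp add: comm_group_def)

end

section \<open>Outer tensor products\<close>

text \<open>Both the multiplication of \<open>A \<otimes> B\<close> and its action on \<open>M \<otimes> N\<close> are instances of \<open>act\<close>.\<close>

locale tensor_action =
  AB: tensor_modules R A B + VW: tensor_modules R V W
  for R :: "('r, 'x) ring_scheme" and A :: "('r, 'a) module" and B :: "('r, 'b) module"
    and V :: "('r, 'v) module" and W :: "('r, 'w) module" +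
  fixes \<alpha> :: "'a \<Rightarrow> 'v \<Rightarrow> 'v" and \<beta> :: "'b \<Rightarrow> 'w \<Rightarrow> 'w"
  assumes alpha_right: "a \<in> carrier A \<Longrightarrow> \<alpha> a \<in> module_hom R V V"
    and alpha_left: "v \<in> carrier V \<Longrightarrow> (\<lambda>a. \<alpha> a v) \<in> module_hom R A V"
    and beta_right: "b \<in> carrier B \<Longrightarrow> \<beta> b \<in> module_hom R W W"
    and beta_left: "w \<in> carrier W \<Longrightarrow> (\<lambda>b. \<beta> b w) \<in> module_hom R B W"
begin

lemma alpha:
  "\<lbrakk>a \<in> carrier A; v \<in> carrier V\<rbrakk> \<Longrightarrow> \<alpha> a v \<in> carrier V"
  "\<lbrakk>a \<in> carrier A; v \<in> carrier V; v' \<in> carrier V\<rbrakk> \<Longrightarrow> \<alpha> a (v \<oplus>\<^bsub>V\<^esub> v') = \<alpha> a v \<oplus>\<^bsub>V\<^esub> \<alpha> a v'"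
  "\<lbrakk>a \<in> carrier A; r \<in> carrier R; v \<in> carrier V\<rbrakk> \<Longrightarrow> \<alpha> a (r \<odot>\<^bsub>V\<^esub> v) = r \<odot>\<^bsub>V\<^esub> \<alpha> a v"
  "\<lbrakk>a \<in> carrier A; a' \<in> carrier A; v \<in> carrier V\<rbrakk> \<Longrightarrow> \<alpha> (a \<oplus>\<^bsub>A\<^esub> a') v = \<alpha> a v \<oplus>\<^bsub>V\<^esub> \<alpha> a' v"
  "\<lbrakk>r \<in> carrier R; a \<in> carrier A; v \<in> carrier V\<rbrakk> \<Longrightarrow> \<alpha> (r \<odot>\<^bsub>A\<^esub> a) v = r \<odot>\<^bsub>V\<^esub> \<alpha> a v"
  using alpha_right[of a] alpha_left[of v] by (auto simp: module_hom_def)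

lemma beta:
  "\<lbrakk>b \<in> carrier B; w \<in> carrier W\<rbrakk> \<Longrightarrow> \<beta> b w \<in> carrier W"
  "\<lbrakk>b \<in> carrier B; w \<in> carrier W; w' \<in> carrier W\<rbrakk> \<Longrightarrow> \<beta> b (w \<oplus>\<^bsub>W\<^esub> w') = \<beta> b w \<oplus>\<^bsub>W\<^esub> \<beta> b w'"
  "\<lbrakk>b \<in> carrier B; r \<in> carrier R; w \<in> carrier W\<rbrakk> \<Longrightarrow> \<beta> b (r \<odot>\<^bsub>W\<^esub> w) = r \<odot>\<^bsub>W\<^esub> \<beta> b w"
  "\<lbrakk>b \<in> carrier B; b' \<in> carrier B; w \<in> carrier W\<rbrakk> \<Longrightarrow> \<beta> (b \<oplus>\<^bsub>B\<^esub> b') w = \<beta> b w \<oplus>\<^bsub>W\<^esub> \<beta> b' w"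
  "\<lbrakk>r \<in> carrier R; b \<in> carrier B; w \<in> carrier W\<rbrakk> \<Longrightarrow> \<beta> (r \<odot>\<^bsub>B\<^esub> b) w = r \<odot>\<^bsub>W\<^esub> \<beta> b w"
  using beta_right[of b] beta_left[of w] by (auto simp: module_hom_def)

text \<open>The action of one pure tensor, from which \<open>act\<close> arises by lifting in the
  pair (a, b).\<close>

definition act1 :: "'a \<Rightarrow> 'b \<Rightarrow> ('v, 'w) tensor \<Rightarrow> ('v, 'w) tensor" where
  "act1 a b u = tensor_lift VW.TM (\<lambda>x y. VW.pt (\<alpha> a x) (\<beta> b y)) u"

definition act :: "('a, 'b) tensor \<Rightarrow> ('v, 'w) tensor \<Rightarrow> ('v, 'w) tensor" where
  "act t u = tensor_lift VW.TM (\<lambda>a b. tensor_lift VW.TM (\<lambda>x y. VW.pt (\<alpha> a x) (\<beta> b y)) u) t"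

interpretation TM: Module.module R VW.TM
  by (rule VW.module_TM)

lemma
  assumes "a \<in> carrier A" "b \<in> carrier B"
  shows act1_hom: "act1 a b \<in> module_hom R VW.TM VW.TM"
    and act1_pure: "\<lbrakk>x \<in> carrier V; y \<in> carrier W\<rbrakk> \<Longrightarrow> act1 a b (VW.pt x y) = VW.pt (\<alpha> a x) (\<beta> b y)"
proof -
  note s = VW.TM_simps alpha beta assms VW.pure_closed VW.pure_add_left VW.pure_add_right
    VW.TM_smult_pure VW.TM_smult_pure_right VW.pure_balanced
  show "act1 a b \<in> module_hom R VW.TM VW.TM"
    unfolding act1_def[abs_def] by (rule VW.TM_lift_hom[OF VW.module_TM]) (auto simp: s)
  show "act1 a b (VW.pt x y) = VW.pt (\<alpha> a x) (\<beta> b y)" if "x \<in> carrier V" "y \<in> carrier W"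
    unfolding act1_def by (rule VW.TM_lift_pure[OF VW.module_TM]) (use that in \<open>auto simp: s\<close>)
qed

lemma act1:
  assumes "a \<in> carrier A" "b \<in> carrier B" "u \<in> carrier VW.T" "u' \<in> carrier VW.T"
  shows "act1 a b u \<in> carrier VW.T"
    "act1 a b (u \<otimes>\<^bsub>VW.T\<^esub> u') = act1 a b u \<otimes>\<^bsub>VW.T\<^esub> act1 a b u'"
    "r \<in> carrier R \<Longrightarrow> act1 a b (r \<odot>\<^bsub>VW.TM\<^esub> u) = r \<odot>\<^bsub>VW.TM\<^esub> act1 a b u"
  using act1_hom[OF assms(1,2)] assms(3,4) by (auto simp: module_hom_def VW.TM_simps)

text \<open>This is the condition for lifting \<open>act1\<close> to arbitrary tensors of
  \<open>A\<close> and \<open>B\<close>; it is checked on pure tensors \<open>u\<close>.\<close>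

lemma act1_bilinear:
  assumes u: "u \<in> carrier VW.T" and a: "a \<in> carrier A" and b: "b \<in> carrier B"
  shows "a' \<in> carrier A \<Longrightarrow> act1 (a \<oplus>\<^bsub>A\<^esub> a') b u = act1 a b u \<otimes>\<^bsub>VW.T\<^esub> act1 a' b u"
    "b' \<in> carrier B \<Longrightarrow> act1 a (b \<oplus>\<^bsub>B\<^esub> b') u = act1 a b u \<otimes>\<^bsub>VW.T\<^esub> act1 a b' u"
    "r \<in> carrier R \<Longrightarrow> act1 (r \<odot>\<^bsub>A\<^esub> a) b u = r \<odot>\<^bsub>VW.TM\<^esub> act1 a b u"
    "r \<in> carrier R \<Longrightarrow> act1 a (r \<odot>\<^bsub>B\<^esub> b) u = r \<odot>\<^bsub>VW.TM\<^esub> act1 a b u"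
proof -
  note s = VW.TM_simps alpha beta act1_pure VW.pure_closed VW.pure_add_left VW.pure_add_right
    VW.TM_smult_pure VW.TM_smult_pure_right VW.pure_balanced VW.TM_smult_add act1
  show "act1 (a \<oplus>\<^bsub>A\<^esub> a') b u = act1 a b u \<otimes>\<^bsub>VW.T\<^esub> act1 a' b u" if a': "a' \<in> carrier A"
    using u by (induction u rule: VW.tensor_induct) (use a b a' in \<open>auto simp: s VW.T.m_ac\<close>)
  show "act1 a (b \<oplus>\<^bsub>B\<^esub> b') u = act1 a b u \<otimes>\<^bsub>VW.T\<^esub> act1 a b' u" if b': "b' \<in> carrier B"
    using u by (induction u rule: VW.tensor_induct) (use a b b' in \<open>auto simp: s VW.T.m_ac\<close>)
  show "act1 (r \<odot>\<^bsub>A\<^esub> a) b u = r \<odot>\<^bsub>VW.TM\<^esub> act1 a b u" if r: "r \<in> carrier R"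
    using u by (induction u rule: VW.tensor_induct) (use a b r in \<open>auto simp: s\<close>)
  show "act1 a (r \<odot>\<^bsub>B\<^esub> b) u = r \<odot>\<^bsub>VW.TM\<^esub> act1 a b u" if r: "r \<in> carrier R"
    using u by (induction u rule: VW.tensor_induct) (use a b r in \<open>auto simp: s\<close>)
qed

lemma
  assumes "u \<in> carrier VW.T"
  shows act_hom_left: "(\<lambda>t. act t u) \<in> module_hom R AB.TM VW.TM"
    and act_pure_left: "\<lbrakk>a \<in> carrier A; b \<in> carrier B\<rbrakk> \<Longrightarrow> act (AB.pt a b) u = act1 a b u"
proof -
  have eq: "(\<lambda>t. act t u) = tensor_lift VW.TM (\<lambda>a b. act1 a b u)"
    by (simp add: act_def act1_def fun_eq_iff)
  show "(\<lambda>t. act t u) \<in> module_hom R AB.TM VW.TM"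
    unfolding eq by (rule AB.TM_lift_hom[OF VW.module_TM])
      (use assms in \<open>auto simp: act1 act1_bilinear VW.TM_simps\<close>)
  have "tensor_lift VW.TM (\<lambda>a b. act1 a b u) (AB.pt a b) = act1 a b u"
    if "a \<in> carrier A" "b \<in> carrier B"
    by (rule AB.TM_lift_pure[OF VW.module_TM])
      (use assms that in \<open>auto simp: act1 act1_bilinear VW.TM_simps\<close>)
  then show "act (AB.pt a b) u = act1 a b u" if "a \<in> carrier A" "b \<in> carrier B"
    using that eq by metis
qed

lemma act_pure:
  "\<lbrakk>a \<in> carrier A; b \<in> carrier B; x \<in> carrier V; y \<in> carrier W\<rbrakk> \<Longrightarrow>
    act (AB.pt a b) (VW.pt x y) = VW.pt (\<alpha> a x) (\<beta> b y)"
  by (simp add: act_pure_left VW.pure_closed act1_pure)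

lemma act_left:
  assumes "u \<in> carrier VW.T" "t \<in> carrier AB.T" "t' \<in> carrier AB.T"
  shows "act t u \<in> carrier VW.T"
    "act (t \<otimes>\<^bsub>AB.T\<^esub> t') u = act t u \<otimes>\<^bsub>VW.T\<^esub> act t' u"
    "r \<in> carrier R \<Longrightarrow> act (r \<odot>\<^bsub>AB.TM\<^esub> t) u = r \<odot>\<^bsub>VW.TM\<^esub> act t u"
  using act_hom_left[OF assms(1)] assms(2,3) by (auto simp: module_hom_def VW.TM_simps AB.TM_simps)

lemma act_right:
  assumes "t \<in> carrier AB.T" "u \<in> carrier VW.T"
  shows "u' \<in> carrier VW.T \<Longrightarrow> act t (u \<otimes>\<^bsub>VW.T\<^esub> u') = act t u \<otimes>\<^bsub>VW.T\<^esub> act t u'"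
    "r \<in> carrier R \<Longrightarrow> act t (r \<odot>\<^bsub>VW.TM\<^esub> u) = r \<odot>\<^bsub>VW.TM\<^esub> act t u"
proof -
  show "act t (u \<otimes>\<^bsub>VW.T\<^esub> u') = act t u \<otimes>\<^bsub>VW.T\<^esub> act t u'" if "u' \<in> carrier VW.T"
    using assms(1)
    by (induction t rule: AB.tensor_induct)
      (use that assms(2) in \<open>auto simp: act_pure_left act1 act_left VW.T.m_ac\<close>)
  show "act t (r \<odot>\<^bsub>VW.TM\<^esub> u) = r \<odot>\<^bsub>VW.TM\<^esub> act t u" if "r \<in> carrier R"
    using assms(1)
    by (induction t rule: AB.tensor_induct)
      (use that assms(2) in \<open>auto simp: act_pure_left act1 act_left VW.TM_smult_closed VW.TM_smult_add\<close>)
qed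

end

section \<open>The algebra A \<otimes> B and its modules M \<otimes> N\<close>

locale fd_alg_pair = A: fd_alg A + B: fd_alg B
  for A :: "'a calg" and B :: "'b calg" +
  assumes ring_tensor: "ring (tensor_algebra A B)"
begin

abbreviation "TA \<equiv> tensor_algebra A B"

sublocale AB: tensor_modules complex_ring A B
  by unfold_locales

lemma TA_simps [simp]:
  "carrier TA = carrier AB.T" "ring.add TA = monoid.mult AB.T" "ring.zero TA = \<one>\<^bsub>AB.T\<^esub>"
  "smult TA = smult AB.TM" "monoid.one TA = AB.pt \<one>\<^bsub>A\<^esub> \<one>\<^bsub>B\<^esub>"
  by (simp_all add: tensor_algebra_def Let_def tensor_module_def tensor_with_action_simps)

sublocale AB: tensor_action complex_ring A B A B "monoid.mult A" "monoid.mult B"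
  by unfold_locales
    (auto simp: module_hom_def A.l_distr A.r_distr B.l_distr B.r_distr A.smult_mult_left A.smult_mult_right
      B.smult_mult_left B.smult_mult_right)

lemma TA_mult: "s \<otimes>\<^bsub>TA\<^esub> t = AB.act s t"
  by (simp add: tensor_algebra_def Let_def AB.act_def)

sublocale TA: fd_alg TA
proof
  have v: "vectorspace complex_ring TA"
  proof -
    have "Module.module complex_ring TA"
      using AB.module_TM
      by (auto simp: Module.module_def module_axioms_def AB.TM_simps
        intro: abelian_group.intro ring.is_abelian_group[OF ring_tensor])
    then show ?thesis
      by (simp add: vectorspace_def class_field)
  qed
  have id: "(\<lambda>x. x) \<in> module_hom complex_ring AB.TM TA"
    by (auto simp: module_hom_def AB.TM_simps)
  have "fd_space complex_ring TA"
    by (rule fd_space_iso[OF fd_space_tensor[OF A.fd_space_alg B.fd_space_alg] v id])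
      (simp add: bij_betw_def AB.TM_simps)
  then show "fd_algebra TA"
    unfolding fd_algebra_def fd_space_def
    by (auto simp: ring_tensor TA_mult AB.act_left AB.act_right)
qed

context
  fixes M :: "('a, 'm) module" and N :: "('b, 'n) module"
  assumes M: "left_module A M" and N: "left_module B N"
begin

interpretation M: left_module A M by (rule M)
interpretation N: left_module B N by (rule N)
interpretation V: vectorspace complex_ring "underlying_space A M" by (rule A.vectorspace_underlying[OF M])
interpretation W: vectorspace complex_ring "underlying_space B N" by (rule B.vectorspace_underlying[OF N])

interpretation VW: tensor_modules complex_ring "underlying_space A M" "underlying_space B N"
  by unfold_locales

interpretation O: tensor_action complex_ring A B "underlying_space A M" "underlying_space B N" "smult M" "smult N"
proof
  show "smult M a \<in> module_hom complex_ring (underlying_space A M) (underlying_space A M)"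
    if a: "a \<in> carrier A" for a
  proof -
    have "a \<odot>\<^bsub>M\<^esub> ((c \<odot>\<^bsub>A\<^esub> \<one>\<^bsub>A\<^esub>) \<odot>\<^bsub>M\<^esub> x) = (c \<odot>\<^bsub>A\<^esub> \<one>\<^bsub>A\<^esub>) \<odot>\<^bsub>M\<^esub> (a \<odot>\<^bsub>M\<^esub> x)" if "x \<in> carrier M" for c x
      using a that A.smult_mult_right[of a "\<one>\<^bsub>A\<^esub>" c]
      by (simp add: M.smult_assoc[symmetric] A.scalar_closed A.scalar_one_mult)
    then show ?thesis
      using a by (auto simp: module_hom_def M.smult_closed M.smult_r_distr)
  qed
  show "smult N b \<in> module_hom complex_ring (underlying_space B N) (underlying_space B N)"
    if b: "b \<in> carrier B" for b
  proof -
    have "b \<odot>\<^bsub>N\<^esub> ((c \<odot>\<^bsub>B\<^esub> \<one>\<^bsub>B\<^esub>) \<odot>\<^bsub>N\<^esub> x) = (c \<odot>\<^bsub>B\<^esub> \<one>\<^bsub>B\<^esub>) \<odot>\<^bsub>N\<^esub> (b \<odot>\<^bsub>N\<^esub> x)" if "x \<in> carrier N" for c x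
      using b that B.smult_mult_right[of b "\<one>\<^bsub>B\<^esub>" c]
      by (simp add: N.smult_assoc[symmetric] B.scalar_closed B.scalar_one_mult)
    then show ?thesis
      using b by (auto simp: module_hom_def N.smult_closed N.smult_r_distr)
  qed
  show "(\<lambda>a. a \<odot>\<^bsub>M\<^esub> v) \<in> module_hom complex_ring A (underlying_space A M)"
    if "v \<in> carrier (underlying_space A M)" for v
    using that by (auto simp: module_hom_def M.smult_closed M.smult_l_distr M.smult_assoc[symmetric]
      A.scalar_closed A.scalar_one_mult)
  show "(\<lambda>b. b \<odot>\<^bsub>N\<^esub> v) \<in> module_hom complex_ring B (underlying_space B N)"
    if "v \<in> carrier (underlying_space B N)" for v
    using that by (auto simp: module_hom_def N.smult_closed N.smult_l_distr N.smult_assoc[symmetric]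
      B.scalar_closed B.scalar_one_mult)
qed

lemma outer_simps:
  "carrier (outer_tensor A B M N) = carrier VW.T" "ring.add (outer_tensor A B M N) = monoid.mult VW.T"
  "ring.zero (outer_tensor A B M N) = \<one>\<^bsub>VW.T\<^esub>" "t \<odot>\<^bsub>outer_tensor A B M N\<^esub> u = O.act t u"
  by (simp_all add: outer_tensor_def Let_def O.act_def tensor_module_def tensor_with_action_simps)

lemma left_module_outer: "left_module TA (outer_tensor A B M N)"
proof -
  have "abelian_group (outer_tensor A B M N)"
    by (rule comm_group_abelian_groupI, rule comm_group_cong[OF VW.comm_group_tensor])
      (auto simp: outer_simps)
  moreover have "left_module_axioms TA (outer_tensor A B M N)"
  proof
    fix s t u assume st: "s \<in> carrier TA" "t \<in> carrier TA" and u: "u \<in> carrier (outer_tensor A B M N)"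
    \<comment> \<open>Associativity is extended from pure tensors one variable at a time: here s is
      arbitrary while the other two are pure, next t becomes arbitrary, and finally u.\<close>
    have p: "O.act (s \<otimes>\<^bsub>TA\<^esub> AB.pt a' b') (VW.pt x y) = O.act s (O.act (AB.pt a' b') (VW.pt x y))"
      if "s \<in> carrier AB.T" "a' \<in> carrier A" "b' \<in> carrier B" "x \<in> carrier M" "y \<in> carrier N" for s a' b' x y
      using that(1)
    proof (induction s rule: AB.tensor_induct)
      case (pure a b)
      then show ?case
        using that(2-)
        by (simp add: TA_mult AB.act_pure O.act_pure M.smult_assoc N.smult_assoc M.smult_closed N.smult_closed)
    next
      case (add a b)
      then show ?case
        using that(2-)
        by (simp add: TA_mult AB.act_left O.act_left AB.pure_closed VW.pure_closed)
    qed
    have p': "O.act (s \<otimes>\<^bsub>TA\<^esub> t) (VW.pt x y) = O.act s (O.act t (VW.pt x y))"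
      if "s \<in> carrier AB.T" "t \<in> carrier AB.T" "x \<in> carrier M" "y \<in> carrier N" for s t x y
      using that(2)
    proof (induction t rule: AB.tensor_induct)
      case (pure a b)
      then show ?case using p that by simp
    next
      case (add a b)
      then show ?case
        using that by (simp add: TA_mult AB.act_right AB.act_left O.act_left O.act_right VW.pure_closed)
    qed
    have "O.act (s \<otimes>\<^bsub>TA\<^esub> t) u = O.act s (O.act t u)"
      if "u \<in> carrier VW.T" for u
      using that
    proof (induction u rule: VW.tensor_induct)
      case (pure x y)
      then show ?case using p' st by simp
    next
      case (add x y)
      then show ?case
        using st by (simp add: TA_mult AB.act_left O.act_left O.act_right)
    qed
    then show "(s \<otimes>\<^bsub>TA\<^esub> t) \<odot>\<^bsub>outer_tensor A B M N\<^esub> u =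
      s \<odot>\<^bsub>outer_tensor A B M N\<^esub> (t \<odot>\<^bsub>outer_tensor A B M N\<^esub> u)"
      using u by (simp add: outer_simps)
  next
    fix u assume u: "u \<in> carrier (outer_tensor A B M N)"
    have "O.act (AB.pt \<one>\<^bsub>A\<^esub> \<one>\<^bsub>B\<^esub>) u = u" if "u \<in> carrier VW.T" for u
      using that
    proof (induction u rule: VW.tensor_induct)
      case (pure x y)
      then show ?case by (simp add: O.act_pure M.smult_one N.smult_one)
    next
      case (add a b)
      then show ?case by (simp add: O.act_right AB.pure_closed)
    qed
    then show "\<one>\<^bsub>TA\<^esub> \<odot>\<^bsub>outer_tensor A B M N\<^esub> u = u"
      using u by (simp add: outer_simps)
  next
    fix s u assume "s \<in> carrier TA" and "u \<in> carrier (outer_tensor A B M N)"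
    then have su: "s \<in> carrier AB.T" "u \<in> carrier VW.T"
      by (simp_all add: outer_simps)
    then show "s \<odot>\<^bsub>outer_tensor A B M N\<^esub> u \<in> carrier (outer_tensor A B M N)"
      by (simp add: outer_simps O.act_left)
    show "(s \<oplus>\<^bsub>TA\<^esub> t) \<odot>\<^bsub>outer_tensor A B M N\<^esub> u =
      s \<odot>\<^bsub>outer_tensor A B M N\<^esub> u \<oplus>\<^bsub>outer_tensor A B M N\<^esub> t \<odot>\<^bsub>outer_tensor A B M N\<^esub> u"
      if "t \<in> carrier TA" for t
      using su that by (simp add: outer_simps O.act_left)
    show "s \<odot>\<^bsub>outer_tensor A B M N\<^esub> (u \<oplus>\<^bsub>outer_tensor A B M N\<^esub> v) =
      s \<odot>\<^bsub>outer_tensor A B M N\<^esub> u \<oplus>\<^bsub>outer_tensor A B M N\<^esub> s \<odot>\<^bsub>outer_tensor A B M N\<^esub> v"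
      if "v \<in> carrier (outer_tensor A B M N)" for v
      using su that by (simp add: outer_simps O.act_right)
  qed
  ultimately show ?thesis
    by (simp add: left_module_def ring_tensor)
qed

lemma
  assumes "fg_module A M" "fg_module B N"
  shows fg_outer: "fg_module TA (outer_tensor A B M N)"
    and mdim_outer: "mdim TA (outer_tensor A B M N) = mdim A M * mdim B N"
proof -
  have fd: "fd_space complex_ring (underlying_space A M)" "fd_space complex_ring (underlying_space B N)"
    using assms by (simp_all add: A.fg_iff B.fg_iff)
  have v: "vectorspace complex_ring (underlying_space TA (outer_tensor A B M N))"
    by (rule TA.vectorspace_underlying[OF left_module_outer])
  \<comment> \<open>The scalar c in the algebra A \<otimes> B acts as c does on the tensor product
    of vector spaces. So the identity map is an isomorphism between the two spaces, and dimensions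
    multiply.\<close>
  have sm: "O.act (c \<odot>\<^bsub>AB.TM\<^esub> AB.pt \<one>\<^bsub>A\<^esub> \<one>\<^bsub>B\<^esub>) u = c \<odot>\<^bsub>VW.TM\<^esub> u" if "u \<in> carrier VW.T" for c u
  proof -
    have "O.act (AB.pt \<one>\<^bsub>A\<^esub> \<one>\<^bsub>B\<^esub>) u = u"
      using left_module.smult_one[OF left_module_outer, of u] that by (simp add: outer_simps)
    then show ?thesis
      using that O.act_left(3)[of u "AB.pt \<one>\<^bsub>A\<^esub> \<one>\<^bsub>B\<^esub>" "AB.pt \<one>\<^bsub>A\<^esub> \<one>\<^bsub>B\<^esub>" c]
      by (simp add: AB.pure_closed)
  qed
  have id: "(\<lambda>x. x) \<in> module_hom complex_ring VW.TM (underlying_space TA (outer_tensor A B M N))"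
    by (auto simp: module_hom_def VW.TM_simps outer_simps sm)
  have bij: "bij_betw (\<lambda>x. x) (carrier VW.TM) (carrier (underlying_space TA (outer_tensor A B M N)))"
    by (simp add: bij_betw_def VW.TM_simps outer_simps)
  show "fg_module TA (outer_tensor A B M N)"
    using fd_space_iso[OF fd_space_tensor[OF fd] v id bij] left_module_outer by (simp add: TA.fg_iff)
  show "mdim TA (outer_tensor A B M N) = mdim A M * mdim B N"
    using dim_iso[OF fd_space_tensor[OF fd] v id bij] dim_tensor[OF fd] by (simp add: mdim_def)
qed

end

text \<open>The homomorphism \<open>gdim\<close> is moved inside both extensions, where it meets
  only outer tensor products of actual modules, whose dimensions multiply. The inner extension
  contributes the factor for y, the outer one the factor for x.\<close>

lemma gdim_outer:
  assumes x: "x \<in> carrier (G0 A)" and y: "y \<in> carrier (G0 B)"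
  shows "gdim TA (G0_outer A B x y) = gdim A x * gdim B y"
    and "G0_outer A B x y \<in> carrier (G0 TA)"
proof -
  have xy: "x \<in> carrier (presented_group (fg_modules A) (G0_rels A))"
    "y \<in> carrier (presented_group (fg_modules B) (G0_rels B))"
    using x y by (simp_all add: G0_def)
  have fg: "fg_module A M" "left_module A M" if "M \<in> fg_modules A" for M
    using that by (simp_all add: fg_modules_def fg_module_def)
  have fgB: "fg_module B M" "left_module B M" if "M \<in> fg_modules B" for M
    using that by (simp_all add: fg_modules_def fg_module_def)
  have cl: "G0_class TA (outer_tensor A B M N) \<in> carrier (G0 TA)"
    "gdim TA (G0_class TA (outer_tensor A B M N)) = of_nat (mdim A M) * of_nat (mdim B N)"
    if "M \<in> fg_modules A" "N \<in> fg_modules B" for M N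
    using that fg fgB fg_outer[of M N] mdim_outer[of M N] by (simp_all add: TA.G0_class_closed TA.gdim_class)
  let ?i = "\<lambda>M. extend_gens (G0 TA) (\<lambda>N. G0_class TA (outer_tensor A B M N)) y"
  have icl: "?i M \<in> carrier (G0 TA)" if "M \<in> fg_modules A" for M
    using that cl xy by (intro G0.extend_gens_closed comm_group_G0) auto
  show "G0_outer A B x y \<in> carrier (G0 TA)"
    unfolding G0_outer_def Let_def using icl xy by (intro G0.extend_gens_closed comm_group_G0) auto
  have i: "gdim TA (?i M) = gdim B y * of_nat (mdim A M)" if M: "M \<in> fg_modules A" for M
  proof -
    have "gdim TA (?i M) =
        extend_gens (add_monoid Zq) (gdim TA \<circ> (\<lambda>N. G0_class TA (outer_tensor A B M N))) y"
      by (rule G0.extend_gens_comp_hom[OF comm_group_G0 comm_group_Zq TA.gdim_hom]) (use M cl xy in auto)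
    \<comment> \<open>Multiplication by \<open>mdim A M\<close> is an additive map, so the rule just
      used, read backwards, pulls this factor out of the extension.\<close>
    also have "\<dots> = extend_gens (add_monoid Zq) ((\<lambda>p. p * of_nat (mdim A M)) \<circ> (\<lambda>N. of_nat (mdim B N))) y"
      by (rule G0.extend_gens_cong[OF comm_group_Zq]) (use M cl xy in auto)
    also have "\<dots> = gdim B y * of_nat (mdim A M)"
      unfolding gdim_def
      by (rule G0.extend_gens_comp_hom[OF comm_group_Zq comm_group_Zq, symmetric])
        (use xy in \<open>auto simp: hom_def distrib_right\<close>)
    finally show ?thesis .
  qed
  have "gdim TA (G0_outer A B x y) = extend_gens (add_monoid Zq) (gdim TA \<circ> ?i) x"
    unfolding G0_outer_def Let_def
    by (rule G0.extend_gens_comp_hom[OF comm_group_G0 comm_group_Zq TA.gdim_hom]) (use icl xy in auto)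
  also have "\<dots> = extend_gens (add_monoid Zq) ((\<lambda>p. gdim B y * p) \<circ> (\<lambda>M. of_nat (mdim A M))) x"
    by (rule G0.extend_gens_cong[OF comm_group_Zq]) (use i xy in auto)
  also have "\<dots> = gdim B y * gdim A x"
    unfolding gdim_def[of A]
    by (rule G0.extend_gens_comp_hom[OF comm_group_Zq comm_group_Zq, symmetric])
      (use xy in \<open>auto simp: hom_def distrib_left\<close>)
  finally show "gdim TA (G0_outer A B x y) = gdim A x * gdim B y"
    by simp
qed

end

section \<open>Projective covers of the simple modules\<close>

lemma submodule_nested:
  assumes "left_module R M" "Module.submodule H R M" "Module.submodule H' R M" "H \<subseteq> H'"
  shows "Module.submodule H R (M\<lparr>carrier := H'\<rparr>)"
proof -
  interpret M: left_module R M by fact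
  interpret M': left_module R "M\<lparr>carrier := H'\<rparr>"
    by (rule M.left_module_sub) fact
  show ?thesis
    by (rule M'.submoduleI) (use assms M.submoduleD[OF assms(2)] in auto)
qed

lemma (in fd_alg) mdim_quotient:
  assumes "fg_module A M" "Module.submodule N A M"
  shows "mdim A M = mdim A (M\<lparr>carrier := N\<rparr>) + mdim A (quotient_module M N)"
proof -
  interpret left_module A M
    using assms(1) by (simp add: fg_module_def)
  have "(\<lambda>x. x) \<in> module_hom A (M\<lparr>carrier := N\<rparr>) M"
    using submoduleD(1)[OF assms(2)] by (auto simp: module_hom_def)
  moreover have "(\<lambda>x. x) ` carrier (M\<lparr>carrier := N\<rparr>) = a_kernel M (quotient_module M N) (\<lambda>x. N +>\<^bsub>M\<^esub> x)"
    using quotient_proj_zero[OF assms(2)] submoduleD(1)[OF assms(2)] by (auto simp: a_kernel_def')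
  ultimately have "short_exact A (M\<lparr>carrier := N\<rparr>) M (quotient_module M N)"
    unfolding short_exact_def
    using quotient_proj_hom[OF assms(2)] quotient_proj_onto[OF assms(2)]
    by (intro bexI[of _ "\<lambda>x. x"] bexI[of _ "\<lambda>x. N +>\<^bsub>M\<^esub> x"]) auto
  then show ?thesis
    by (rule mdim_exact[OF assms(1) left_module_sub[OF assms(2)] left_module_quotient[OF assms(2)]])
qed

text \<open>The images of the basis vectors of the free module are lifted through g and extended
  linearly to \<phi>. Composing with the section s of P into the free module gives the lift.\<close>

lemma projective_lift:
  fixes P :: "('r, 'p) module"
  assumes "projective R P" "left_module R M" "left_module R N" "g \<in> module_hom R M N" "g ` carrier M = carrier N"
    and "h \<in> module_hom R P N"
  obtains f where "f \<in> module_hom R P M" "\<And>x. x \<in> carrier P \<Longrightarrow> g (f x) = h x"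
proof -
  interpret M: left_module R M by fact
  interpret N: left_module R N by fact
  obtain I :: "'p set" and s p where s: "s \<in> module_hom R P (free_module R I)" and p: "p \<in> module_hom R (free_module R I) P"
    and ps: "\<And>x. x \<in> carrier P \<Longrightarrow> p (s x) = x"
    using assms(1) unfolding projective_def by (elim conjE bexE exE) (blast intro: that)
  let ?F = "free_module R I"
  \<comment> \<open>For an index outside \<open>I\<close> this is the zero vector, so the choice of
    preimages \<open>a\<close> below can be made for all indices.\<close>
  define e where "e i = (\<lambda>j\<in>I. if j = i then \<one>\<^bsub>R\<^esub> else \<zero>\<^bsub>R\<^esub>)" for i
  have e: "e i \<in> carrier ?F" for i
  proof -
    have "finite {j \<in> I. e i j \<noteq> \<zero>\<^bsub>R\<^esub>}"
      by (rule finite_subset[of _ "{i}"]) (auto simp: e_def)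
    then show ?thesis
      by (auto simp: free_module_def e_def)
  qed
  have k: "(\<lambda>x. h (p x)) \<in> module_hom R ?F N"
    by (rule module_hom_comp[OF p assms(6)])
  have kd: "h (p x) \<in> carrier N" "h (p (x \<oplus>\<^bsub>?F\<^esub> y)) = h (p x) \<oplus>\<^bsub>N\<^esub> h (p y)"
    "r \<in> carrier R \<Longrightarrow> h (p (r \<odot>\<^bsub>?F\<^esub> x)) = r \<odot>\<^bsub>N\<^esub> h (p x)"
    if "x \<in> carrier ?F" "y \<in> carrier ?F" for x y r
    using k that by (auto simp: module_hom_def)
  have "\<exists>m \<in> carrier M. g m = h (p (e i))" for i
    using kd(1)[OF e e, of i] assms(5) by (metis imageE)
  then obtain a where a: "\<And>i. a i \<in> carrier M" "\<And>i. g (a i) = h (p (e i))"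
    by metis
  define \<phi> where "\<phi> x = finsum M (\<lambda>i. x i \<odot>\<^bsub>M\<^esub> a i) {i \<in> I. x i \<noteq> \<zero>\<^bsub>R\<^esub>}" for x
  have F: "x i \<in> carrier R" "finite {i \<in> I. x i \<noteq> \<zero>\<^bsub>R\<^esub>}" if "x \<in> carrier ?F" "i \<in> I" for x i
    using that by (auto simp: free_module_def)
  \<comment> \<open>The sum defining \<phi> runs over the support, which varies with the vector.
    Passing to any larger finite index set makes the sums for different vectors comparable.\<close>
  have sup: "\<phi> x = finsum M (\<lambda>i. x i \<odot>\<^bsub>M\<^esub> a i) J"
    if "x \<in> carrier ?F" "finite J" "J \<subseteq> I" "{i \<in> I. x i \<noteq> \<zero>\<^bsub>R\<^esub>} \<subseteq> J" for x J
    unfolding \<phi>_def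
    by (rule M.add.finprod_mono_neutral_cong_left)
      (use that a F in \<open>auto simp: M.smult_zero_left subset_iff intro!: M.smult_closed\<close>)
  have F_fin: "finite {i \<in> I. x i \<noteq> \<zero>\<^bsub>R\<^esub>}" if "x \<in> carrier ?F" for x
    using that by (auto simp: free_module_def)
  have Fadd: "x \<oplus>\<^bsub>?F\<^esub> y = (\<lambda>i\<in>I. x i \<oplus>\<^bsub>R\<^esub> y i)" and Fsm: "r \<odot>\<^bsub>?F\<^esub> x = (\<lambda>i\<in>I. r \<otimes>\<^bsub>R\<^esub> x i)" for x y r
    by (simp_all add: free_module_def)
  have Fadd_closed: "x \<oplus>\<^bsub>?F\<^esub> y \<in> carrier ?F" if "x \<in> carrier ?F" "y \<in> carrier ?F" for x y
  proof -
    have "finite {i \<in> I. (\<lambda>i\<in>I. x i \<oplus>\<^bsub>R\<^esub> y i) i \<noteq> \<zero>\<^bsub>R\<^esub>}"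
      by (rule finite_subset[OF _ finite_UnI[OF F_fin[OF that(1)] F_fin[OF that(2)]]]) auto
    then show ?thesis
      unfolding Fadd using that by (auto simp: free_module_def)
  qed
  have Fsm_closed: "r \<odot>\<^bsub>?F\<^esub> x \<in> carrier ?F" if "r \<in> carrier R" "x \<in> carrier ?F" for x r
  proof -
    have "finite {i \<in> I. (\<lambda>i\<in>I. r \<otimes>\<^bsub>R\<^esub> x i) i \<noteq> \<zero>\<^bsub>R\<^esub>}"
      by (rule finite_subset[OF _ F_fin[OF that(2)]]) (use that in auto)
    then show ?thesis
      unfolding Fsm using that by (auto simp: free_module_def)
  qed
  have \<phi>_closed: "\<phi> x \<in> carrier M" if "x \<in> carrier ?F" for x
    unfolding \<phi>_def by (rule M.finsum_closed) (use that F a in \<open>auto intro!: M.smult_closed\<close>)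
  have \<phi>_add: "\<phi> (x \<oplus>\<^bsub>?F\<^esub> y) = \<phi> x \<oplus>\<^bsub>M\<^esub> \<phi> y" if xy: "x \<in> carrier ?F" "y \<in> carrier ?F" for x y
  proof -
    let ?J = "{i \<in> I. x i \<noteq> \<zero>\<^bsub>R\<^esub>} \<union> {i \<in> I. y i \<noteq> \<zero>\<^bsub>R\<^esub>}"
    have J: "finite ?J" "?J \<subseteq> I"
      using F_fin xy by auto
    have "\<phi> (x \<oplus>\<^bsub>?F\<^esub> y) = finsum M (\<lambda>i. (x \<oplus>\<^bsub>?F\<^esub> y) i \<odot>\<^bsub>M\<^esub> a i) ?J"
      by (rule sup[OF Fadd_closed[OF xy] J]) (auto simp: Fadd)
    also have "\<dots> = finsum M (\<lambda>i. x i \<odot>\<^bsub>M\<^esub> a i \<oplus>\<^bsub>M\<^esub> y i \<odot>\<^bsub>M\<^esub> a i) ?J"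
      by (rule M.finsum_cong') (use xy F a in \<open>auto simp: Fadd M.smult_l_distr M.smult_closed\<close>)
    also have "\<dots> = finsum M (\<lambda>i. x i \<odot>\<^bsub>M\<^esub> a i) ?J \<oplus>\<^bsub>M\<^esub> finsum M (\<lambda>i. y i \<odot>\<^bsub>M\<^esub> a i) ?J"
      by (rule M.finsum_addf) (use xy F a in \<open>auto intro!: M.smult_closed\<close>)
    also have "\<dots> = \<phi> x \<oplus>\<^bsub>M\<^esub> \<phi> y"
      using sup[OF xy(1) J] sup[OF xy(2) J] by simp
    finally show ?thesis .
  qed
  have finsum_smult: "r \<odot>\<^bsub>M\<^esub> finsum M u J = finsum M (\<lambda>i. r \<odot>\<^bsub>M\<^esub> u i) J"
    if "finite J" "r \<in> carrier R" "u \<in> J \<rightarrow> carrier M" for r u and J :: "'p set"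
    using that by (induction J) (auto simp: M.smult_zero_right M.smult_r_distr M.smult_closed Pi_iff)
  have \<phi>_sm: "\<phi> (r \<odot>\<^bsub>?F\<^esub> x) = r \<odot>\<^bsub>M\<^esub> \<phi> x" if rx: "r \<in> carrier R" "x \<in> carrier ?F" for r x
  proof -
    let ?J = "{i \<in> I. x i \<noteq> \<zero>\<^bsub>R\<^esub>}"
    have "\<phi> (r \<odot>\<^bsub>?F\<^esub> x) = finsum M (\<lambda>i. (r \<odot>\<^bsub>?F\<^esub> x) i \<odot>\<^bsub>M\<^esub> a i) ?J"
      by (rule sup[OF Fsm_closed[OF rx] F_fin[OF rx(2)]]) (use rx in \<open>auto simp: Fsm\<close>)
    also have "\<dots> = finsum M (\<lambda>i. r \<odot>\<^bsub>M\<^esub> (x i \<odot>\<^bsub>M\<^esub> a i)) ?J"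
      by (rule M.finsum_cong') (use rx F a in \<open>auto simp: Fsm M.smult_assoc M.smult_closed\<close>)
    also have "\<dots> = r \<odot>\<^bsub>M\<^esub> \<phi> x"
      unfolding \<phi>_def
      by (rule finsum_smult[symmetric]) (use rx F F_fin a in \<open>auto intro!: M.smult_closed\<close>)
    finally show ?thesis .
  qed
  have \<phi>_e: "\<phi> (e i) = a i" if "i \<in> I" for i
  proof -
    have "\<phi> (e i) = finsum M (\<lambda>j. e i j \<odot>\<^bsub>M\<^esub> a j) {i}"
      by (rule sup[OF e]) (use that in \<open>auto simp: e_def\<close>)
    then show ?thesis
      using that a by (simp add: e_def M.smult_one)
  qed
  have gd: "g m \<in> carrier N" "g (m \<oplus>\<^bsub>M\<^esub> m') = g m \<oplus>\<^bsub>N\<^esub> g m'" "r \<in> carrier R \<Longrightarrow> g (r \<odot>\<^bsub>M\<^esub> m) = r \<odot>\<^bsub>N\<^esub> g m"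
    if "m \<in> carrier M" "m' \<in> carrier M" for m m' r
    using assms(4) that by (auto simp: module_hom_def)
  \<comment> \<open>Two linear maps that agree on the basis vectors agree everywhere; the induction
    removes one coordinate of the support at a time.\<close>
  have lift_on: "g (\<phi> x) = h (p x)" if "finite J" "J \<subseteq> I" "x \<in> carrier ?F" "{i \<in> I. x i \<noteq> \<zero>\<^bsub>R\<^esub>} \<subseteq> J" for x J
    using that
  proof (induction J arbitrary: x)
    case empty
    \<comment> \<open>A vector with empty support is zero. Writing it as zero times itself lets the
      compatibility of both maps with scalars settle the case.\<close>
    have x: "x = \<zero>\<^bsub>R\<^esub> \<odot>\<^bsub>?F\<^esub> x"
      using empty by (intro ext) (auto simp: Fsm free_module_def PiE_iff extensional_def)
    have "g (\<phi> (\<zero>\<^bsub>R\<^esub> \<odot>\<^bsub>?F\<^esub> x)) = \<zero>\<^bsub>N\<^esub>"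
      using empty(2) gd(1,3)[OF \<phi>_closed[OF empty(2)] \<phi>_closed[OF empty(2)]]
      by (simp add: \<phi>_sm N.smult_zero_left)
    moreover have "h (p (\<zero>\<^bsub>R\<^esub> \<odot>\<^bsub>?F\<^esub> x)) = \<zero>\<^bsub>N\<^esub>"
      using empty(2) kd(3)[OF empty(2) empty(2), of "\<zero>\<^bsub>R\<^esub>"] kd(1) by (simp add: N.smult_zero_left)
    ultimately show ?case
      using x by simp
  next
    case (insert j J)
    define x' where "x' = x(j := \<zero>\<^bsub>R\<^esub>)"
    have j: "j \<in> I" "x j \<in> carrier R"
      using insert F by auto
    have "finite {i \<in> I. x' i \<noteq> \<zero>\<^bsub>R\<^esub>}"
      by (rule finite_subset[OF _ F_fin[OF insert.prems(2)]]) (auto simp: x'_def)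
    then have x': "x' \<in> carrier ?F"
      using insert.prems(2) j by (auto simp: free_module_def x'_def PiE_iff extensional_def)
    have split: "x = x' \<oplus>\<^bsub>?F\<^esub> x j \<odot>\<^bsub>?F\<^esub> e j"
      using insert.prems(2) j
      by (intro ext) (auto simp: Fadd Fsm x'_def e_def free_module_def PiE_iff extensional_def)
    have IH: "g (\<phi> x') = h (p x')"
      by (rule insert.IH[OF _ x']) (use insert.prems in \<open>auto simp: x'_def\<close>)
    have "g (\<phi> x) = g (\<phi> x') \<oplus>\<^bsub>N\<^esub> x j \<odot>\<^bsub>N\<^esub> h (p (e j))"
      using j x' \<phi>_closed a gd(2) gd(3)[OF a(1) a(1)] e
      by (subst split) (simp add: \<phi>_add Fsm_closed \<phi>_sm \<phi>_e M.smult_closed)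
    also have "\<dots> = h (p x)"
      using kd(2)[OF x' Fsm_closed[OF j(2) e]] kd(3)[OF e e j(2)] IH
        arg_cong[OF split, of "\<lambda>z. h (p z)"] by simp
    finally show ?case .
  qed
  have lift: "g (\<phi> x) = h (p x)" if "x \<in> carrier ?F" for x
    by (rule lift_on[OF F_fin[OF that] _ that]) auto
  have "\<phi> \<in> module_hom R ?F M"
    using \<phi>_closed \<phi>_add \<phi>_sm by (auto simp: module_hom_def)
  then have "(\<lambda>x. \<phi> (s x)) \<in> module_hom R P M"
    by (rule module_hom_comp[OF s])
  moreover have "g (\<phi> (s x)) = h x" if "x \<in> carrier P" for x
    using lift[of "s x"] ps[OF that] s that by (auto simp: module_hom_def)
  ultimately show thesis
    by (rule that)
qed

section \<open>Cyclic modules, simple modules and projective covers\<close>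

context left_module
begin

lemma cyclic_submodule:
  assumes "x \<in> carrier M"
  shows "Module.submodule {a \<odot>\<^bsub>M\<^esub> x | a. a \<in> carrier R} R M" "x \<in> {a \<odot>\<^bsub>M\<^esub> x | a. a \<in> carrier R}"
proof -
  show "x \<in> {a \<odot>\<^bsub>M\<^esub> x | a. a \<in> carrier R}"
    using assms smult_one[of x] by force
  show "Module.submodule {a \<odot>\<^bsub>M\<^esub> x | a. a \<in> carrier R} R M"
  proof (rule submoduleI)
    show "\<zero>\<^bsub>M\<^esub> \<in> {a \<odot>\<^bsub>M\<^esub> x | a. a \<in> carrier R}"
      using smult_zero_left[OF assms] by force
  next
    fix u v assume "u \<in> {a \<odot>\<^bsub>M\<^esub> x | a. a \<in> carrier R}" "v \<in> {a \<odot>\<^bsub>M\<^esub> x | a. a \<in> carrier R}"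
    then obtain a b where "a \<in> carrier R" "b \<in> carrier R" "u = a \<odot>\<^bsub>M\<^esub> x" "v = b \<odot>\<^bsub>M\<^esub> x"
      by auto
    then have "a \<oplus>\<^bsub>R\<^esub> b \<in> carrier R" "u \<oplus>\<^bsub>M\<^esub> v = (a \<oplus>\<^bsub>R\<^esub> b) \<odot>\<^bsub>M\<^esub> x"
      using assms by (simp_all add: smult_l_distr)
    then show "u \<oplus>\<^bsub>M\<^esub> v \<in> {a \<odot>\<^bsub>M\<^esub> x | a. a \<in> carrier R}"
      by blast
  next
    fix c u assume c: "c \<in> carrier R" and "u \<in> {a \<odot>\<^bsub>M\<^esub> x | a. a \<in> carrier R}"
    then obtain a where "a \<in> carrier R" "u = a \<odot>\<^bsub>M\<^esub> x"
      by auto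
    then have "c \<otimes>\<^bsub>R\<^esub> a \<in> carrier R" "c \<odot>\<^bsub>M\<^esub> u = (c \<otimes>\<^bsub>R\<^esub> a) \<odot>\<^bsub>M\<^esub> x"
      using c assms by (simp_all add: smult_assoc)
    then show "c \<odot>\<^bsub>M\<^esub> u \<in> {a \<odot>\<^bsub>M\<^esub> x | a. a \<in> carrier R}"
      by blast
  qed (use assms smult_closed in auto)
qed

lemma fg_cyclic:
  assumes "x \<in> carrier M" "carrier M = {a \<odot>\<^bsub>M\<^esub> x | a. a \<in> carrier R}"
  shows "fg_module R M"
proof -
  have "N = carrier M" if "Module.submodule N R M" "{x} \<subseteq> N" for N
    using submoduleD[OF that(1)] that(2) assms(2) by auto
  then show ?thesis
    unfolding fg_module_def using assms(1) left_module_axioms by blast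
qed

end

lemma simple_moduleI:
  assumes "left_module R S" "carrier S \<noteq> {\<zero>\<^bsub>S\<^esub>}"
    "\<And>N. Module.submodule N R S \<Longrightarrow> N = {\<zero>\<^bsub>S\<^esub>} \<or> N = carrier S"
  shows "simple_module R S"
  unfolding simple_module_def by (intro conjI allI impI assms)

lemma simple_moduleD:
  assumes "simple_module R S"
  shows "left_module R S" "carrier S \<noteq> {\<zero>\<^bsub>S\<^esub>}"
    "Module.submodule N R S \<Longrightarrow> N = {\<zero>\<^bsub>S\<^esub>} \<or> N = carrier S"
  using assms unfolding simple_module_def by simp_all

text \<open>The cyclic submodule contains x, hence is not zero.\<close>

lemma simple_module_cyclic:
  assumes "simple_module R S" "x \<in> carrier S" "x \<noteq> \<zero>\<^bsub>S\<^esub>"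
  shows "carrier S = {a \<odot>\<^bsub>S\<^esub> x | a. a \<in> carrier R}"
proof -
  interpret left_module R S
    by (rule simple_moduleD(1)[OF assms(1)])
  note cyc = cyclic_submodule[OF assms(2)]
  have "{a \<odot>\<^bsub>S\<^esub> x | a. a \<in> carrier R} \<noteq> {\<zero>\<^bsub>S\<^esub>}"
    using cyc(2) assms(3) by (metis singletonD)
  then show ?thesis
    using simple_moduleD(3)[OF assms(1) cyc(1)] by argo
qed

lemma simple_module_nonzero:
  assumes "simple_module R S"
  obtains x where "x \<in> carrier S" "x \<noteq> \<zero>\<^bsub>S\<^esub>"
proof -
  interpret left_module R S
    by (rule simple_moduleD(1)[OF assms])
  have "\<exists>x \<in> carrier S. x \<noteq> \<zero>\<^bsub>S\<^esub>"
    using simple_moduleD(2)[OF assms] M.zero_closed by blast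
  then show thesis
    using that by blast
qed

lemma simple_module_fg:
  assumes "simple_module R S"
  shows "fg_module R S"
proof -
  obtain x where x: "x \<in> carrier S" "x \<noteq> \<zero>\<^bsub>S\<^esub>"
    using simple_module_nonzero[OF assms] .
  show ?thesis
    by (rule left_module.fg_cyclic[OF simple_moduleD(1)[OF assms] x(1) simple_module_cyclic[OF assms x]])
qed

lemma projectiveD: "projective R P \<Longrightarrow> left_module R P"
  unfolding projective_def by (rule conjunct1)

lemma projective_coverD: "projective_cover R P S \<Longrightarrow> projective R P"
  unfolding projective_cover_def by (rule conjunct1)

lemma projective_coverE:
  assumes "projective_cover R P S"
  obtains \<pi> where "\<pi> \<in> module_hom R P S" "\<pi> ` carrier P = carrier S"
    "\<forall>N. Module.submodule N R P \<and> set_add P N (a_kernel P S \<pi>) = carrier P \<longrightarrow> N = carrier P"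
proof -
  have "\<exists>\<pi> \<in> module_hom R P S. \<pi> ` carrier P = carrier S \<and>
      (\<forall>N. Module.submodule N R P \<and> set_add P N (a_kernel P S \<pi>) = carrier P \<longrightarrow> N = carrier P)"
    using assms unfolding projective_cover_def by (rule conjunct2[THEN conjunct2])
  then obtain \<pi> where hom: "\<pi> \<in> module_hom R P S" and sup: "\<pi> ` carrier P = carrier S \<and>
      (\<forall>N. Module.submodule N R P \<and> set_add P N (a_kernel P S \<pi>) = carrier P \<longrightarrow> N = carrier P)"
    by (rule bexE)
  show thesis
    by (rule that[OF hom conjunct1[OF sup] conjunct2[OF sup]])
qed

text \<open>The kernel of a projective cover is superfluous, so that any preimage of a generator generates.\<close>

lemma projective_cover_fg:
  assumes "projective_cover R P S" "simple_module R S"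
  shows "fg_module R P"
proof -
  obtain \<pi> where \<pi>: "\<pi> \<in> module_hom R P S" "\<pi> ` carrier P = carrier S"
    and sup: "\<forall>N. Module.submodule N R P \<and> set_add P N (a_kernel P S \<pi>) = carrier P \<longrightarrow> N = carrier P"
    by (rule projective_coverE[OF assms(1)])
  have lP: "left_module R P"
    by (rule projectiveD[OF projective_coverD[OF assms(1)]])
  interpret P: left_module R P by fact
  interpret S: left_module R S by (rule simple_moduleD(1)[OF assms(2)])
  obtain s where s: "s \<in> carrier S" "s \<noteq> \<zero>\<^bsub>S\<^esub>"
    using simple_module_nonzero[OF assms(2)] .
  have "s \<in> \<pi> ` carrier P"
    unfolding \<pi>(2) by (rule s(1))
  then obtain p where p: "s = \<pi> p" "p \<in> carrier P"
    by (rule imageE)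
  define N where "N = {a \<odot>\<^bsub>P\<^esub> p | a. a \<in> carrier R}"
  have sub: "Module.submodule N R P"
    unfolding N_def by (rule P.cyclic_submodule[OF p(2)])
  note D = P.submoduleD[OF sub]
  have K: "a_kernel P S \<pi> = {x \<in> carrier P. \<pi> x = \<zero>\<^bsub>S\<^esub>}"
    by (rule a_kernel_def')
  have "set_add P N (a_kernel P S \<pi>) = carrier P"
  proof (intro equalityI subsetI)
    fix x assume "x \<in> set_add P N (a_kernel P S \<pi>)"
    then obtain n k where "n \<in> N" "k \<in> carrier P" "x = n \<oplus>\<^bsub>P\<^esub> k"
      unfolding set_add_def' K by blast
    then show "x \<in> carrier P"
      using subsetD[OF D(1)] by simp
  next
    fix x assume x: "x \<in> carrier P"
    then have "\<pi> x \<in> carrier S"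
      using \<pi>(2) by blast
    then obtain a where a: "a \<in> carrier R" "\<pi> x = a \<odot>\<^bsub>S\<^esub> s"
      using simple_module_cyclic[OF assms(2) s] by blast
    \<comment> \<open>Since \<pi> x = a s and s = \<pi> p, the decomposition x = a p + (x - a p) has
      its second term in the kernel.\<close>
    let ?y = "a \<odot>\<^bsub>P\<^esub> p" and ?z = "(\<ominus>\<^bsub>R\<^esub> a) \<odot>\<^bsub>P\<^esub> p"
    have yz: "?y \<in> carrier P" "?z \<in> carrier P" "?y \<oplus>\<^bsub>P\<^esub> ?z = \<zero>\<^bsub>P\<^esub>"
      using a p P.smult_l_distr[of a "\<ominus>\<^bsub>R\<^esub> a" p]
      by (simp_all add: P.smult_closed P.smult_zero_left P.R.r_neg)
    have "\<pi> (?z \<oplus>\<^bsub>P\<^esub> x) = \<pi> ?z \<oplus>\<^bsub>S\<^esub> \<pi> x"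
      by (rule module_hom_add[OF \<pi>(1) yz(2) x])
    also have "\<pi> ?z = (\<ominus>\<^bsub>R\<^esub> a) \<odot>\<^bsub>S\<^esub> s"
      unfolding p(1) by (rule module_hom_smult[OF \<pi>(1) _ p(2)]) (simp add: a(1))
    also have "(\<ominus>\<^bsub>R\<^esub> a) \<odot>\<^bsub>S\<^esub> s \<oplus>\<^bsub>S\<^esub> \<pi> x = \<zero>\<^bsub>S\<^esub>"
      using S.smult_l_distr[of "\<ominus>\<^bsub>R\<^esub> a" a s] a s(1) by (simp add: S.smult_zero_left P.R.l_neg)
    finally have "?z \<oplus>\<^bsub>P\<^esub> x \<in> a_kernel P S \<pi>"
      using yz x by (simp add: K)
    moreover have "?y \<in> N"
      unfolding N_def using a(1) by blast
    moreover have "x = ?y \<oplus>\<^bsub>P\<^esub> (?z \<oplus>\<^bsub>P\<^esub> x)"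
      using yz x P.M.a_assoc[OF yz(1,2) x] by simp
    ultimately show "x \<in> set_add P N (a_kernel P S \<pi>)"
      unfolding set_add_def' by blast
  qed
  then have "N = carrier P"
    by (rule sup[THEN spec, THEN mp, OF conjI[OF sub]])
  then show ?thesis
    using P.fg_cyclic[OF p(2)] unfolding N_def by argo
qed

text \<open>A list of simple modules is complete only for modules of the type
  \<open>umodule\<close>. Simplicity therefore has to be passed to the copy of a simple module on
  that type.\<close>

lemma simple_module_iso:
  assumes "left_module R U" "module_iso R U Q" "simple_module R Q"
  shows "simple_module R U"
proof -
  interpret U: left_module R U by fact
  interpret Q: left_module R Q by (rule simple_moduleD(1)[OF assms(3)])
  obtain f where f: "f \<in> module_hom R U Q" "bij_betw f (carrier U) (carrier Q)"
    using assms(2) by (auto simp: module_iso_def)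
  have fd: "f (x \<oplus>\<^bsub>U\<^esub> y) = f x \<oplus>\<^bsub>Q\<^esub> f y" "r \<in> carrier R \<Longrightarrow> f (r \<odot>\<^bsub>U\<^esub> x) = r \<odot>\<^bsub>Q\<^esub> f x"
    if "x \<in> carrier U" "y \<in> carrier U" for x y r
    using f(1) that by (auto simp: module_hom_def)
  have f0: "f \<zero>\<^bsub>U\<^esub> = \<zero>\<^bsub>Q\<^esub>"
    by (rule module_hom_zero[OF assms(1) Q.left_module_axioms f(1)])
  have inj: "f ` H = f ` H' \<Longrightarrow> H = H'" if "H \<subseteq> carrier U" "H' \<subseteq> carrier U" for H H'
    using f(2) that by (metis bij_betw_def inj_on_image_eq_iff)
  have "H = {\<zero>\<^bsub>U\<^esub>} \<or> H = carrier U" if H: "Module.submodule H R U" for H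
  proof -
    note D = U.submoduleD[OF H]
    have "Module.submodule (f ` H) R Q"
    proof (rule Q.submoduleI)
      show "f ` H \<subseteq> carrier Q"
        using D(1) f(2) by (auto simp: bij_betw_def)
      show "\<zero>\<^bsub>Q\<^esub> \<in> f ` H"
        using D(2) f0 by force
    next
      fix x y assume "x \<in> f ` H" "y \<in> f ` H"
      then obtain u v where uv: "u \<in> H" "v \<in> H" "x = f u" "y = f v"
        by auto
      then have "x \<oplus>\<^bsub>Q\<^esub> y = f (u \<oplus>\<^bsub>U\<^esub> v)"
        using fd(1)[of u v] subsetD[OF D(1)] by auto
      then show "x \<oplus>\<^bsub>Q\<^esub> y \<in> f ` H"
        using D(3) uv by blast
    next
      fix r x assume r: "r \<in> carrier R" and "x \<in> f ` H"
      then obtain u where u: "u \<in> H" "x = f u"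
        by auto
      then have "r \<odot>\<^bsub>Q\<^esub> x = f (r \<odot>\<^bsub>U\<^esub> u)"
        using fd(2)[of u u r] subsetD[OF D(1)] r by auto
      then show "r \<odot>\<^bsub>Q\<^esub> x \<in> f ` H"
        using D(4) u r by blast
    qed
    then have "f ` H = {\<zero>\<^bsub>Q\<^esub>} \<or> f ` H = carrier Q"
      by (rule simple_moduleD(3)[OF assms(3)])
    then show ?thesis
    proof
      assume "f ` H = {\<zero>\<^bsub>Q\<^esub>}"
      then have "f ` H = f ` {\<zero>\<^bsub>U\<^esub>}"
        using f0 by simp
      then show ?thesis
        using inj[of H "{\<zero>\<^bsub>U\<^esub>}"] D(1) by simp
    next
      assume "f ` H = carrier Q"
      then have "f ` H = f ` carrier U"
        using f(2) by (simp add: bij_betw_def)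
      then show ?thesis
        using inj[of H "carrier U"] D(1) by simp
    qed
  qed
  moreover have "carrier U \<noteq> {\<zero>\<^bsub>U\<^esub>}"
  proof
    assume "carrier U = {\<zero>\<^bsub>U\<^esub>}"
    then have "carrier Q = {\<zero>\<^bsub>Q\<^esub>}"
      using f(2) f0 by (auto simp: bij_betw_def)
    then show False
      using simple_moduleD(2)[OF assms(3)] by contradiction
  qed
  ultimately show ?thesis
    by (intro simple_moduleI assms(1))
qed

section \<open>The bound of dim A by the sum of dim S_i dim P_i\<close>

context fd_alg
begin

text \<open>Among the proper submodules above \<open>N\<close>, one of largest dimension is maximal,
  because a proper inclusion raises the dimension. Simplicity of the quotient follows by taking
  preimages.\<close>

lemma simple_quotient:
  assumes "fg_module A M" "Module.submodule N A M" "N \<noteq> carrier M"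
  obtains N' where "Module.submodule N' A M" "N \<subseteq> N'" "simple_module A (quotient_module M N')"
proof -
  interpret M: left_module A M
    using assms(1) by (simp add: fg_module_def)
  define Hs where "Hs = {H. Module.submodule H A M \<and> N \<subseteq> H \<and> H \<noteq> carrier M}"
  have "N \<in> Hs"
    using assms by (simp add: Hs_def)
  moreover have "\<forall>H. H \<in> Hs \<longrightarrow> mdim A (M\<lparr>carrier := H\<rparr>) < Suc (mdim A M)"
    using mdim_sub_le[OF assms(1)] by (auto simp: Hs_def less_Suc_eq_le)
  ultimately obtain N' where N': "N' \<in> Hs" "\<And>H. H \<in> Hs \<Longrightarrow> mdim A (M\<lparr>carrier := H\<rparr>) \<le> mdim A (M\<lparr>carrier := N'\<rparr>)"
    using ex_has_greatest_nat[of "\<lambda>H. H \<in> Hs" N "\<lambda>H. mdim A (M\<lparr>carrier := H\<rparr>)"] by blast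
  have sub: "Module.submodule N' A M" "N \<subseteq> N'" "N' \<noteq> carrier M"
    using N'(1) by (auto simp: Hs_def)
  let ?Q = "quotient_module M N'" and ?\<pi> = "\<lambda>x. N' +>\<^bsub>M\<^esub> x"
  note onto = M.quotient_proj_onto[OF sub(1)] and hom = M.quotient_proj_hom[OF sub(1)]
    and zero = M.quotient_proj_zero[OF sub(1)]
  interpret Q: left_module A ?Q
    by (rule M.left_module_quotient[OF sub(1)])
  have "H = {\<zero>\<^bsub>?Q\<^esub>} \<or> H = carrier ?Q" if H: "Module.submodule H A ?Q" for H
  proof -
    note D = Q.submoduleD[OF H]
    \<comment> \<open>The preimage of H contains N'. If it is proper, maximality of the dimension
      forces it to equal N', and then H is zero.\<close>
    define K where "K = {x \<in> carrier M. ?\<pi> x \<in> H}"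
    have mem: "x \<in> K \<longleftrightarrow> x \<in> carrier M \<and> ?\<pi> x \<in> H" for x
      by (simp add: K_def)
    have K: "Module.submodule K A M"
    proof (rule M.submoduleI)
      show "K \<subseteq> carrier M"
        by (auto simp: mem)
      show "\<zero>\<^bsub>M\<^esub> \<in> K"
        using zero[of "\<zero>\<^bsub>M\<^esub>"] M.submoduleD(2)[OF sub(1)] D(2) by (simp add: mem)
      show "x \<oplus>\<^bsub>M\<^esub> y \<in> K" if "x \<in> K" "y \<in> K" for x y
        using that D(3) by (simp add: mem module_hom_add[OF hom])
      show "a \<odot>\<^bsub>M\<^esub> x \<in> K" if "a \<in> carrier A" "x \<in> K" for a x
        using that D(4) by (simp add: mem module_hom_smult[OF hom] M.smult_closed)
    qed
    have N'K: "N' \<subseteq> K"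
    proof
      fix x assume x: "x \<in> N'"
      then have xM: "x \<in> carrier M"
        using M.submoduleD(1)[OF sub(1)] by blast
      then have "?\<pi> x = \<zero>\<^bsub>?Q\<^esub>"
        using zero x by blast
      then show "x \<in> K"
        using xM D(2) by (simp add: mem)
    qed
    have HK: "\<exists>x \<in> K. h = ?\<pi> x" if "h \<in> H" for h
    proof -
      have "h \<in> ?\<pi> ` carrier M"
        unfolding onto using that D(1) by (rule subsetD[rotated])
      then obtain x where "h = ?\<pi> x" "x \<in> carrier M"
        by (rule imageE)
      then show ?thesis
        using that by (intro bexI[of _ x]) (simp_all add: mem)
    qed
    show ?thesis
    proof (cases "K = carrier M")
      case True
      have "carrier ?Q \<subseteq> H"
      proof
        fix h assume "h \<in> carrier ?Q"
        then have "h \<in> ?\<pi> ` carrier M"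
          by (simp only: onto)
        then show "h \<in> H"
          by (rule imageE) (use mem True in blast)
      qed
      then show ?thesis
        using D(1) by blast
    next
      case False
      have "K \<in> Hs"
        unfolding Hs_def using K sub(2) N'K False by blast
      then have le: "mdim A (M\<lparr>carrier := K\<rparr>) \<le> mdim A (M\<lparr>carrier := N'\<rparr>)"
        by (rule N'(2))
      note nest = submodule_nested[OF M.left_module_axioms sub(1) K N'K]
      have "N' = K"
        using mdim_sub_eq[OF fg_sub[OF assms(1) K] nest] mdim_sub_le[OF fg_sub[OF assms(1) K] nest] le
        by simp
      then have "h = \<zero>\<^bsub>?Q\<^esub>" if "h \<in> H" for h
        using HK[OF that] zero mem by blast
      then show ?thesis
        using D(2) by blast
    qed
  qed
  moreover have "carrier ?Q \<noteq> {\<zero>\<^bsub>?Q\<^esub>}"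
  proof
    assume "carrier ?Q = {\<zero>\<^bsub>?Q\<^esub>}"
    then have "x \<in> N'" if "x \<in> carrier M" for x
      using zero[OF that] onto that by blast
    then show False
      using sub(3) M.submoduleD(1)[OF sub(1)] by auto
  qed
  ultimately have "simple_module A ?Q"
    by (intro simple_moduleI Q.left_module_axioms)
  then show thesis
    by (rule that[OF sub(1,2)])
qed

text \<open>For a left ideal \<open>N\<close> this is Hom_A(A/N, S), a homomorphism being given by
  the image of the class of one. It is a complex subspace, but in general not a submodule, of
  \<open>S\<close>, which is why \<open>ann_dim\<close> measures it as a vector space.\<close>

definition ann :: "('a, 's) module \<Rightarrow> 'a set \<Rightarrow> 's set" where
  "ann S N = {x \<in> carrier S. \<forall>a \<in> N. a \<odot>\<^bsub>S\<^esub> x = \<zero>\<^bsub>S\<^esub>}"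

definition ann_dim :: "('a, 's) module \<Rightarrow> 'a set \<Rightarrow> nat" where
  "ann_dim S N = vectorspace.dim complex_ring ((underlying_space A S)\<lparr>carrier := ann S N\<rparr>)"

text \<open>Annihilators are subspaces because complex scalars commute with \<open>A\<close>. A
  larger set annihilates fewer vectors, and a proper inclusion of subspaces lowers the
  dimension.\<close>

lemma
  assumes S: "fg_module A S" and "N \<subseteq> N'" "N' \<subseteq> carrier A"
  shows ann_dim_antimono: "ann_dim S N' \<le> ann_dim S N"
    and ann_dim_less: "x \<in> ann S N \<Longrightarrow> x \<notin> ann S N' \<Longrightarrow> ann_dim S N' < ann_dim S N"
proof -
  interpret S: left_module A S
    using S by (simp add: fg_module_def)
  let ?V = "underlying_space A S"
  have fdV: "fd_space complex_ring ?V"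
    using S by (rule fg_imp_fd)
  interpret V: vectorspace complex_ring ?V
    using fdV by (simp add: fd_space_def)
  have sub: "subspace complex_ring (ann S H) ?V" if "H \<subseteq> carrier A" for H
  proof -
    have "a \<odot>\<^bsub>S\<^esub> ((c \<odot>\<^bsub>A\<^esub> \<one>\<^bsub>A\<^esub>) \<odot>\<^bsub>S\<^esub> x) = (c \<odot>\<^bsub>A\<^esub> \<one>\<^bsub>A\<^esub>) \<odot>\<^bsub>S\<^esub> (a \<odot>\<^bsub>S\<^esub> x)"
      if "x \<in> carrier S" "a \<in> carrier A" for a c x
      using that smult_mult_right[of a "\<one>\<^bsub>A\<^esub>" c]
      by (simp add: S.smult_assoc[symmetric] scalar_closed scalar_one_mult)
    then show ?thesis
      using that V.vectorspace_axioms
      by (auto simp: subspace_def LinearCombinations.submodule_def vectorspace_def ann_def subset_iff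
          S.smult_r_distr S.smult_closed S.smult_zero_right scalar_closed)
  qed
  let ?U = "?V\<lparr>carrier := ann S N\<rparr>"
  have fdU: "fd_space complex_ring ?U"
    by (rule fd_space_subspace[OF fdV sub]) (use assms in auto)
  have le: "ann S N' \<subseteq> ann S N"
    using assms(2) by (auto simp: ann_def)
  have "subspace complex_ring (ann S N') ?U"
    by (rule V.nested_subspaces[OF sub sub le]) (use assms in auto)
  note * = dim_subspace_le[OF fdU this] subspace_eqI[OF fdU this]
  show "ann_dim S N' \<le> ann_dim S N"
    using *(1) by (simp add: ann_dim_def)
  show "ann_dim S N' < ann_dim S N" if "x \<in> ann S N" "x \<notin> ann S N'"
    using * that by (cases "ann_dim S N' = ann_dim S N") (auto simp: ann_dim_def)
qed

text \<open>On the zero module the identity has itself as image and as kernel, so 0 -> 0 -> 0 is a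
  short exact sequence of three equal terms and the dimension m satisfies m = m + m.\<close>

lemma mdim_zero_submodule:
  assumes "fg_module A M"
  shows "mdim A (M\<lparr>carrier := {\<zero>\<^bsub>M\<^esub>}\<rparr>) = 0"
proof -
  interpret M: left_module A M
    using assms by (simp add: fg_module_def)
  let ?Z = "M\<lparr>carrier := {\<zero>\<^bsub>M\<^esub>}\<rparr>"
  have sub: "Module.submodule {\<zero>\<^bsub>M\<^esub>} A M"
    by (rule M.submoduleI) (auto simp: M.smult_zero_right)
  have Z: "fg_module A ?Z"
    by (rule fg_sub[OF assms sub])
  have id: "(\<lambda>x. x) \<in> module_hom A ?Z ?Z"
    using M.smult_zero_right by (auto simp: module_hom_def)
  have "short_exact A ?Z ?Z ?Z"
    unfolding short_exact_def by (intro bexI[OF _ id]) (auto simp: a_kernel_def')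
  then have "mdim A ?Z = mdim A ?Z + mdim A ?Z"
    by (intro mdim_exact Z) (use Z in \<open>auto simp: fg_module_def\<close>)
  then show ?thesis
    by simp
qed

text \<open>
  For a proper left ideal \<open>N\<close>, some \<open>P i\<close> maps to \<open>A\<close> with an image that is not contained in a
  maximal left ideal above \<open>N\<close>. Adding this image to \<open>N\<close> decreases the annihilator of
  \<open>N\<close> in \<open>S i\<close>, which can happen at most \<open>dim (S i)\<close> times.
\<close>

lemma dim_le_left_ideal:
  fixes S :: "nat \<Rightarrow> ('a, 's) module" and P :: "nat \<Rightarrow> ('a, 'p) module"
  assumes simples: "simple_modules_list A t S"
    and covers: "\<And>i. i < t \<Longrightarrow> projective_cover A (P i) (S i)"
    and "Module.submodule N A (regular_module A)"
  shows "vectorspace.dim complex_ring A \<le>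
    mdim A ((regular_module A)\<lparr>carrier := N\<rparr>) + (\<Sum>i<t. ann_dim (S i) N * mdim A (P i))"
  using assms(3)
\<comment> \<open>The measure is the codimension of \<open>N\<close>. When \<open>N\<close> is all
  of \<open>A\<close>, the first summand alone is dim A.\<close>
proof (induction "vectorspace.dim complex_ring A - mdim A ((regular_module A)\<lparr>carrier := N\<rparr>)"
    arbitrary: N rule: less_induct)
  case less
  let ?A = "regular_module A"
  interpret RA: left_module A ?A
    by (rule left_module_regular)
  show ?case
  proof (cases "N = carrier ?A")
    case True
    then have "?A\<lparr>carrier := N\<rparr> = ?A"
      by (simp add: regular_module_def with_action_def)
    then show ?thesis
      using mdim_regular by simp
  next
    case False
    obtain N' where N': "Module.submodule N' A ?A" "N \<subseteq> N'" "simple_module A (quotient_module ?A N')"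
      using simple_quotient[OF fg_regular less.prems False] .
    let ?Q = "quotient_module ?A N'"
    interpret Q: left_module A ?Q
      by (rule RA.left_module_quotient[OF N'(1)])
    obtain U :: "'a umodule" where U: "left_module A U" "module_iso A U ?Q"
      using umodule_exists[OF simple_module_fg[OF N'(3)]] .
    obtain i where i: "i < t" "module_iso A (S i) U"
      using simples simple_module_iso[OF U N'(3)] unfolding simple_modules_list_def by blast
    have Si: "simple_module A (S i)"
      using simples i(1) by (simp add: simple_modules_list_def)
    interpret Si: left_module A "S i"
      using Si by (simp add: simple_module_def)
    obtain u where u: "u \<in> module_hom A ?Q U" "bij_betw u (carrier ?Q) (carrier U)"
      using module_iso_sym[OF U] by (auto simp: module_iso_def)
    obtain v where v: "v \<in> module_hom A U (S i)" "bij_betw v (carrier U) (carrier (S i))"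
      using module_iso_sym[OF Si.left_module_axioms i(2)] by (auto simp: module_iso_def)
    \<comment> \<open>The composite A -> A/N' -> U -> S i; the detour through \<open>U\<close>
      reflects that the list of simples is complete on the type of \<open>U\<close>.\<close>
    define g where "g x = v (u (N' +>\<^bsub>?A\<^esub> x))" for x
    have g: "g \<in> module_hom A ?A (S i)"
      unfolding g_def[abs_def]
      by (rule module_hom_comp[OF module_hom_comp[OF RA.quotient_proj_hom[OF N'(1)] u(1)] v(1)])
    have g_onto: "g ` carrier ?A = carrier (S i)"
    proof -
      have "g ` carrier ?A = v ` u ` ((\<lambda>x. N' +>\<^bsub>?A\<^esub> x) ` carrier ?A)"
        by (simp add: g_def image_image)
      then show ?thesis
        using RA.quotient_proj_onto[OF N'(1)] u(2) v(2) by (simp add: bij_betw_def)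
    qed
    have g_zero: "g x = \<zero>\<^bsub>S i\<^esub>" if "x \<in> N'" for x
    proof -
      have "N' +>\<^bsub>?A\<^esub> x = \<zero>\<^bsub>?Q\<^esub>"
        using RA.quotient_proj_zero[OF N'(1), of x] that RA.submoduleD(1)[OF N'(1)] by auto
      then show ?thesis
        using module_hom_zero[OF Q.left_module_axioms U(1) u(1)]
          module_hom_zero[OF U(1) Si.left_module_axioms v(1)]
        by (simp add: g_def)
    qed
    \<comment> \<open>A homomorphism from the regular module is a \<mapsto> a x. As g kills N',
      which contains N, the vector x lies in the annihilator of N.\<close>
    define x where "x = g \<one>\<^bsub>A\<^esub>"
    have gx: "g a = a \<odot>\<^bsub>S i\<^esub> x" if "a \<in> carrier A" for a
    proof -
      have "g (a \<odot>\<^bsub>?A\<^esub> \<one>\<^bsub>A\<^esub>) = a \<odot>\<^bsub>S i\<^esub> g \<one>\<^bsub>A\<^esub>"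
        using g that unfolding module_hom_def by (auto simp del: regular_module_simps(4))
      then show ?thesis
        using that by (simp add: x_def)
    qed
    obtain \<pi> where \<pi>: "\<pi> \<in> module_hom A (P i) (S i)" "\<pi> ` carrier (P i) = carrier (S i)"
      by (rule projective_coverE[OF covers[OF i(1)]])
    have proj: "projective A (P i)"
      by (rule projective_coverD[OF covers[OF i(1)]])
    have Pi: "fg_module A (P i)"
      by (rule projective_cover_fg[OF covers[OF i(1)] Si])
    interpret Pi: left_module A "P i"
      using Pi by (simp add: fg_module_def)
    \<comment> \<open>Projectivity factors the cover \<pi> through g. As \<pi> is not zero, the
      image of f is not contained in the kernel of g.\<close>
    obtain f where f: "f \<in> module_hom A (P i) ?A" "\<And>y. y \<in> carrier (P i) \<Longrightarrow> g (f y) = \<pi> y"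
      using projective_lift[OF proj left_module_regular Si.left_module_axioms g g_onto \<pi>(1)] by blast
    have fd: "f y \<in> carrier A" "f (y \<oplus>\<^bsub>P i\<^esub> z) = f y \<oplus>\<^bsub>A\<^esub> f z" "a \<in> carrier A \<Longrightarrow> f (a \<odot>\<^bsub>P i\<^esub> y) = a \<otimes>\<^bsub>A\<^esub> f y"
      if "y \<in> carrier (P i)" "z \<in> carrier (P i)" for y z a
      using f(1) that by (auto simp: module_hom_def)
    have f0: "f \<zero>\<^bsub>P i\<^esub> = \<zero>\<^bsub>A\<^esub>"
      using module_hom_zero[OF Pi.left_module_axioms left_module_regular f(1)] by simp
    note DN = RA.submoduleD[OF less.prems]
    have NA: "N \<subseteq> carrier A"
      using DN(1) by simp
    define N2 where "N2 = {n \<oplus>\<^bsub>A\<^esub> f y | n y. n \<in> N \<and> y \<in> carrier (P i)}"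
    have mem: "n \<oplus>\<^bsub>A\<^esub> f y \<in> N2" if "n \<in> N" "y \<in> carrier (P i)" for n y
      using that by (auto simp: N2_def)
    have N2: "Module.submodule N2 A ?A"
    proof (rule RA.submoduleI)
      show "N2 \<subseteq> carrier ?A"
        using NA fd by (auto simp: N2_def)
      show "\<zero>\<^bsub>?A\<^esub> \<in> N2"
        using mem[of "\<zero>\<^bsub>A\<^esub>" "\<zero>\<^bsub>P i\<^esub>"] DN(2) f0 by simp
    next
      fix y z assume "y \<in> N2" "z \<in> N2"
      then obtain n p n' p' where *: "n \<in> N" "p \<in> carrier (P i)" "y = n \<oplus>\<^bsub>A\<^esub> f p"
        "n' \<in> N" "p' \<in> carrier (P i)" "z = n' \<oplus>\<^bsub>A\<^esub> f p'"
        by (auto simp: N2_def)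
      then have "n \<in> carrier A" "n' \<in> carrier A"
        using NA by auto
      then have "y \<oplus>\<^bsub>?A\<^esub> z = (n \<oplus>\<^bsub>A\<^esub> n') \<oplus>\<^bsub>A\<^esub> f (p \<oplus>\<^bsub>P i\<^esub> p')"
        using * fd by (simp add: a_ac)
      then show "y \<oplus>\<^bsub>?A\<^esub> z \<in> N2"
        using mem[of "n \<oplus>\<^bsub>A\<^esub> n'" "p \<oplus>\<^bsub>P i\<^esub> p'"] * DN(3)[of n n'] by simp
    next
      fix a y assume a: "a \<in> carrier A" and "y \<in> N2"
      then obtain n p where *: "n \<in> N" "p \<in> carrier (P i)" "y = n \<oplus>\<^bsub>A\<^esub> f p"
        by (auto simp: N2_def)
      then have "n \<in> carrier A"
        using NA by auto
      then have "a \<odot>\<^bsub>?A\<^esub> y = (a \<otimes>\<^bsub>A\<^esub> n) \<oplus>\<^bsub>A\<^esub> f (a \<odot>\<^bsub>P i\<^esub> p)"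
        using * fd a by (simp add: r_distr)
      then show "a \<odot>\<^bsub>?A\<^esub> y \<in> N2"
        using mem[of "a \<otimes>\<^bsub>A\<^esub> n" "a \<odot>\<^bsub>P i\<^esub> p"] * a DN(4)[of a n] Pi.smult_closed by simp
    qed
    have N2A: "N2 \<subseteq> carrier A"
      using RA.submoduleD(1)[OF N2] by simp
    have NN2: "N \<subseteq> N2"
    proof
      fix n assume n: "n \<in> N"
      then have "n \<in> carrier A"
        using NA by auto
      then show "n \<in> N2"
        using mem[OF n, of "\<zero>\<^bsub>P i\<^esub>"] f0 by simp
    qed
    have fN2: "f y \<in> N2" if "y \<in> carrier (P i)" for y
      using mem[OF DN(2) that] fd(1)[OF that that] by simp
    have xS: "x \<in> carrier (S i)"
      using g by (auto simp: x_def module_hom_def)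
    have x_in: "x \<in> ann (S i) N"
      using gx[symmetric] g_zero N'(2) NA xS by (auto simp: ann_def subset_iff)
    obtain s where s: "s \<in> carrier (S i)" "s \<noteq> \<zero>\<^bsub>S i\<^esub>"
      using simple_module_nonzero[OF Si] .
    have "s \<in> \<pi> ` carrier (P i)"
      unfolding \<pi>(2) by (rule s(1))
    then obtain p where p: "p \<in> carrier (P i)" "\<pi> p = s"
      by blast
    \<comment> \<open>Here (f p) x = g (f p) = \<pi> p = s, which was chosen nonzero; so x is no
      longer annihilated once the image of f is added to N.\<close>
    have fpx: "f p \<odot>\<^bsub>S i\<^esub> x \<noteq> \<zero>\<^bsub>S i\<^esub>"
      using gx[of "f p"] f(2)[OF p(1)] p(2) s(2) fd(1)[OF p(1) p(1)] by simp
    then have x_out: "x \<notin> ann (S i) N2"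
      using fN2[OF p(1)] by (auto simp: ann_def)
    have "N \<noteq> N2"
      using x_in x_out by auto
    let ?N = "?A\<lparr>carrier := N\<rparr>" and ?N2 = "?A\<lparr>carrier := N2\<rparr>"
    have fgN2: "fg_module A ?N2"
      by (rule fg_sub[OF fg_regular N2])
    have nest: "Module.submodule N A ?N2"
      by (rule submodule_nested[OF left_module_regular less.prems N2 NN2])
    interpret N2: left_module A ?N2
      using fgN2 by (simp add: fg_module_def)
    interpret Q2: left_module A "quotient_module ?N2 N"
      by (rule N2.left_module_quotient[OF nest])
    have le_N2: "mdim A ?N2 \<le> vectorspace.dim complex_ring A"
      using mdim_sub_le[OF fg_regular N2] by (simp add: mdim_regular)
    have "mdim A ?N \<le> mdim A ?N2" "mdim A ?N \<noteq> mdim A ?N2"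
      using mdim_sub_le[OF fgN2 nest] mdim_sub_eq[OF fgN2 nest] \<open>N \<noteq> N2\<close> by auto
    then have IH: "vectorspace.dim complex_ring A \<le> mdim A ?N2 + (\<Sum>j<t. ann_dim (S j) N2 * mdim A (P j))"
      using le_N2 by (intro less.hyps N2) auto
    \<comment> \<open>Modulo N every element of N2 comes from the image of f, so the increase in
      dimension is at most dim P_i.\<close>
    have quot: "mdim A (quotient_module ?N2 N) \<le> mdim A (P i)"
    proof (rule mdim_image_le[OF Pi N2.left_module_quotient[OF nest]])
      have "f \<in> module_hom A (P i) ?N2"
        using f(1) fN2 by (auto simp: module_hom_def)
      from module_hom_comp[OF this N2.quotient_proj_hom[OF nest]]
      show hom: "(\<lambda>y. N +>\<^bsub>?N2\<^esub> f y) \<in> module_hom A (P i) (quotient_module ?N2 N)" .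
      show "(\<lambda>y. N +>\<^bsub>?N2\<^esub> f y) ` carrier (P i) = carrier (quotient_module ?N2 N)"
      proof
        show "(\<lambda>y. N +>\<^bsub>?N2\<^esub> f y) ` carrier (P i) \<subseteq> carrier (quotient_module ?N2 N)"
          using hom by (auto simp: module_hom_def)
        show "carrier (quotient_module ?N2 N) \<subseteq> (\<lambda>y. N +>\<^bsub>?N2\<^esub> f y) ` carrier (P i)"
        proof
          fix w assume "w \<in> carrier (quotient_module ?N2 N)"
          then obtain z where z: "z \<in> N2" "w = N +>\<^bsub>?N2\<^esub> z"
            using N2.quotient_proj_onto[OF nest] by auto
          then obtain n y where ny: "n \<in> N" "y \<in> carrier (P i)" "z = n \<oplus>\<^bsub>A\<^esub> f y"
            by (auto simp: N2_def)
          have "w = (N +>\<^bsub>?N2\<^esub> n) \<oplus>\<^bsub>quotient_module ?N2 N\<^esub> (N +>\<^bsub>?N2\<^esub> f y)"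
            using N2.quotient_proj_hom[OF nest] z ny NN2 fN2[OF ny(2)] by (auto simp: module_hom_def)
          also have "N +>\<^bsub>?N2\<^esub> n = \<zero>\<^bsub>quotient_module ?N2 N\<^esub>"
            using N2.quotient_proj_zero[OF nest, of n] ny(1) NN2 by auto
          also have "\<zero>\<^bsub>quotient_module ?N2 N\<^esub> \<oplus>\<^bsub>quotient_module ?N2 N\<^esub> (N +>\<^bsub>?N2\<^esub> f y) = N +>\<^bsub>?N2\<^esub> f y"
            by (rule Q2.M.l_zero) (rule funcset_mem[OF module_hom_closed[OF hom] ny(2)])
          finally have "w = N +>\<^bsub>?N2\<^esub> f y" .
          then show "w \<in> (\<lambda>y. N +>\<^bsub>?N2\<^esub> f y) ` carrier (P i)"
            using ny(2) by blast
        qed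
      qed
    qed
    have "mdim A ?N2 = mdim A ?N + mdim A (quotient_module ?N2 N)"
      using mdim_quotient[OF fgN2 nest] by simp
    then have step: "mdim A ?N2 \<le> mdim A ?N + mdim A (P i)"
      using quot by simp
    have fgS: "fg_module A (S j)" if "j < t" for j
      using simples that by (auto simp: simple_modules_list_def intro: simple_module_fg)
    \<comment> \<open>At the index i the annihilator loses at least one dimension, which pays for
      one copy of P_i. At the other indices it suffices that annihilators do not grow.\<close>
    have "(\<Sum>j<t. ann_dim (S j) N2 * mdim A (P j)) + mdim A (P i) =
        (\<Sum>j<t. (ann_dim (S j) N2 + (if j = i then 1 else 0)) * mdim A (P j))"
      using i(1) by (simp add: distrib_right sum.distrib if_distrib[of "\<lambda>k. k * _"] sum.delta cong: if_cong)
    also have "\<dots> \<le> (\<Sum>j<t. ann_dim (S j) N * mdim A (P j))"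
      using ann_dim_antimono[OF fgS NN2 N2A] ann_dim_less[OF fgS NN2 N2A x_in x_out] i(1)
      by (intro sum_mono mult_right_mono) (auto simp: Suc_le_eq)
    finally show ?thesis
      using IH step by linarith
  qed
qed

text \<open>The zero ideal has dimension zero and annihilates all of each S_i.\<close>

lemma dim_le_sum_simples:
  assumes simples: "simple_modules_list A t S"
    and covers: "\<And>i. i < t \<Longrightarrow> projective_cover A (P i) (S i)"
  shows "vectorspace.dim complex_ring A \<le> (\<Sum>i<t. mdim A (S i) * mdim A (P i))"
proof -
  interpret RA: left_module A "regular_module A"
    by (rule left_module_regular)
  have "Module.submodule {\<zero>\<^bsub>A\<^esub>} A (regular_module A)"
    by (rule RA.submoduleI) auto
  from dim_le_left_ideal[OF simples covers this]
  have "vectorspace.dim complex_ring A \<le> (\<Sum>i<t. ann_dim (S i) {\<zero>\<^bsub>A\<^esub>} * mdim A (P i))"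
    using mdim_zero_submodule[OF fg_regular] by simp
  also have "\<dots> = (\<Sum>i<t. mdim A (S i) * mdim A (P i))"
  proof (rule sum.cong)
    fix i assume "i \<in> {..<t}"
    then interpret Si: left_module A "S i"
      using simples by (simp add: simple_modules_list_def simple_module_def)
    have "ann (S i) {\<zero>\<^bsub>A\<^esub>} = carrier (S i)"
      by (auto simp: ann_def Si.smult_zero_left)
    then show "ann_dim (S i) {\<zero>\<^bsub>A\<^esub>} * mdim A (P i) = mdim A (S i) * mdim A (P i)"
      by (simp add: ann_dim_def mdim_def underlying_space_def restrict_scalars_def with_action_def)
  qed simp
  finally show ?thesis .
qed

end

section \<open>Powers of a primitive element in a twisted Hopf algebra\<close>

text \<open>The coproduct of a power is known only to lie in the group generated by homogeneous pure
  tensors. This reduces identities between functionals on it to such tensors.\<close>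

lemma generate_hom_eqI:
  assumes "x \<in> generate G E" "group_hom G K h" "group_hom G K k" "E \<subseteq> carrier G"
    and "\<And>e. e \<in> E \<Longrightarrow> h e = k e"
  shows "h x = k x"
proof -
  interpret h: group_hom G K h by fact
  interpret k: group_hom G K k by fact
  have "x \<in> carrier G \<and> h x = k x"
    using assms(1) by (induction rule: generate.induct) (use assms in \<open>auto simp: h.hom_inv k.hom_inv\<close>)
  then show ?thesis ..
qed

text \<open>The lowest power is split off because the induction on powers of \<beta> produces this
  form: 1 when the new factor goes to the right-hand slot, q times the old value when it goes to the
  left.\<close>

lemma q_int_Suc: "q_int (Suc n) = 1 + qvar * q_int n"
  by (simp add: q_int_def sum.lessThan_Suc_shift sum_distrib_left del: sum.lessThan_Suc)

lemma q_fact_Suc: "q_fact (Suc n) = q_int (Suc n) * q_fact n"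
  by (simp add: q_fact_def prod.atLeast_Suc_atMost mult.commute)

section \<open>Functionals and their tensor products\<close>

definition functional :: "(int poly, 'h) module \<Rightarrow> ('h \<Rightarrow> int poly) \<Rightarrow> bool" where
  "functional H \<phi> \<longleftrightarrow> \<phi> \<in> module_hom Zq H (regular_module Zq)"

text \<open>For functionals this is \<phi> \<otimes> \<psi> followed by the multiplication of
  \<Z>[q].\<close>

definition pairing :: "('h \<Rightarrow> int poly) \<Rightarrow> ('h \<Rightarrow> int poly) \<Rightarrow> ('h, 'h) tensor \<Rightarrow> int poly" where
  "pairing \<phi> \<psi> = extend_gens (add_monoid Zq) (\<lambda>(a, b). \<phi> a * \<psi> b)"

lemma functionalD:
  assumes "functional H \<phi>"
  shows "\<lbrakk>x \<in> carrier H; y \<in> carrier H\<rbrakk> \<Longrightarrow> \<phi> (x \<oplus>\<^bsub>H\<^esub> y) = \<phi> x + \<phi> y"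
    "x \<in> carrier H \<Longrightarrow> \<phi> (p \<odot>\<^bsub>H\<^esub> x) = p * \<phi> x"
  using assms by (auto simp: functional_def module_hom_def)

context
  fixes H :: "(int poly, 'h) module"
  assumes module: "Module.module Zq H"
begin

interpretation HM: Module.module Zq H by (rule module)
interpretation TT: tensor_modules Zq H H by unfold_locales

lemma
  assumes "functional H \<phi>" "functional H \<psi>"
  shows pairing_hom: "pairing \<phi> \<psi> \<in> hom (tensor_group Zq H H) (add_monoid Zq)"
    and pairing_pure: "\<lbrakk>a \<in> carrier H; b \<in> carrier H\<rbrakk> \<Longrightarrow> pairing \<phi> \<psi> (pure_tensor Zq H H a b) = \<phi> a * \<psi> b"
proof -
  note s = functionalD[OF assms(1)] functionalD[OF assms(2)]
  show "pairing \<phi> \<psi> \<in> hom TT.T (add_monoid Zq)"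
    unfolding pairing_def
    by (rule TT.tensor_extend_hom[OF comm_group_Zq]) (auto simp: s algebra_simps)
  show "pairing \<phi> \<psi> (TT.pt a b) = \<phi> a * \<psi> b" if "a \<in> carrier H" "b \<in> carrier H"
    unfolding pairing_def
    by (rule TT.tensor_extend_pure[OF comm_group_Zq]) (use that in \<open>auto simp: s algebra_simps\<close>)
qed

lemma pairing_add:
  "\<lbrakk>functional H \<phi>; functional H \<psi>; s \<in> carrier (tensor_group Zq H H); t \<in> carrier (tensor_group Zq H H)\<rbrakk> \<Longrightarrow>
    pairing \<phi> \<psi> (s \<otimes>\<^bsub>tensor_group Zq H H\<^esub> t) = pairing \<phi> \<psi> s + pairing \<phi> \<psi> t"
  using pairing_hom[of \<phi> \<psi>] by (auto simp: hom_def)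

lemma pairing_smult:
  assumes "functional H \<phi>" "functional H \<psi>" "t \<in> carrier (tensor_group Zq H H)"
  shows "pairing \<phi> \<psi> (p \<odot>\<^bsub>tensor_module Zq H H\<^esub> t) = p * pairing \<phi> \<psi> t"
  using assms(3)
proof (induction t rule: TT.tensor_induct)
  case (pure x y)
  then have "p \<odot>\<^bsub>TT.TM\<^esub> TT.pt x y = TT.pt (p \<odot>\<^bsub>H\<^esub> x) y"
    by (intro TT.TM_smult_pure) auto
  then show ?case
    using pure pairing_pure[OF assms(1,2)] functionalD[OF assms(1)] by simp
next
  case (add a b)
  then show ?case
    by (simp add: TT.TM_smult_add pairing_add assms TT.TM_smult_closed algebra_simps)
qed

end

section \<open>Coproducts of powers of a degree one element\<close>

context q_twisted_hopf_algebra
begin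

interpretation H: ring H by (rule ring)
interpretation HM: Module.module Zq H by (rule module)
interpretation TT: tensor_modules Zq H H by unfold_locales

lemma Hn_closed: "x \<in> Hn n \<Longrightarrow> x \<in> carrier H"
  using left_module.submoduleD(1)[OF left_module_of_module[OF module] degree_submodule] by blast

lemma one_Hn: "\<one> \<in> Hn 0"
proof -
  have "(1 :: int poly) \<odot> \<one> = \<one>"
    using HM.smult_one[of "\<one>"] by simp
  then show ?thesis
    using bij_betw_imp_surj_on[OF connected] by (metis rangeI)
qed

lemma Hn_zero: "x \<in> Hn 0 \<Longrightarrow> \<exists>p. x = p \<odot> \<one>"
  using bij_betw_imp_surj_on[OF connected] by blast

lemma pt_closed: "\<lbrakk>a \<in> carrier H; b \<in> carrier H\<rbrakk> \<Longrightarrow> pt a b \<in> carrier TT.T"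
  unfolding pt_def by (rule TT.pure_closed)

lemma coproduct_closed: "x \<in> carrier H \<Longrightarrow> \<Delta> x \<in> carrier TT.T"
  using coproduct_linear by (auto simp: module_hom_def HH_def TT.TM_simps)

lemma mult_smult_left: "\<lbrakk>x \<in> carrier H; y \<in> carrier H\<rbrakk> \<Longrightarrow> (p \<odot> x) \<otimes> y = p \<odot> (x \<otimes> y)"
  using mult_bilinear by (auto simp: bilinear_mult_def module_hom_def)

text \<open>The grading and connectedness give \<Delta> \<beta> = x \<otimes> 1 + 1 \<otimes> y with
  x and y of degree one. The two counit identities then identify both x and y with \<beta>.\<close>

lemma primitive_degree_one:
  assumes \<beta>: "\<beta> \<in> Hn 1"
  shows "\<Delta> \<beta> = pt \<beta> \<one> \<otimes>\<^bsub>TT.T\<^esub> pt \<one> \<beta>"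
proof -
  interpret H1: left_module Zq H by (rule left_module_of_module[OF module])
  note D = H1.submoduleD[OF degree_submodule[of 1]]
  \<comment> \<open>In total degree one, one of the two factors has degree zero and is a multiple of
    the unit. Balancing moves its coefficient to the other factor, and the missing summand is filled
    in with zero.\<close>
  have base: "\<exists>x \<in> Hn 1. \<exists>y \<in> Hn 1. pt a b = pt x \<one> \<otimes>\<^bsub>TT.T\<^esub> pt \<one> y"
    if t: "a \<in> Hn k" "b \<in> Hn l" "k + l = 1" for a b k l
  proof -
    consider "k = 1" "l = 0" | "k = 0" "l = 1"
      using t(3) by linarith
    then show ?thesis
    proof cases
      case 1
      then obtain p where p: "b = p \<odot> \<one>"
        using t Hn_zero by blast
      have "pt a b = pt (p \<odot> a) \<one> \<otimes>\<^bsub>TT.T\<^esub> pt \<one> \<zero>"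
        using t Hn_closed[of a] by (simp add: p pt_def TT.pure_zero_right TT.pure_closed TT.pure_balanced)
      then show ?thesis
        using D(2) D(4)[of p a] t 1 by auto
    next
      case 2
      then obtain p where p: "a = p \<odot> \<one>"
        using t Hn_zero by blast
      have "pt a b = pt \<zero> \<one> \<otimes>\<^bsub>TT.T\<^esub> pt \<one> (p \<odot> b)"
        using t Hn_closed[of b] by (simp add: p pt_def TT.pure_zero_left TT.pure_closed TT.pure_balanced)
      then show ?thesis
        using D(2) D(4)[of p b] t 2 by auto
    qed
  qed
  have "\<exists>x \<in> Hn 1. \<exists>y \<in> Hn 1. t = pt x \<one> \<otimes>\<^bsub>TT.T\<^esub> pt \<one> y"
    if "t \<in> generate (add_monoid HH) {pt a b | a b k l. a \<in> Hn k \<and> b \<in> Hn l \<and> k + l = 1}" for t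
    using that
  proof (induction t rule: generate.induct)
    case one
    have "\<one>\<^bsub>TT.T\<^esub> = pt \<zero> \<one> \<otimes>\<^bsub>TT.T\<^esub> pt \<one> \<zero>"
      by (simp add: pt_def TT.pure_zero_left TT.pure_zero_right)
    then show ?case
      using D(2) by (auto simp: HH_def TT.TM_simps)
  next
    case (incl t)
    then show ?case
      using base by blast
  next
    case (inv t)
    then obtain a b k l where t: "t = pt a b" "a \<in> Hn k" "b \<in> Hn l" "k + l = 1"
      by auto
    have ab: "a \<in> carrier H" "b \<in> carrier H"
      using t Hn_closed by auto
    interpret HHM: abelian_group HH
      using TT.module_TM by (simp add: Module.module_def HH_def)
    have "pt (\<ominus> a) b \<oplus>\<^bsub>HH\<^esub> t = \<zero>\<^bsub>HH\<^esub>"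
      using TT.T.l_inv[OF pt_closed[OF ab]] TT.pure_inv_left[OF ab]
      by (simp add: t(1) HH_def TT.TM_simps flip: pt_def)
    then have "\<ominus>\<^bsub>HH\<^esub> t = pt (\<ominus> a) b"
      using ab pt_closed by (intro HHM.minus_equality) (auto simp: HH_def TT.TM_simps t(1))
    then have "inv\<^bsub>add_monoid HH\<^esub> t = pt (\<ominus> a) b"
      by (simp add: a_inv_def)
    then show ?case
      using base[OF H1.submoduleD(5)[OF degree_submodule t(2)] t(3,4)] by simp
  next
    case (eng s t)
    then obtain x y x' y' where *: "x \<in> Hn 1" "y \<in> Hn 1" "x' \<in> Hn 1" "y' \<in> Hn 1"
      "s = pt x \<one> \<otimes>\<^bsub>TT.T\<^esub> pt \<one> y" "t = pt x' \<one> \<otimes>\<^bsub>TT.T\<^esub> pt \<one> y'"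
      by blast
    then have "s \<otimes>\<^bsub>TT.T\<^esub> t = pt (x \<oplus> x') \<one> \<otimes>\<^bsub>TT.T\<^esub> pt \<one> (y \<oplus> y')"
      using Hn_closed[of _ 1] by (simp add: pt_def TT.pure_add_left TT.pure_add_right TT.pure_closed TT.T.m_ac)
    then have "s \<otimes>\<^bsub>add_monoid HH\<^esub> t = pt (x \<oplus> x') \<one> \<otimes>\<^bsub>TT.T\<^esub> pt \<one> (y \<oplus> y')"
      by (simp add: HH_def TT.TM_simps)
    then show ?case
      using D(3)[OF *(1,3)] D(3)[OF *(2,4)] by blast
  qed
  from this[OF coproduct_graded[OF \<beta>]]
  obtain x y where xy: "x \<in> Hn 1" "y \<in> Hn 1" "\<Delta> \<beta> = pt x \<one> \<otimes>\<^bsub>TT.T\<^esub> pt \<one> y"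
    by blast
  have xyH: "x \<in> carrier H" "y \<in> carrier H" "\<beta> \<in> carrier H"
    using xy \<beta> Hn_closed by auto
  obtain \<epsilon> where \<epsilon>: "functional H \<epsilon>" "\<epsilon> \<one> = 1" "\<And>n x. \<lbrakk>0 < n; x \<in> Hn n\<rbrakk> \<Longrightarrow> \<epsilon> x = 0"
    "\<And>x. x \<in> carrier H \<Longrightarrow> tensor_lift H (\<lambda>a b. \<epsilon> a \<odot> b) (\<Delta> x) = x"
    "\<And>x. x \<in> carrier H \<Longrightarrow> tensor_lift H (\<lambda>a b. \<epsilon> b \<odot> a) (\<Delta> x) = x"
    using counit_antipode unfolding functional_def by blast
  have dist: "(p + q) \<odot> a = p \<odot> a \<oplus> q \<odot> a" "p \<odot> (q \<odot> a) = (p * q) \<odot> a"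
    if "a \<in> carrier H" for p q a
    using HM.smult_l_distr[of p q a] HM.smult_assoc1[of p q a] that by simp_all
  note s = functionalD[OF \<epsilon>(1)] dist HM.smult_r_distr mult.commute
  have l1: "tensor_lift H (\<lambda>a b. \<epsilon> a \<odot> b) \<in> module_hom Zq TT.TM H"
    by (rule TT.TM_lift_hom[OF module]) (auto simp: s)
  have l2: "tensor_lift H (\<lambda>a b. \<epsilon> a \<odot> b) (pt a b) = \<epsilon> a \<odot> b" if "a \<in> carrier H" "b \<in> carrier H" for a b
    unfolding pt_def by (rule TT.TM_lift_pure[OF module]) (use that in \<open>auto simp: s\<close>)
  have r1: "tensor_lift H (\<lambda>a b. \<epsilon> b \<odot> a) \<in> module_hom Zq TT.TM H"
    by (rule TT.TM_lift_hom[OF module]) (auto simp: s)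
  have r2: "tensor_lift H (\<lambda>a b. \<epsilon> b \<odot> a) (pt a b) = \<epsilon> b \<odot> a" if "a \<in> carrier H" "b \<in> carrier H" for a b
    unfolding pt_def by (rule TT.TM_lift_pure[OF module]) (use that in \<open>auto simp: s\<close>)
  have one: "(1 :: int poly) \<odot> a = a" "(0 :: int poly) \<odot> a = \<zero>" if "a \<in> carrier H" for a
    using HM.smult_one[OF that] HM.smult_l_null[OF that] by simp_all
  \<comment> \<open>The counit kills x, which has degree one, and sends the unit to 1. So \<epsilon>
    \<otimes> id maps \<Delta> \<beta> to y, whereas the counit identity says that it returns
    \<beta>.\<close>
  have "\<beta> = y"
    using \<epsilon>(4)[OF xyH(3)] module_hom_add[OF l1, of "pt x \<one>" "pt \<one> y"] xyH \<epsilon>(3)[of 1 x] \<epsilon>(2) xy(1)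
    by (simp add: xy(3) TT.TM_simps pt_closed l2 one)
  moreover have "\<beta> = x"
    using \<epsilon>(5)[OF xyH(3)] module_hom_add[OF r1, of "pt x \<one>" "pt \<one> y"] xyH \<epsilon>(3)[of 1 y] \<epsilon>(2) xy(2)
    by (simp add: xy(3) TT.TM_simps pt_closed r2 one)
  ultimately show ?thesis
    using xy(3) by simp
qed

text \<open>
  The statement is made for all functionals \<open>\<phi>\<close> at once, because the induction step
  replaces \<open>\<phi>\<close> by \<open>x \<mapsto> \<phi> (x \<beta>)\<close>.
\<close>

theorem pairing_coproduct_power:
  fixes n :: nat
  assumes \<beta>: "\<beta> \<in> Hn 1" and d: "functional H d" "\<And>m x. \<lbrakk>m \<noteq> 1; x \<in> Hn m\<rbrakk> \<Longrightarrow> d x = 0"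
    and "functional H \<phi>"
  shows "pairing \<phi> d (\<Delta> (\<beta> [^] n)) = q_int n * (\<phi> (\<beta> [^] (n - 1)) * d \<beta>)"
  using assms(4)
proof (induction n arbitrary: \<phi>)
  \<comment> \<open>Both sides vanish: d kills the unit, which has degree zero, and
    \<open>q_int 0\<close> is zero whatever the truncated exponent \<open>n - 1\<close>
    contributes.\<close>
  case 0
  then show ?case
    using pairing_pure[OF module 0 d(1), of "\<one>" "\<one>", folded pt_def] d(2)[of 0 "\<one>"] one_Hn
    by (simp add: coproduct_one q_int_def)
next
  case (Suc n)
  let ?b = "\<beta> [^] n"
  have \<beta>H: "\<beta> \<in> carrier H"
    by (rule Hn_closed[OF \<beta>])
  have bn: "?b \<in> Hn n"
  proof (induction n)
    case (Suc n)
    then show ?case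
      using mult_graded \<beta> unfolding graded_mult_def by fastforce
  qed (simp add: one_Hn)
  have bH: "?b \<in> carrier H"
    by (rule Hn_closed[OF bn])
  obtain \<epsilon> where \<epsilon>: "functional H \<epsilon>" "\<epsilon> \<one> = 1" "\<And>n x. \<lbrakk>0 < n; x \<in> Hn n\<rbrakk> \<Longrightarrow> \<epsilon> x = 0"
    "\<And>x. x \<in> carrier H \<Longrightarrow> tensor_lift H (\<lambda>a b. \<epsilon> b \<odot> a) (\<Delta> x) = x"
    using counit_antipode unfolding functional_def by blast
  obtain \<tau> where \<tau>: "twisted_product H Hn \<tau>"
    "\<And>a b. \<lbrakk>a \<in> carrier H; b \<in> carrier H\<rbrakk> \<Longrightarrow> \<Delta> (a \<otimes> b) = \<tau> (\<Delta> a) (\<Delta> b)"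
    using coproduct_mult by blast
  have \<tau>_right: "(\<lambda>y. \<tau> x y) \<in> module_hom Zq TT.TM TT.TM" and \<tau>_left: "(\<lambda>y. \<tau> y x) \<in> module_hom Zq TT.TM TT.TM"
    if "x \<in> carrier TT.T" for x
    using \<tau>(1) that by (auto simp: twisted_product_def bilinear_mult_def TT.TM_simps)
  have \<tau>_pure: "\<tau> (pt a b) (pt a' b') = qvar ^ (j * k) \<odot>\<^bsub>HH\<^esub> pt (a \<otimes> a') (b \<otimes> b')"
    if "a \<in> Hn i" "b \<in> Hn j" "a' \<in> Hn k" "b' \<in> Hn l" for a b a' b' i j k l
    using \<tau>(1) that by (auto simp: twisted_product_def pt_def HH_def)
  have \<tau>_closed: "\<tau> x y \<in> carrier TT.T" if "x \<in> carrier TT.T" "y \<in> carrier TT.T" for x y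
    using \<tau>_right[OF that(1)] that(2) by (auto simp: module_hom_def TT.TM_simps)
  define \<phi>' where "\<phi>' x = \<phi> (x \<otimes> \<beta>)" for x
  have \<phi>': "functional H \<phi>'"
    using functionalD[OF Suc.prems] \<beta>H
    by (auto simp: \<phi>'_def functional_def module_hom_def H.l_distr mult_smult_left)
  have E: "\<Delta> ?b \<in> generate (add_monoid HH) {pt a b | a b k l. a \<in> Hn k \<and> b \<in> Hn l \<and> k + l = n}"
    by (rule coproduct_graded[OF bn])
  have HHgrp: "group (add_monoid HH)"
    using TT.module_TM by (simp add: Module.module_def HH_def abelian_group.a_group)
  have Zgrp: "group (add_monoid Zq)"
    using comm_group_Zq by (simp add: comm_group_def)
  have pt1: "pt \<beta> \<one> \<in> carrier TT.T" "pt \<one> \<beta> \<in> carrier TT.T"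
    using \<beta>H by (auto simp: pt_closed)
  have hom_\<tau>: "group_hom (add_monoid HH) (add_monoid Zq) (\<lambda>u. pairing \<phi> d (\<tau> u w))" if w: "w \<in> carrier TT.T" for w
    unfolding group_hom_def group_hom_axioms_def
    using HHgrp Zgrp \<tau>_left[OF w] \<tau>_closed[OF _ w] pairing_add[OF module Suc.prems d(1)]
    by (auto simp: hom_def module_hom_def HH_def TT.TM_simps)
  have hom_c: "group_hom (add_monoid HH) (add_monoid Zq) (\<lambda>u. c * pairing \<phi>1 \<phi>2 u)"
    if "functional H \<phi>1" "functional H \<phi>2" for c \<phi>1 \<phi>2
    unfolding group_hom_def group_hom_axioms_def
    using HHgrp Zgrp pairing_add[OF module that]
    by (auto simp: hom_def HH_def TT.TM_simps algebra_simps)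
  have gens: "{pt a b | a b k l. a \<in> Hn k \<and> b \<in> Hn l \<and> k + l = n} \<subseteq> carrier (add_monoid HH)"
    using pt_closed Hn_closed by (auto simp: HH_def TT.TM_simps)
  \<comment> \<open>The new factor goes to the right. It passes there with the left component 1 of
    degree zero, so no power of q appears. As d sees only degree one, the right component b must be
    of degree zero, where it is a multiple of the unit and is recorded by \<epsilon>.\<close>
  have 1: "pairing \<phi> d (\<tau> (\<Delta> ?b) (pt \<one> \<beta>)) = d \<beta> * pairing \<phi> \<epsilon> (\<Delta> ?b)"
  proof (rule generate_hom_eqI[OF E hom_\<tau>[OF pt1(2)] hom_c[OF Suc.prems \<epsilon>(1)] gens])
    fix e assume "e \<in> {pt a b | a b k l. a \<in> Hn k \<and> b \<in> Hn l \<and> k + l = n}"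
    then obtain a b k l where e: "e = pt a b" "a \<in> Hn k" "b \<in> Hn l"
      by auto
    have ab: "a \<in> carrier H" "b \<in> carrier H"
      using e Hn_closed by auto
    have "\<tau> e (pt \<one> \<beta>) = qvar ^ (l * 0) \<odot>\<^bsub>HH\<^esub> pt (a \<otimes> \<one>) (b \<otimes> \<beta>)"
      unfolding e(1) by (rule \<tau>_pure[OF e(2,3) one_Hn \<beta>])
    then have "pairing \<phi> d (\<tau> e (pt \<one> \<beta>)) = \<phi> a * d (b \<otimes> \<beta>)"
      using ab \<beta>H by (simp add: pairing_smult[OF module Suc.prems d(1), folded HH_def] pt_closed pairing_pure[OF module Suc.prems d(1), folded pt_def])
    also have "d (b \<otimes> \<beta>) = \<epsilon> b * d \<beta>"
    proof (cases "l = 0")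
      case True
      then obtain p where "b = p \<odot> \<one>"
        using e(3) Hn_zero by blast
      then show ?thesis
        using \<beta>H \<epsilon>(2) by (simp add: mult_smult_left functionalD[OF d(1)] functionalD[OF \<epsilon>(1)])
    next
      case False
      have "b \<otimes> \<beta> \<in> Hn (l + 1)"
        using mult_graded e(3) \<beta> unfolding graded_mult_def by blast
      then show ?thesis
        using d(2)[of "l + 1"] \<epsilon>(3)[of l b] e(3) False by simp
    qed
    finally show "pairing \<phi> d (\<tau> e (pt \<one> \<beta>)) = d \<beta> * pairing \<phi> \<epsilon> e"
      using ab by (simp add: e(1) pairing_pure[OF module Suc.prems \<epsilon>(1), folded pt_def])
  qed
  \<comment> \<open>The new factor goes to the left and passes b of degree l, at the price q^l.
    Since d b vanishes unless l = 1, the price is always a single q.\<close>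
  have 2: "pairing \<phi> d (\<tau> (\<Delta> ?b) (pt \<beta> \<one>)) = qvar * pairing \<phi>' d (\<Delta> ?b)"
  proof (rule generate_hom_eqI[OF E hom_\<tau>[OF pt1(1)] hom_c[OF \<phi>' d(1)] gens])
    fix e assume "e \<in> {pt a b | a b k l. a \<in> Hn k \<and> b \<in> Hn l \<and> k + l = n}"
    then obtain a b k l where e: "e = pt a b" "a \<in> Hn k" "b \<in> Hn l"
      by auto
    have ab: "a \<in> carrier H" "b \<in> carrier H"
      using e Hn_closed by auto
    have "\<tau> e (pt \<beta> \<one>) = qvar ^ (l * 1) \<odot>\<^bsub>HH\<^esub> pt (a \<otimes> \<beta>) (b \<otimes> \<one>)"
      unfolding e(1) by (rule \<tau>_pure[OF e(2,3) \<beta> one_Hn])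
    then have "pairing \<phi> d (\<tau> e (pt \<beta> \<one>)) = qvar ^ l * (\<phi>' a * d b)"
      using ab \<beta>H by (simp add: pairing_smult[OF module Suc.prems d(1), folded HH_def] pt_closed pairing_pure[OF module Suc.prems d(1), folded pt_def] \<phi>'_def)
    also have "\<dots> = qvar * (\<phi>' a * d b)"
      using d(2)[of l b] e(3) by (cases "l = 1") auto
    finally show "pairing \<phi> d (\<tau> e (pt \<beta> \<one>)) = qvar * pairing \<phi>' d e"
      using ab by (simp add: e(1) pairing_pure[OF module \<phi>' d(1), folded pt_def])
  qed
  \<comment> \<open>The counit identity in the right-hand slot, with \<phi> applied to it.\<close>
  have 3: "pairing \<phi> \<epsilon> (\<Delta> ?b) = \<phi> ?b"
  proof -
    have "\<phi> ?b = \<phi> (tensor_lift H (\<lambda>a b. \<epsilon> b \<odot> a) (\<Delta> ?b))"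
      using \<epsilon>(4)[OF bH] by simp
    also have "\<dots> = extend_gens (add_monoid Zq) (\<lambda>(a, b). \<phi> (\<epsilon> b \<odot> a)) (\<Delta> ?b)"
      by (rule TT.tensor_lift_comp_hom[OF H.is_abelian_group comm_group_Zq])
        (use functionalD[OF Suc.prems] coproduct_closed[OF bH] in \<open>auto simp: hom_def\<close>)
    also have "\<dots> = pairing \<phi> \<epsilon> (\<Delta> ?b)"
      unfolding pairing_def
      by (rule TT.extend_gens_cong[OF comm_group_Zq])
        (use functionalD[OF Suc.prems] coproduct_closed[OF bH] in \<open>auto simp: tensor_group_def mult.commute\<close>)
    finally show ?thesis ..
  qed
  have "\<Delta> (\<beta> [^] Suc n) = \<tau> (\<Delta> ?b) (pt \<beta> \<one> \<otimes>\<^bsub>TT.T\<^esub> pt \<one> \<beta>)"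
    using \<tau>(2)[OF bH \<beta>H] primitive_degree_one[OF \<beta>] by simp
  also have "\<dots> = \<tau> (\<Delta> ?b) (pt \<beta> \<one>) \<otimes>\<^bsub>TT.T\<^esub> \<tau> (\<Delta> ?b) (pt \<one> \<beta>)"
    using module_hom_add[OF \<tau>_right[OF coproduct_closed[OF bH]], of "pt \<beta> \<one>" "pt \<one> \<beta>"] pt1
    by (simp add: TT.TM_simps)
  finally have "pairing \<phi> d (\<Delta> (\<beta> [^] Suc n)) = qvar * pairing \<phi>' d (\<Delta> ?b) + d \<beta> * \<phi> ?b"
    using \<tau>_closed[OF coproduct_closed[OF bH]] pt1 by (simp add: pairing_add[OF module Suc.prems d(1)] 1 2 3)
  \<comment> \<open>The case split is due to truncated subtraction: the product of \<beta>^(n - 1)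
    with \<beta> is \<beta>^n only for positive n, and for n = 0 the factor \<open>q_int n\<close>
    vanishes.\<close>
  also have "qvar * pairing \<phi>' d (\<Delta> ?b) = qvar * q_int n * (\<phi> ?b * d \<beta>)"
  proof (cases n)
    case 0
    then show ?thesis
      using Suc.IH[OF \<phi>'] by (simp add: q_int_def)
  next
    case (Suc m)
    then have "\<phi>' (\<beta> [^] (n - 1)) = \<phi> ?b"
      by (simp add: \<phi>'_def)
    then show ?thesis
      using Suc.IH[OF \<phi>'] by (simp add: mult.assoc)
  qed
  finally show ?case
    by (simp add: q_int_Suc algebra_simps)
qed

end

section \<open>The graded groups of a tower\<close>

lemma GA_simps:
  "monoid.mult (GA A) = (\<lambda>x y n. x n \<otimes>\<^bsub>G0 (A n)\<^esub> y n)" "\<one>\<^bsub>GA A\<^esub> = (\<lambda>n. \<one>\<^bsub>G0 (A n)\<^esub>)"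
  by (simp_all add: GA_def restrict_def fun_eq_iff)

lemma group_G0: "group (G0 R)"
  by (rule comm_group.axioms(2)[OF comm_group_G0])

lemma G0_one:
  "\<one>\<^bsub>G0 R\<^esub> \<in> carrier (G0 R)" "x \<in> carrier (G0 R) \<Longrightarrow> \<one>\<^bsub>G0 R\<^esub> \<otimes>\<^bsub>G0 R\<^esub> x = x"
  "x \<in> carrier (G0 R) \<Longrightarrow> x \<otimes>\<^bsub>G0 R\<^esub> \<one>\<^bsub>G0 R\<^esub> = x"
proof -
  interpret group "G0 R" by (rule group_G0)
  show "\<one>\<^bsub>G0 R\<^esub> \<in> carrier (G0 R)" "x \<in> carrier (G0 R) \<Longrightarrow> \<one>\<^bsub>G0 R\<^esub> \<otimes>\<^bsub>G0 R\<^esub> x = x"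
    "x \<in> carrier (G0 R) \<Longrightarrow> x \<otimes>\<^bsub>G0 R\<^esub> \<one>\<^bsub>G0 R\<^esub> = x"
    by simp_all
qed

lemma G0_commute:
  "\<lbrakk>x \<in> carrier (G0 R); y \<in> carrier (G0 R)\<rbrakk> \<Longrightarrow> x \<otimes>\<^bsub>G0 R\<^esub> y = y \<otimes>\<^bsub>G0 R\<^esub> x"
  by (rule comm_monoid.m_comm[OF comm_group.axioms(1)[OF comm_group_G0]])

lemma carrier_GA:
  "x \<in> carrier (GA A) \<longleftrightarrow> (\<forall>n. x n \<in> carrier (G0 (A n))) \<and> finite {n. x n \<noteq> \<one>\<^bsub>G0 (A n)\<^esub>}"
  by (auto simp: GA_def carrier_sum_group group_G0)

lemma comm_group_GA: "comm_group (GA A)"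
proof (rule group.group_comm_groupI)
  show "group (GA A)"
    unfolding GA_def by (rule sum_group) (rule group_G0)
  show "x \<otimes>\<^bsub>GA A\<^esub> y = y \<otimes>\<^bsub>GA A\<^esub> x" if "x \<in> carrier (GA A)" "y \<in> carrier (GA A)" for x y
    using that by (simp add: GA_simps carrier_GA G0_commute)
qed

lemma GA_int_pow:
  assumes "x \<in> carrier (GA A)"
  shows "(x [^]\<^bsub>GA A\<^esub> (k :: int)) n = x n [^]\<^bsub>G0 (A n)\<^esub> k"
proof -
  have "(\<lambda>x. x n) \<in> hom (GA A) (G0 (A n))"
    by (auto simp: hom_def carrier_GA GA_simps)
  from hom_int_pow[OF this assms] show ?thesis
    using comm_group_GA[of A] group_G0[of "A n"] by (simp add: comm_group_def)
qed

lemma int_module_simps [simp]: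
  "carrier (int_module G) = carrier G" "ring.zero (int_module G) = monoid.one G"
  "ring.add (int_module G) = monoid.mult G" "smult (int_module G) = (\<lambda>k x. x [^]\<^bsub>G\<^esub> k)"
  by (simp_all add: int_module_def)

lemma abelian_group_int_module: "comm_group G \<Longrightarrow> abelian_group (int_module G)"
  by (rule comm_group_abelian_groupI, rule comm_group_cong) auto

lemma Zq_int_module_simps [simp]:
  "carrier Zq_int_module = UNIV" "ring.zero Zq_int_module = 0" "ring.add Zq_int_module = (+)"
  "smult Zq_int_module = (\<lambda>k p. of_int k * p)"
  by (simp_all add: Zq_int_module_def)

lemma abelian_group_Zq_int_module: "abelian_group Zq_int_module"
  by (rule comm_group_abelian_groupI, rule comm_group_cong[OF comm_group_Zq]) auto

lemma tensor_pair_GA_Zq: "tensor_pair \<Z> (int_module (GA A)) Zq_int_module"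
  unfolding tensor_pair_def tensor_pair_axioms_def
  using comm_group_GA[of A] group.int_pow_closed[of "GA A"]
  by (auto simp: abelian_group_int_module abelian_group_Zq_int_module comm_group_def)

lemma tensor_pair_GA_GA: "tensor_pair \<Z> (int_module (GA A)) (int_module (GA A))"
  unfolding tensor_pair_def tensor_pair_axioms_def
  using comm_group_GA[of A] group.int_pow_closed[of "GA A"]
  by (auto simp: abelian_group_int_module comm_group_def)

lemma in_degree_closed: "g \<in> carrier (G0 (A n)) \<Longrightarrow> in_degree A n g \<in> carrier (GA A)"
proof -
  assume g: "g \<in> carrier (G0 (A n))"
  have "finite {m. in_degree A n g m \<noteq> \<one>\<^bsub>G0 (A m)\<^esub>}"
    by (rule finite_subset[of _ "{n}"]) (auto simp: in_degree_def)
  then show ?thesis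
    using g by (auto simp: carrier_GA in_degree_def G0_one)
qed

lemma in_degree_hom: "in_degree A n \<in> hom (G0 (A n)) (GA A)"
  unfolding hom_def
proof (intro CollectI conjI ballI funcsetI)
  show "in_degree A n x \<in> carrier (GA A)" if "x \<in> carrier (G0 (A n))" for x
    using that by (rule in_degree_closed)
  show "in_degree A n (x \<otimes>\<^bsub>G0 (A n)\<^esub> y) = in_degree A n x \<otimes>\<^bsub>GA A\<^esub> in_degree A n y" for x y
    unfolding GA_simps by (rule ext) (simp add: in_degree_def G0_one)
qed

lemma group_Zq: "group (add_monoid Zq)"
  by (rule comm_group.axioms(2)[OF comm_group_Zq])

lemma int_pow_add_Zq: "p [^]\<^bsub>add_monoid Zq\<^esub> (k :: int) = of_int k * p"
proof -
  interpret group "add_monoid Zq" by (rule group_Zq)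
  have n: "p [^]\<^bsub>add_monoid Zq\<^esub> (m :: nat) = of_nat m * p" for m
  proof (induction m)
    case (Suc m)
    then show ?case
      unfolding nat_pow_Suc by (simp add: algebra_simps)
  qed simp
  have inv: "inv\<^bsub>add_monoid Zq\<^esub> x = - x" for x
    by (rule inv_equality) auto
  show ?thesis
  proof (cases k rule: int_cases2)
    case (nonneg m)
    then show ?thesis
      unfolding nonneg int_pow_int n by simp
  next
    case (nonpos m)
    have "p [^]\<^bsub>add_monoid Zq\<^esub> - int m = inv\<^bsub>add_monoid Zq\<^esub> (p [^]\<^bsub>add_monoid Zq\<^esub> m)"
      by (rule int_pow_neg_int) simp
    then show ?thesis
      unfolding nonpos n inv by simp
  qed
qed

locale fd_graded =
  fixes A :: "nat \<Rightarrow> 'a calg"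
  assumes fd_A: "fd_algebra (A n)"
begin

sublocale An: fd_alg "A n" for n
  by unfold_locales (rule fd_A)

text \<open>An element of the direct sum has finite support, so it is a finite product of its
  homogeneous components, and each component lies in a group generated by classes of
  modules.\<close>

lemma GA_hom_ext:
  assumes "group K" "h \<in> hom (GA A) K" "k \<in> hom (GA A) K" "x \<in> carrier (GA A)"
    and eq: "\<And>n M. M \<in> fg_modules (A n) \<Longrightarrow> h (in_degree A n (G0_class (A n) M)) = k (in_degree A n (G0_class (A n) M))"
  shows "h x = k x"
proof -
  interpret GA: comm_group "GA A" by (rule comm_group_GA)
  interpret h: group_hom "GA A" K h
    by (simp add: group_hom_def group_hom_axioms_def assms GA.is_group)
  interpret k: group_hom "GA A" K k
    by (simp add: group_hom_def group_hom_axioms_def assms GA.is_group)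
  interpret i: group_hom "G0 (A n)" "GA A" "in_degree A n" for n
    by (simp add: group_hom_def group_hom_axioms_def in_degree_hom group_G0 GA.is_group)
  have hom: "h (in_degree A n g) = k (in_degree A n g)" if "g \<in> carrier (G0 (A n))" for n g
    using that by (induction g rule: An.G0_induct) (auto simp: eq h.hom_inv k.hom_inv)
  have "\<forall>x \<in> carrier (GA A). {n. x n \<noteq> \<one>\<^bsub>G0 (A n)\<^esub>} \<subseteq> J \<longrightarrow> h x = k x" if "finite J" for J
    using that
  proof (induction J)
    case empty
    show ?case
    proof (intro ballI impI)
      fix x assume "{n. x n \<noteq> \<one>\<^bsub>G0 (A n)\<^esub>} \<subseteq> {}"
      then have "x n = \<one>\<^bsub>G0 (A n)\<^esub>" for n
        by simp
      then have "x = \<one>\<^bsub>GA A\<^esub>"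
        unfolding GA_simps by (rule ext)
      then show "h x = k x"
        by (simp only: h.hom_one k.hom_one)
    qed
  next
    case (insert j J)
    show ?case
    proof (intro ballI impI)
      fix x assume x: "x \<in> carrier (GA A)" "{n. x n \<noteq> \<one>\<^bsub>G0 (A n)\<^esub>} \<subseteq> insert j J"
      \<comment> \<open>One component is replaced by the neutral element and restored by multiplying
        with its image under \<open>in_degree\<close>.\<close>
      let ?y = "x(j := \<one>\<^bsub>G0 (A j)\<^esub>)"
      have xj: "x j \<in> carrier (G0 (A j))" "\<And>n. x n \<in> carrier (G0 (A n))"
        using x by (auto simp: carrier_GA)
      have "finite {n. ?y n \<noteq> \<one>\<^bsub>G0 (A n)\<^esub>}"
        by (rule finite_subset[of _ "{n. x n \<noteq> \<one>\<^bsub>G0 (A n)\<^esub>}"]) (use x in \<open>auto simp: carrier_GA\<close>)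
      then have y: "?y \<in> carrier (GA A)"
        using xj by (auto simp: carrier_GA G0_one)
      have ij: "in_degree A j (x j) \<in> carrier (GA A)"
        by (rule in_degree_closed) (rule xj(1))
      have split: "x = ?y \<otimes>\<^bsub>GA A\<^esub> in_degree A j (x j)"
        unfolding GA_simps using xj by (intro ext) (simp add: in_degree_def G0_one)
      have "{n. ?y n \<noteq> \<one>\<^bsub>G0 (A n)\<^esub>} \<subseteq> J"
        using x(2) by auto
      then have hy: "h ?y = k ?y"
        using insert.IH y by blast
      have "h x = h ?y \<otimes>\<^bsub>K\<^esub> h (in_degree A j (x j))"
        using arg_cong[OF split, of h] h.hom_mult[OF y ij] by (rule trans)
      also have "\<dots> = k ?y \<otimes>\<^bsub>K\<^esub> k (in_degree A j (x j))"
        by (simp only: hy hom[OF xj(1)])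
      also have "\<dots> = k x"
        using trans[OF arg_cong[OF split, of k] k.hom_mult[OF y ij]] by (rule sym)
      finally show "h x = k x" .
    qed
  qed
  moreover have "finite {n. x n \<noteq> \<one>\<^bsub>G0 (A n)\<^esub>}"
    using assms(4) by (simp add: carrier_GA)
  ultimately show ?thesis
    using assms(4) by blast
qed

sublocale GZ: tensor_pair \<Z> "int_module (GA A)" Zq_int_module
  by (rule tensor_pair_GA_Zq)

sublocale GG: tensor_pair \<Z> "int_module (GA A)" "int_module (GA A)"
  by (rule tensor_pair_GA_GA)

lemma gdim_component:
  "\<lbrakk>x \<in> carrier (GA A); y \<in> carrier (GA A)\<rbrakk> \<Longrightarrow>
    gdim (A n) ((x \<otimes>\<^bsub>GA A\<^esub> y) n) = gdim (A n) (x n) + gdim (A n) (y n)"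
  "x \<in> carrier (GA A) \<Longrightarrow> gdim (A n) ((x [^]\<^bsub>GA A\<^esub> (k :: int)) n) = of_int k * gdim (A n) (x n)"
proof -
  show "gdim (A n) ((x \<otimes>\<^bsub>GA A\<^esub> y) n) = gdim (A n) (x n) + gdim (A n) (y n)"
    if "x \<in> carrier (GA A)" "y \<in> carrier (GA A)"
    using that by (simp add: GA_simps An.gdim_mult carrier_GA)
  show "gdim (A n) ((x [^]\<^bsub>GA A\<^esub> k) n) = of_int k * gdim (A n) (x n)" if x: "x \<in> carrier (GA A)"
  proof -
    have "x n \<in> carrier (G0 (A n))"
      using x by (simp add: carrier_GA)
    from hom_int_pow[OF An.gdim_hom this group_G0 group_Zq, of k] show ?thesis
      unfolding GA_int_pow[OF x] int_pow_add_Zq .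
  qed
qed

section \<open>The dimension functionals on G(A)_q\<close>

lemma Gq_simps:
  "carrier (Gq A) = carrier GZ.T" "ring.add (Gq A) = monoid.mult GZ.T" "ring.zero (Gq A) = \<one>\<^bsub>GZ.T\<^esub>"
  "smult (Gq A) p = extend_gens GZ.T (\<lambda>(x, f). GZ.pt x (p * f))"
  by (simp_all add: Gq_def tensor_with_action_simps case_prod_unfold)

lemma
  shows Gq_smult_hom: "(\<lambda>t. p \<odot>\<^bsub>Gq A\<^esub> t) \<in> hom GZ.T GZ.T"
    and Gq_smult_pure: "x \<in> carrier (GA A) \<Longrightarrow> p \<odot>\<^bsub>Gq A\<^esub> Gq_pure A x f = Gq_pure A x (p * f)"
proof -
  have b: "GZ.pt (x [^]\<^bsub>GA A\<^esub> k) (p * f) = GZ.pt x (p * (of_int k * f))" if "x \<in> carrier (GA A)" for x f and k :: int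
    using GZ.pure_balanced[of x "p * f" k] that by (simp add: mult.left_commute)
  have a: "GZ.pt (x \<otimes>\<^bsub>GA A\<^esub> y) f = GZ.pt x f \<otimes>\<^bsub>GZ.T\<^esub> GZ.pt y f"
    "GZ.pt x (f + g) = GZ.pt x f \<otimes>\<^bsub>GZ.T\<^esub> GZ.pt x g" "GZ.pt x f \<in> carrier GZ.T"
    if "x \<in> carrier (GA A)" "y \<in> carrier (GA A)" for x y f g
    using that GZ.pure_add_left[of x f y] GZ.pure_add_right[of x f g] GZ.pure_closed[of x f] by simp_all
  show "(\<lambda>t. p \<odot>\<^bsub>Gq A\<^esub> t) \<in> hom GZ.T GZ.T"
    unfolding Gq_simps[abs_def]
    by (rule GZ.tensor_extend_hom[OF GZ.comm_group_tensor]) (auto simp: a b distrib_left)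
  show "p \<odot>\<^bsub>Gq A\<^esub> Gq_pure A x f = Gq_pure A x (p * f)" if "x \<in> carrier (GA A)"
    unfolding Gq_simps Gq_pure_def
    by (rule GZ.tensor_extend_pure[OF GZ.comm_group_tensor]) (use that in \<open>auto simp: a b distrib_left\<close>)
qed

lemma Gq_pure_closed: "x \<in> carrier (GA A) \<Longrightarrow> Gq_pure A x f \<in> carrier (Gq A)"
  using GZ.pure_closed[of x f] by (simp add: Gq_pure_def Gq_simps)

text \<open>This is D_n: the dimension of the degree n component, extended \<Z>[q]-linearly.\<close>

definition qdim :: "nat \<Rightarrow> 'a gq \<Rightarrow> int poly" where
  "qdim n = extend_gens (add_monoid Zq) (\<lambda>(x, f). gdim (A n) (x n) * f)"

lemma
  shows qdim_hom: "qdim n \<in> hom GZ.T (add_monoid Zq)"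
    and qdim_pure: "x \<in> carrier (GA A) \<Longrightarrow> qdim n (Gq_pure A x f) = gdim (A n) (x n) * f"
proof -
  show "qdim n \<in> hom GZ.T (add_monoid Zq)"
    unfolding qdim_def
    by (rule GZ.tensor_extend_hom[OF comm_group_Zq]) (auto simp: gdim_component algebra_simps)
  show "qdim n (Gq_pure A x f) = gdim (A n) (x n) * f" if "x \<in> carrier (GA A)"
    unfolding qdim_def Gq_pure_def
    by (rule GZ.tensor_extend_pure[OF comm_group_Zq]) (use that in \<open>auto simp: gdim_component algebra_simps\<close>)
qed

lemma qdim_add: "\<lbrakk>s \<in> carrier (Gq A); t \<in> carrier (Gq A)\<rbrakk> \<Longrightarrow> qdim n (s \<oplus>\<^bsub>Gq A\<^esub> t) = qdim n s + qdim n t"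
  using qdim_hom by (auto simp: hom_def Gq_simps)

lemma qdim_smult: "t \<in> carrier (Gq A) \<Longrightarrow> qdim n (p \<odot>\<^bsub>Gq A\<^esub> t) = p * qdim n t"
  unfolding Gq_simps(1)
proof (induction t rule: GZ.tensor_induct)
  case (pure x f)
  then show ?case
    using Gq_smult_pure[of x p f] by (simp add: qdim_pure flip: Gq_pure_def)
next
  case (add a b)
  have cl: "p \<odot>\<^bsub>Gq A\<^esub> a \<in> carrier GZ.T" "p \<odot>\<^bsub>Gq A\<^esub> b \<in> carrier GZ.T"
    "p \<odot>\<^bsub>Gq A\<^esub> (a \<otimes>\<^bsub>GZ.T\<^esub> b) = (p \<odot>\<^bsub>Gq A\<^esub> a) \<otimes>\<^bsub>GZ.T\<^esub> (p \<odot>\<^bsub>Gq A\<^esub> b)"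
    using Gq_smult_hom[of p] add by (auto simp: hom_def)
  then show ?case
    using add qdim_add[of a b] qdim_add[of "p \<odot>\<^bsub>Gq A\<^esub> a" "p \<odot>\<^bsub>Gq A\<^esub> b"]
    by (simp add: Gq_simps(1,2) distrib_left)
qed

lemma qdim_class:
  assumes "fg_module (A m) M"
  shows "qdim n (Gq_class A m M) = (if m = n then of_nat (mdim (A n) M) else 0)"
proof -
  have "qdim n (Gq_class A m M) = gdim (A n) (in_degree A m (G0_class (A m) M) n)"
    unfolding Gq_class_def
    using qdim_pure[OF in_degree_closed[where A = A, OF An.G0_class_closed[OF assms]], of n 1] by simp
  also have "\<dots> = (if m = n then of_nat (mdim (A n) M) else 0)"
    using An.gdim_class[OF assms] by (auto simp: in_degree_def An.gdim_one)
  finally show ?thesis .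
qed

lemma Gq_class_closed: "fg_module (A m) M \<Longrightarrow> Gq_class A m M \<in> carrier (Gq A)"
  by (simp add: Gq_class_def Gq_pure_closed in_degree_closed An.G0_class_closed)

text \<open>With this, \<open>qdim 1\<close> satisfies the vanishing condition imposed on d in
  \<open>pairing_coproduct_power\<close>.\<close>

lemma qdim_degree:
  assumes "x \<in> Gq_degree A m" "m \<noteq> n"
  shows "qdim n x = 0"
proof -
  have ab: "group (add_monoid (Gq A))"
    unfolding Gq_def using GZ.abelian_group_tensor by (rule abelian_group.a_group)
  have "qdim n x = (\<lambda>_. 0) x"
  proof (rule generate_hom_eqI[OF assms(1)[unfolded Gq_degree_def]])
    show "group_hom (add_monoid (Gq A)) (add_monoid Zq) (qdim n)"
      using ab group_Zq by (auto simp: group_hom_def group_hom_axioms_def hom_def qdim_add)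
    show "group_hom (add_monoid (Gq A)) (add_monoid Zq) (\<lambda>_. 0)"
      using ab group_Zq by (auto simp: group_hom_def group_hom_axioms_def hom_def)
  qed (use assms(2) in \<open>auto simp: Gq_pure_closed in_degree_closed qdim_pure\<close>,
      simp add: in_degree_def An.gdim_one)
  then show ?thesis
    by simp
qed

end

section \<open>Restriction preserves dimensions\<close>

context tower_of_algebras
begin

sublocale fd_graded A
  by unfold_locales (rule fd_algebra)

text \<open>That A_m \<otimes> A_n is a ring is read off from the projectivity axiom:
  \<open>projective\<close> includes \<open>left_module\<close>, and this includes the ring laws of
  the scalars.\<close>

lemma fd_alg_pair: "fd_alg_pair (A m) (A n)"
proof -
  have "left_module (tensor_algebra (A m) (A n)) (restrict_scalars (\<rho> m n) (regular_module (A (m + n))))"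
    by (rule projectiveD[OF left_projective])
  then show ?thesis
    by (simp add: fd_alg_pair_def fd_alg_pair_axioms_def left_module_def An.fd_alg_axioms)
qed

sublocale T: fd_alg_pair "A m" "A n" for m n
  by (rule fd_alg_pair)

text \<open>Since \<rho> is unital and complex linear, c times the unit acts on the restriction as
  it does on N. The two underlying spaces are even equal as records, so dimension and finite
  generation carry over.\<close>

lemma
  assumes N: "fg_module (A (m + n)) N"
  shows fg_restrict: "fg_module (tensor_algebra (A m) (A n)) (restrict_scalars (\<rho> m n) N)"
    and mdim_restrict: "mdim (tensor_algebra (A m) (A n)) (restrict_scalars (\<rho> m n) N) = mdim (A (m + n)) N"
proof -
  let ?T = "tensor_algebra (A m) (A n)" and ?A = "A (m + n)" and ?r = "\<rho> m n"
  interpret N: left_module ?A N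
    using N by (simp add: fg_module_def)
  have r: "?r s \<in> carrier ?A" "?r (s \<oplus>\<^bsub>?T\<^esub> t) = ?r s \<oplus>\<^bsub>?A\<^esub> ?r t" "?r (s \<otimes>\<^bsub>?T\<^esub> t) = ?r s \<otimes>\<^bsub>?A\<^esub> ?r t"
    "?r \<one>\<^bsub>?T\<^esub> = \<one>\<^bsub>?A\<^esub>" "?r (c \<odot>\<^bsub>?T\<^esub> s) = c \<odot>\<^bsub>?A\<^esub> ?r s"
    if "s \<in> carrier ?T" "t \<in> carrier ?T" for s t c
  proof -
    have h: "?r \<in> Ring.ring_hom ?T ?A" and l: "?r \<in> module_hom complex_ring ?T ?A"
      using rho_hom[of m n] unfolding alg_hom_def by blast+
    show "?r s \<in> carrier ?A" "?r (s \<oplus>\<^bsub>?T\<^esub> t) = ?r s \<oplus>\<^bsub>?A\<^esub> ?r t" "?r (s \<otimes>\<^bsub>?T\<^esub> t) = ?r s \<otimes>\<^bsub>?A\<^esub> ?r t"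
      "?r \<one>\<^bsub>?T\<^esub> = \<one>\<^bsub>?A\<^esub>"
      by (rule ring_hom_closed[OF h that(1)], rule ring_hom_add[OF h that], rule ring_hom_mult[OF h that],
          rule ring_hom_one[OF h])
    show "?r (c \<odot>\<^bsub>?T\<^esub> s) = c \<odot>\<^bsub>?A\<^esub> ?r s"
      by (rule module_hom_smult[OF l _ that(1)]) simp
  qed
  have lm: "left_module ?T (restrict_scalars ?r N)"
  proof -
    have "abelian_group (restrict_scalars ?r N)"
      by (rule comm_group_abelian_groupI, rule comm_group_cong[OF N.a_comm_group]) auto
    moreover have "left_module_axioms ?T (restrict_scalars ?r N)"
    proof
      fix s x assume s: "s \<in> carrier ?T" and "x \<in> carrier (restrict_scalars ?r N)"
      then have x: "x \<in> carrier N"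
        by simp
      show "s \<odot>\<^bsub>restrict_scalars ?r N\<^esub> x \<in> carrier (restrict_scalars ?r N)"
        using s x r(1)[OF s s] by (simp add: N.smult_closed)
      show "(s \<oplus>\<^bsub>?T\<^esub> t) \<odot>\<^bsub>restrict_scalars ?r N\<^esub> x =
        s \<odot>\<^bsub>restrict_scalars ?r N\<^esub> x \<oplus>\<^bsub>restrict_scalars ?r N\<^esub> t \<odot>\<^bsub>restrict_scalars ?r N\<^esub> x"
        if t: "t \<in> carrier ?T" for t
        using x r(1)[OF s s] r(1)[OF t t] r(2)[OF s t] by (simp add: N.smult_l_distr del: T.TA_simps)
      show "(s \<otimes>\<^bsub>?T\<^esub> t) \<odot>\<^bsub>restrict_scalars ?r N\<^esub> x =
        s \<odot>\<^bsub>restrict_scalars ?r N\<^esub> (t \<odot>\<^bsub>restrict_scalars ?r N\<^esub> x)"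
        if t: "t \<in> carrier ?T" for t
        using x r(1)[OF s s] r(1)[OF t t] r(3)[OF s t] by (simp add: N.smult_assoc del: T.TA_simps)
      show "s \<odot>\<^bsub>restrict_scalars ?r N\<^esub> (x \<oplus>\<^bsub>restrict_scalars ?r N\<^esub> y) =
        s \<odot>\<^bsub>restrict_scalars ?r N\<^esub> x \<oplus>\<^bsub>restrict_scalars ?r N\<^esub> s \<odot>\<^bsub>restrict_scalars ?r N\<^esub> y"
        if "y \<in> carrier (restrict_scalars ?r N)" for y
        using x that r(1)[OF s s] by (simp add: N.smult_r_distr)
    next
      fix x assume "x \<in> carrier (restrict_scalars ?r N)"
      then show "\<one>\<^bsub>?T\<^esub> \<odot>\<^bsub>restrict_scalars ?r N\<^esub> x = x"
        using r(4)[OF T.TA.one_closed T.TA.one_closed] by (simp add: N.smult_one del: T.TA_simps)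
    qed
    ultimately show ?thesis
      by (simp add: left_module_def T.ring_tensor)
  qed
  have "?r (c \<odot>\<^bsub>?T\<^esub> \<one>\<^bsub>?T\<^esub>) = c \<odot>\<^bsub>?A\<^esub> \<one>\<^bsub>?A\<^esub>" for c
    using r(4,5)[OF T.TA.one_closed T.TA.one_closed] by (simp del: T.TA_simps)
  then have "underlying_space ?T (restrict_scalars ?r N) = underlying_space ?A N"
    by (simp add: underlying_space_def restrict_scalars_def with_action_def del: T.TA_simps)
  then show "fg_module ?T (restrict_scalars ?r N)" "mdim ?T (restrict_scalars ?r N) = mdim ?A N"
    using N lm by (simp_all add: T.TA.fg_iff An.fg_iff mdim_def)
qed

text \<open>The condition \<open>usual_coproduct\<close> describes \<delta> through the components
  \<open>GA_canonical\<close>. The product of two dimensions factors through these components, and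
  on the class of a module they are restrictions, which keep the dimension.\<close>

lemma usual_coproduct_dim:
  assumes \<delta>: "usual_coproduct A \<rho> \<delta>" and x: "x \<in> carrier (GA A)"
  shows "extend_gens (add_monoid Zq) (\<lambda>(y, z). gdim (A k) (y k) * gdim (A l) (z l)) (\<delta> x) =
    gdim (A (k + l)) (x (k + l))"
proof -
  let ?K = "extend_gens (add_monoid Zq) (\<lambda>(y, z). gdim (A k) (y k) * gdim (A l) (z l))"
  let ?T = "tensor_algebra (A k) (A l)"
  have K: "?K \<in> hom GG.T (add_monoid Zq)"
    by (rule GG.tensor_extend_hom[OF comm_group_Zq])
      (auto simp: gdim_component algebra_simps)
  have \<delta>_cl: "\<delta> y \<in> carrier GG.T" and \<delta>_add: "z \<in> carrier (GA A) \<Longrightarrow> \<delta> (y \<otimes>\<^bsub>GA A\<^esub> z) = \<delta> y \<otimes>\<^bsub>GG.T\<^esub> \<delta> z"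
    if "y \<in> carrier (GA A)" for y z
    using \<delta> that unfolding usual_coproduct_def module_hom_def
    by (auto simp: tensor_module_def tensor_with_action_simps)
  \<comment> \<open>The product of the dimensions in degrees k and l is the dimension of the outer
    tensor product, by \<open>gdim_outer\<close>.\<close>
  have canon: "?K u = gdim ?T (GA_canonical A k l u)" if u: "u \<in> carrier GG.T" for u
  proof -
    have u': "u \<in> carrier (presented_group (carrier (int_module (GA A)) \<times> carrier (int_module (GA A)))
        (tensor_rels \<Z> (int_module (GA A)) (int_module (GA A))))"
      using u by (simp add: tensor_group_def)
    have c: "G0_outer (A k) (A l) (y k) (z l) \<in> carrier (G0 ?T)"
      "gdim ?T (G0_outer (A k) (A l) (y k) (z l)) = gdim (A k) (y k) * gdim (A l) (z l)"
      if "y \<in> carrier (GA A)" "z \<in> carrier (GA A)" for y z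
      using that T.gdim_outer[of "y k" k "z l" l] by (auto simp: carrier_GA)
    have "gdim ?T (GA_canonical A k l u) =
        extend_gens (add_monoid Zq) (gdim ?T \<circ> (\<lambda>(y, z). G0_outer (A k) (A l) (y k) (z l))) u"
      unfolding GA_canonical_def
      by (rule GG.extend_gens_comp_hom[OF comm_group_G0 comm_group_Zq T.TA.gdim_hom _ u']) (use c in auto)
    also have "\<dots> = ?K u"
      by (rule GG.extend_gens_cong[OF comm_group_Zq _ u']) (use c in auto)
    finally show ?thesis ..
  qed
  show ?thesis
  proof (rule GA_hom_ext[of "add_monoid Zq" "\<lambda>x. ?K (\<delta> x)" "\<lambda>x. gdim (A (k + l)) (x (k + l))"])
    show "group (add_monoid Zq)"
      by (rule group_Zq)
    show "(\<lambda>x. ?K (\<delta> x)) \<in> hom (GA A) (add_monoid Zq)"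
      using K \<delta>_cl \<delta>_add by (auto simp: hom_def)
    show "(\<lambda>x. gdim (A (k + l)) (x (k + l))) \<in> hom (GA A) (add_monoid Zq)"
      by (auto simp: hom_def gdim_component)
    show "x \<in> carrier (GA A)" by (rule x)
    fix n M assume M: "M \<in> fg_modules (A n)"
    then have fg: "fg_module (A n) M"
      by (simp add: fg_modules_def)
    let ?x = "in_degree A n (G0_class (A n) M)"
    have "?x \<in> carrier (GA A)"
      by (rule in_degree_closed) (rule An.G0_class_closed[OF fg])
    then have "?K (\<delta> ?x) = gdim ?T (GA_canonical A k l (\<delta> ?x))"
      by (rule canon[OF \<delta>_cl])
    also have "GA_canonical A k l (\<delta> ?x) =
        (if k + l = n then G0_class ?T (restrict_scalars (\<rho> k l) M) else \<one>\<^bsub>G0 ?T\<^esub>)"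
      using \<delta> M unfolding usual_coproduct_def by blast
    \<comment> \<open>For k + l different from n both sides are zero: on the left the component is
      neutral, on the right so is the entry of \<open>in_degree\<close>.\<close>
    also have "gdim ?T \<dots> = gdim (A (k + l)) (?x (k + l))"
      using fg fg_restrict[of k l M] mdim_restrict[of k l M]
      by (auto simp: in_degree_def T.TA.gdim_class T.TA.gdim_one An.gdim_class An.gdim_one)
    finally show "?K (\<delta> ?x) = gdim (A (k + l)) (?x (k + l))" .
  qed
qed

end

section \<open>The Hilbert series of the graded tower\<close>

lemma Gq_algebra_simps:
  "carrier (Gq_algebra A star) = carrier (Gq A)" "ring.zero (Gq_algebra A star) = ring.zero (Gq A)"
  "ring.add (Gq_algebra A star) = ring.add (Gq A)" "smult (Gq_algebra A star) = smult (Gq A)"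
  "\<one>\<^bsub>Gq_algebra A star\<^esub> = Gq_class A 0 (regular_module (A 0))"
  by (simp_all add: Gq_algebra_def)

lemma module_Gq: "Module.module Zq (Gq_algebra A star) \<Longrightarrow> Module.module Zq (Gq A)"
proof -
  assume "Module.module Zq (Gq_algebra A star)"
  then interpret H: Module.module Zq "Gq_algebra A star" .
  have "left_module Zq (Gq A)"
    by (rule left_module.left_module_image[OF left_module_of_module[OF H.module_axioms], of "\<lambda>x. x"])
      (simp_all add: Gq_algebra_simps)
  then show ?thesis
    by (rule module_of_left_module) (rule class_cring.cring_axioms)
qed

lemma dim_field: "vectorspace.dim K (regular_module K) = 1" "fd_space K (regular_module K)" if "field K"
proof -
  interpret K: field K by fact
  have m: "Module.module K (regular_module K)"
    by (rule K.module_regular)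
  interpret V: vectorspace K "regular_module K"
    by (simp add: vectorspace_def m K.field_axioms)
  have one: "{\<one>\<^bsub>K\<^esub>} \<subseteq> carrier (regular_module K)"
    by simp
  have "V.span {\<one>\<^bsub>K\<^esub>} = carrier (regular_module K)"
  proof (intro equalityI subsetI)
    fix x assume "x \<in> carrier (regular_module K)"
    then have x: "x \<in> carrier K"
      by simp
    have "\<one>\<^bsub>K\<^esub> \<in> V.span {\<one>\<^bsub>K\<^esub>}"
      using V.in_own_span[OF one] by blast
    then have "x \<odot>\<^bsub>regular_module K\<^esub> \<one>\<^bsub>K\<^esub> \<in> V.span {\<one>\<^bsub>K\<^esub>}"
      using V.span_is_submodule[OF one] x unfolding LinearCombinations.submodule_def by blast
    then show "x \<in> V.span {\<one>\<^bsub>K\<^esub>}"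
      using x by simp
  qed (use V.span_is_subset2[OF one] in blast)
  then show "V.dim = 1" "fd_space K (regular_module K)"
    using V.dim1I[of "\<one>\<^bsub>K\<^esub>"] V.vectorspace_axioms one
    by (auto simp: fd_space_def V.fin_dim_def intro!: exI[of _ "{\<one>\<^bsub>K\<^esub>}"])
qed

section \<open>Dimensions of the powers of \<beta>\<close>

context tower_of_algebras
begin

lemma dim_degree_zero: "vectorspace.dim complex_ring (A 0) = 1"
proof -
  obtain h where h: "h \<in> alg_hom ground_algebra (A 0)" "bij_betw h UNIV (carrier (A 0))"
    using degree_zero by blast
  have "h \<in> module_hom complex_ring (regular_module complex_ring) (A 0)"
    using h(1) by (auto simp: alg_hom_def ground_algebra_def)
  then show ?thesis
    using dim_iso[OF dim_field(2)[OF class_field] An.AV.vectorspace_axioms] h(2) dim_field(1)[OF class_field]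
    by simp
qed

lemma functional_qdim: "functional (Gq A) (qdim n)"
  unfolding functional_def module_hom_def
  by (simp add: qdim_add qdim_smult)

text \<open>The identity (D_k \<otimes> D_l) \<circ> \<Delta> = D_(k+l) holds on x \<otimes> 1 by
  the integral statement for \<delta>; linearity and additivity extend it to all of G(A)_q.\<close>

lemma coproduct_qdim:
  assumes \<Delta>: "coproduct_q A \<rho> \<Delta>" and module: "Module.module Zq (Gq A)" and t: "t \<in> carrier (Gq A)"
  shows "pairing (qdim k) (qdim l) (\<Delta> t) = qdim (k + l) t"
proof -
  interpret M: Module.module Zq "Gq A" by (rule module)
  interpret TT: tensor_modules Zq "Gq A" "Gq A" by unfold_locales
  obtain \<delta> where \<delta>: "usual_coproduct A \<rho> \<delta>"
    and lin: "\<Delta> \<in> module_hom Zq (Gq A) TT.TM"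
    and pure: "\<And>x. x \<in> carrier (GA A) \<Longrightarrow> \<Delta> (Gq_pure A x 1) =
      tensor_lift TT.TM (\<lambda>y z. TT.pt (Gq_pure A y 1) (Gq_pure A z 1)) (\<delta> x)"
    using \<Delta> unfolding coproduct_q_def by blast
  let ?p = "pairing (qdim k) (qdim l)"
  note fn = functional_qdim[of k] functional_qdim[of l]
  have cl: "\<Delta> s \<in> carrier TT.T" if "s \<in> carrier (Gq A)" for s
    using lin that by (auto simp: module_hom_def TT.TM_simps)
  have pure_one: "?p (\<Delta> (Gq_pure A x 1)) = gdim (A (k + l)) (x (k + l))" if x: "x \<in> carrier (GA A)" for x
  proof -
    have dx: "\<delta> x \<in> carrier GG.T"
      using \<delta> x unfolding usual_coproduct_def module_hom_def
      by (auto simp: tensor_module_def tensor_with_action_simps)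
    then have dx': "\<delta> x \<in> carrier (presented_group (carrier (int_module (GA A)) \<times> carrier (int_module (GA A)))
        (tensor_rels \<Z> (int_module (GA A)) (int_module (GA A))))"
      by (simp add: tensor_group_def)
    have pc: "Gq_pure A y 1 \<in> carrier (Gq A)" if "y \<in> carrier (GA A)" for y
      using that by (rule Gq_pure_closed)
    have "?p \<in> hom (add_monoid TT.TM) (add_monoid Zq)"
      using pairing_hom[OF module fn] by (auto simp: hom_def TT.TM_simps)
    then have "?p (\<Delta> (Gq_pure A x 1)) =
      extend_gens (add_monoid Zq) (\<lambda>(y, z). ?p (TT.pt (Gq_pure A y 1) (Gq_pure A z 1))) (\<delta> x)"
      unfolding pure[OF x]
      by (intro GG.tensor_lift_comp_hom[OF Module.module.axioms(2)[OF TT.module_TM] comm_group_Zq])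
        (use pc dx in \<open>auto simp: TT.TM_simps TT.pure_closed\<close>)
    also have "\<dots> = extend_gens (add_monoid Zq) (\<lambda>(y, z). gdim (A k) (y k) * gdim (A l) (z l)) (\<delta> x)"
      by (rule GG.extend_gens_cong[OF comm_group_Zq _ dx'])
        (auto simp: pairing_pure[OF module fn] pc qdim_pure)
    also have "\<dots> = gdim (A (k + l)) (x (k + l))"
      by (rule usual_coproduct_dim[OF \<delta> x])
    finally show ?thesis .
  qed
  show ?thesis
    using t unfolding Gq_simps
  proof (induction t rule: GZ.tensor_induct)
    case (pure x f)
    then have x: "x \<in> carrier (GA A)"
      by simp
    note c = Gq_pure_closed[OF x, of 1]
    \<comment> \<open>The link between \<Delta> and \<delta> is prescribed on elements x \<otimes> 1
      only, so the polynomial is taken out as a scalar.\<close>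
    have "Gq_pure A x f = f \<odot>\<^bsub>Gq A\<^esub> Gq_pure A x 1"
      using Gq_smult_pure[OF x, of f 1] by simp
    moreover have "\<Delta> (f \<odot>\<^bsub>Gq A\<^esub> Gq_pure A x 1) = f \<odot>\<^bsub>TT.TM\<^esub> \<Delta> (Gq_pure A x 1)"
      by (rule module_hom_smult[OF lin _ c]) simp
    ultimately have "?p (\<Delta> (Gq_pure A x f)) = f * gdim (A (k + l)) (x (k + l))"
      by (simp add: pairing_smult[OF module fn cl[OF c]] pure_one[OF x])
    also have "\<dots> = qdim (k + l) (Gq_pure A x f)"
      using qdim_pure[OF x] by (simp add: mult.commute)
    finally show ?case
      by (simp add: Gq_pure_def)
  next
    case (add a b)
    then have ab: "a \<in> carrier (Gq A)" "b \<in> carrier (Gq A)"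
      by (simp_all add: Gq_simps)
    have "\<Delta> (a \<oplus>\<^bsub>Gq A\<^esub> b) = \<Delta> a \<otimes>\<^bsub>TT.T\<^esub> \<Delta> b"
      using module_hom_add[OF lin ab] by (simp add: TT.TM_simps)
    then have "?p (\<Delta> (a \<oplus>\<^bsub>Gq A\<^esub> b)) = qdim (k + l) (a \<oplus>\<^bsub>Gq A\<^esub> b)"
      using add.IH ab
      by (simp add: pairing_add[OF module fn] cl qdim_add)
    then show ?case
      by (simp add: Gq_simps)
  qed
qed

text \<open>Writing D_(n+1) as D_n \<otimes> D_1 after \<Delta>, the pairing formula with \<phi> =
  D_n gives D_(n+1)(\<beta>^(n+1)) = [n+1] D_n(\<beta>^n) D_1(\<beta>). The recursion starts from
  the unit, the class of A_0, which has dimension one.\<close>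

lemma qdim_power:
  assumes \<Delta>: "coproduct_q A \<rho> \<Delta>"
    and hopf: "q_twisted_hopf_algebra (Gq_algebra A star) (Gq_degree A) \<Delta>"
    and \<beta>: "\<beta> \<in> Gq_degree A 1"
  shows "qdim n (\<beta> [^]\<^bsub>Gq_algebra A star\<^esub> n) = q_fact n * qdim 1 \<beta> ^ n"
proof (induction n)
  case 0
  have "qdim 0 (Gq_class A 0 (regular_module (A 0))) = 1"
    using qdim_class[OF An.fg_regular, of 0 0]
    by (simp add: An.mdim_regular dim_degree_zero)
  then show ?case
    by (simp add: q_fact_def Gq_algebra_simps nat_pow_def)
next
  case (Suc n)
  let ?H = "Gq_algebra A star"
  have mH: "Module.module Zq ?H" and rH: "ring ?H"
    using hopf by (auto simp: q_twisted_hopf_algebra_def)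
  interpret H: ring ?H by (rule rH)
  have \<beta>H: "\<beta> \<in> carrier ?H"
    by (rule q_twisted_hopf_algebra.Hn_closed[OF hopf \<beta>])
  have fn: "functional ?H (qdim m)" for m
    using functional_qdim[of m] by (simp add: functional_def module_hom_def Gq_algebra_simps)
  have "\<beta> [^]\<^bsub>?H\<^esub> Suc n \<in> carrier (Gq A)"
    using H.nat_pow_closed[OF \<beta>H, of "Suc n"] by (simp add: Gq_algebra_simps)
  then have "qdim (n + 1) (\<beta> [^]\<^bsub>?H\<^esub> Suc n) = pairing (qdim n) (qdim 1) (\<Delta> (\<beta> [^]\<^bsub>?H\<^esub> Suc n))"
    by (rule coproduct_qdim[OF \<Delta> module_Gq[OF mH], symmetric])
  also have "\<dots> = q_int (Suc n) * (qdim n (\<beta> [^]\<^bsub>?H\<^esub> (Suc n - 1)) * qdim 1 \<beta>)"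
    by (rule q_twisted_hopf_algebra.pairing_coproduct_power[OF hopf \<beta> fn _ fn])
      (rule qdim_degree)
  finally show ?case
    using Suc by (simp add: q_fact_Suc mult_ac)
qed

lemma gdim_beta:
  assumes "\<And>i. i < t \<Longrightarrow> fg_module (A n) (S i)"
  shows "beta (A n) t S P \<in> carrier (G0 (A n))"
    "gdim (A n) (beta (A n) t S P) = of_nat (\<Sum>i<t. mdim (A n) (S i) * mdim (A n) (P i))"
proof -
  interpret G: comm_group "G0 (A n)" by (rule comm_group_G0)
  let ?f = "\<lambda>i. G0_class (A n) (S i) [^]\<^bsub>G0 (A n)\<^esub> mdim (A n) (P i)"
  have f: "?f i \<in> carrier (G0 (A n))" if "i < t" for i
    using assms[OF that] by (simp add: An.G0_class_closed)
  have pow: "gdim (A n) (x [^]\<^bsub>G0 (A n)\<^esub> (m :: nat)) = of_nat m * gdim (A n) x" if "x \<in> carrier (G0 (A n))" for x m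
    using that by (induction m) (simp_all add: An.gdim_one An.gdim_mult algebra_simps)
  have "finprod (G0 (A n)) ?f {..<s} \<in> carrier (G0 (A n)) \<and>
      gdim (A n) (finprod (G0 (A n)) ?f {..<s}) = of_nat (\<Sum>i<s. mdim (A n) (S i) * mdim (A n) (P i))"
    if "s \<le> t" for s
    using that
  proof (induction s)
    case (Suc s)
    then have "finprod (G0 (A n)) ?f {..<Suc s} = ?f s \<otimes>\<^bsub>G0 (A n)\<^esub> finprod (G0 (A n)) ?f {..<s}"
      using f by (simp add: lessThan_Suc Pi_iff)
    then show ?case
      using Suc f[of s] assms[of s]
      by (simp add: An.gdim_mult pow An.G0_class_closed An.gdim_class algebra_simps)
  qed (simp add: An.gdim_one)
  from this[OF order_refl]
  show "beta (A n) t S P \<in> carrier (G0 (A n))"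
    "gdim (A n) (beta (A n) t S P) = of_nat (\<Sum>i<t. mdim (A n) (S i) * mdim (A n) (P i))"
    by (simp_all add: beta_def)
qed

end

section \<open>The graded pieces of the filtration\<close>

context filtered_tower
begin

lemma
  shows fg_gr_module: "fg_module (A n) (gr_module A F n i)"
    and mdim_gr_module_le: "mdim (A n) (gr_module A F n i) \<le> vectorspace.dim complex_ring (A n)"
proof -
  let ?M = "(regular_module (A n))\<lparr>carrier := F n i\<rparr>"
  have M: "fg_module (A n) ?M"
    by (rule An.fg_sub[OF An.fg_regular filtration_left_ideal])
  have N: "Module.submodule (F n (Suc i)) (A n) ?M"
    by (rule submodule_nested[OF An.left_module_regular filtration_left_ideal filtration_left_ideal filtration_Suc])
  show "fg_module (A n) (gr_module A F n i)"
    unfolding gr_module_def by (rule An.fg_quotient[OF M N])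
  have "mdim (A n) (gr_module A F n i) \<le> mdim (A n) ?M"
    using An.mdim_quotient[OF M N] by (simp add: gr_module_def)
  also have "\<dots> \<le> vectorspace.dim complex_ring (A n)"
    using An.mdim_sub_le[OF An.fg_regular filtration_left_ideal] by (simp add: An.mdim_regular)
  finally show "mdim (A n) (gr_module A F n i) \<le> vectorspace.dim complex_ring (A n)" .
qed

lemma qdim_filtered_class:
  assumes module: "Module.module Zq (Gq A)"
  shows "qdim n (Gq_filtered_class A F n) = (\<Sum>i \<in> jumps F n. qvar ^ i * of_nat (mdim (A n) (gr_module A F n i)))"
proof -
  interpret M: Module.module Zq "Gq A" by (rule module)
  let ?f = "\<lambda>i. qvar ^ i \<odot>\<^bsub>Gq A\<^esub> Gq_class A n (gr_module A F n i)"
  have c: "Gq_class A n (gr_module A F n i) \<in> carrier (Gq A)" for i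
    by (rule Gq_class_closed[OF fg_gr_module])
  then have f: "?f i \<in> carrier (Gq A)" for i
    by (intro M.smult_closed) auto
  have q: "qdim n (?f i) = qvar ^ i * of_nat (mdim (A n) (gr_module A F n i))" for i
    by (simp add: qdim_smult[OF c] qdim_class[OF fg_gr_module])
  have zero: "qdim n \<zero>\<^bsub>Gq A\<^esub> = 0"
    using qdim_add[OF M.zero_closed M.zero_closed, of n] by simp
  \<comment> \<open>For infinite J both sums are zero by convention, so the formula holds for every
    index set.\<close>
  have "qdim n (finsum (Gq A) ?f J) = (\<Sum>i \<in> J. qvar ^ i * of_nat (mdim (A n) (gr_module A F n i)))" for J
  proof (induction J rule: infinite_finite_induct)
    case (infinite J)
    then show ?case
      using zero by (simp add: M.finsum_infinite)
  next
    case (insert i J)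
    then have "finsum (Gq A) ?f (insert i J) = ?f i \<oplus>\<^bsub>Gq A\<^esub> finsum (Gq A) ?f J"
      using f by (intro M.finsum_insert) auto
    then show ?case
      using insert f by (simp add: qdim_add q M.finsum_closed)
  qed (simp add: zero)
  then show ?thesis
    by (simp add: Gq_filtered_class_def)
qed

end

theorem theorem7p2:
  fixes A :: "nat \<Rightarrow> (complex, 'a) module"
    and \<rho> :: "nat \<Rightarrow> nat \<Rightarrow> ('a, 'a) tensor \<Rightarrow> 'a"
    and F :: "nat \<Rightarrow> nat \<Rightarrow> 'a set"
    and star :: "'a gq \<Rightarrow> 'a gq \<Rightarrow> 'a gq"
    and \<Delta> :: "'a gq \<Rightarrow> ('a gq, 'a gq) tensor"
    and t :: nat
    and S :: "nat \<Rightarrow> ('a, 's) module"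
    and P :: "nat \<Rightarrow> ('a, 'p) module"
  assumes tower: "filtered_tower A \<rho> F"
    and simples: "simple_modules_list (A 1) t S"
    and covers: "\<And>i. i < t \<Longrightarrow> projective_cover (A 1) (P i) (S i)"
    and quantization: "quantizes A \<rho> star"
    and Q1: "\<And>x y z. \<lbrakk>x \<in> carrier (Gq A); y \<in> carrier (Gq A); z \<in> carrier (Gq A)\<rbrakk> \<Longrightarrow>
      star (star x y) z = star x (star y z)"
    and coproduct: "coproduct_q A \<rho> \<Delta>"
    and Q2: "q_twisted_hopf_algebra (Gq_algebra A star) (Gq_degree A) \<Delta>"
    and Q3: "\<And>n. Gq_pure A (in_degree A 1 (beta (A 1) t S P)) 1 [^]\<^bsub>Gq_algebra A star\<^esub> (n :: nat) =
      Gq_filtered_class A F n"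
  shows "\<forall>n. (\<Sum>i \<in> jumps F n. qvar ^ i * of_nat (mdim (A n) (gr_module A F n i))) =
    of_nat (vectorspace.dim complex_ring (A 1)) ^ n * q_fact n"
proof -
  interpret filtered_tower A \<rho> F by (rule tower)
  let ?\<beta> = "Gq_pure A (in_degree A 1 (beta (A 1) t S P)) 1"
  let ?h = "\<lambda>n. \<Sum>i \<in> jumps F n. qvar ^ i * of_nat (mdim (A n) (gr_module A F n i))"
  \<comment> \<open>This is D_1(\<beta>). It stands in for dim A_1 until the two are shown to be
    equal.\<close>
  define c where "c = (\<Sum>i<t. mdim (A 1) (S i) * mdim (A 1) (P i))"
  have "fg_module (A 1) (S i)" if "i < t" for i
    using simples that by (auto simp: simple_modules_list_def intro: simple_module_fg)
  note b = gdim_beta[of t 1 S P, OF this]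
  have b': "in_degree A 1 (beta (A 1) t S P) \<in> carrier (GA A)"
    by (rule in_degree_closed) (rule b(1))
  have \<beta>: "?\<beta> \<in> Gq_degree A 1"
    unfolding Gq_degree_def by (rule generate.incl) (use b(1) in blast)
  have q\<beta>: "qdim 1 ?\<beta> = of_nat c"
    unfolding qdim_pure[OF b'] using b(2) by (simp add: in_degree_def c_def)
  have mod: "Module.module Zq (Gq A)"
    using Q2 by (auto simp: q_twisted_hopf_algebra_def intro: module_Gq)
  have main: "?h n = q_fact n * of_nat c ^ n" for n
    using qdim_power[OF coproduct Q2 \<beta>, of n] qdim_filtered_class[OF mod, of n] Q3[of n] q\<beta> by simp
  \<comment> \<open>For n = 1 the formula says that the polynomial \<open>?h 1\<close> is the
    constant c; evaluation at q = 0 isolates the quotient of A_1 by the first step of its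
    filtration.\<close>
  have "poly (?h 1) 0 = int c"
    using main[of 1] by (simp add: q_fact_def q_int_def)
  moreover have "poly (?h 1) 0 = (\<Sum>i \<in> jumps F 1. if i = 0 then int (mdim (A 1) (gr_module A F 1 i)) else 0)"
    by (auto simp: poly_sum qvar_def power_0_left intro!: sum.cong)
  \<comment> \<open>The sum is zero if 0 is not a jump, or by convention if there are infinitely
    many jumps; hence an inequality, which is all that the upper bound for c requires.\<close>
  moreover have "\<dots> \<le> int (mdim (A 1) (gr_module A F 1 0))"
    by (cases "finite (jumps F 1)") (auto simp: sum.delta)
  ultimately have "c \<le> vectorspace.dim complex_ring (A 1)"
    using mdim_gr_module_le[of 1 0] by linarith
  moreover have "vectorspace.dim complex_ring (A 1) \<le> c"
    unfolding c_def by (rule An.dim_le_sum_simples[OF simples covers])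
  ultimately show ?thesis
    using main by (simp add: mult.commute)
qed

end
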